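(* Let $n\ge 1$ be an integer, $\beta\in\mathbb{R}$, $b_0>0$ and $p>1$, with $p\le \frac{n}{n-2}$ if $n\ge 3$. Assume that $$(u_0,u_1)\in \big(L^1(\mathbb{R}^n)\cap H^1(\mathbb{R}^n)\big)\times\big(L^1(\mathbb{R}^n)\cap L^2(\mathbb{R}^n)\big)$$ satisfies $$\int_{\mathbb{R}^n}u_1(x)\,dx>0.$$ If $$\begin{cases}1<p\le \dfrac{n+1}{(n-1)_+} & \text{if } \beta\ge -1,\\[2mm] 1<p\le \dfrac{n(1-\beta)+2}{(n(1-\beta)-2)_+} & \text{if } \beta\le -1,\end{cases}$$ then the mild solution of the Cauchy problem $$u_{tt}-\Delta u-\frac{b_0}{(1+t)^{\beta}}\Delta u_t=|u|^p\quad (x\in\mathbb{R}^n,\ t>0),\qquad u(0,x)=u_0(x),\quad u_t(0,x)=u_1(x)\quad (x\in\mathbb{R}^n)$$ blows up in finite time.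
   Context: All functions are real-valued. $(a)_+:=\max\{0,a\}$; when the denominator $(\cdot)_+$ equals $0$ the upper bound on $p$ is read as $+\infty$, i.e. the condition is $1<p<\infty$. Solution operators. Consider the linear homogeneous equation $w_{tt}-\Delta w-\frac{b_0}{(1+t)^{\beta}}\Delta w_t=0$. For $s\ge 0$ and $(g_0,g_1)\in H^2(\mathbb{R}^n)\times H^2(\mathbb{R}^n)$, let $R(t,s)(g_0,g_1)$, $t\ge s$, denote the value at time $t$ of the unique strong solution $w\in C^1([s,\infty);H^2(\mathbb{R}^n))\cap C^2([s,\infty);L^2(\mathbb{R}^n))$ (equation satisfied in the sense of $L^2(\mathbb{R}^n)$) with $w(s)=g_0$, $w_t(s)=g_1$. By the energy estimates, $R(\cdot,s)$ extends uniquely by density to an operator from $H^1(\mathbb{R}^n)\times L^2(\mathbb{R}^n)$ to $C([s,\infty);H^1(\mathbb{R}^n))\cap C^1([s,\infty);L^2(\mathbb{R}^n))$. Set $S(t,s)g:=R(t,s)(0,g)$. Mild solution. A function $u\in C([0,T];H^1(\mathbb{R}^n))\cap C^1([0,T];L^2(\mathbb{R}^n))$ is a mild solution on $[0,T]$ of the Cauchy problem if $u(0)=u_0$, $u_t(0)=u_1$ and $$u(t)=R(t,0)(u_0,u_1)+\int_0^tS(t,s)|u(s)|^p\,ds$$ in the sense of $H^1(\mathbb{R}^n)$, for $t\in[0,T]$. It is global if $T>0$ can be chosen arbitrarily large. Under the stated assumptions on $p$ and for $(u_0,u_1)\in H^1(\mathbb{R}^n)\times L^2(\mathbb{R}^n)$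 there is a unique maximal mild solution $u\in C([0,T_{\max});H^1(\mathbb{R}^n))\cap C^1([0,T_{\max});L^2(\mathbb{R}^n))$, $0<T_{\max}\le\infty$. "The mild solution blows up in finite time" means that it is not global, i.e. $T_{\max}<\infty$, in which case $\|u(t)\|_{H^1}+\|u_t(t)\|_{L^2}\to\infty$ as $t\to T_{\max}$. *)

theory Defs
  imports "HOL-Analysis.Analysis"
begin

definition sq_integrable :: "(real^'n \<Rightarrow> real) \<Rightarrow> bool" where
  "sq_integrable f \<longleftrightarrow> f \<in> borel_measurable lborel \<and> integrable lborel (\<lambda>x. (f x)\<^sup>2)"

lemma sq_integrable_mult:
  assumes "sq_integrable f" "sq_integrable g"
  shows "integrable lborel (\<lambda>x. f x * g x)"
proof (rule Bochner_Integration.integrable_bound)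
  show "integrable lborel (\<lambda>x. (f x)\<^sup>2 + (g x)\<^sup>2)"
    using assms by (auto simp: sq_integrable_def)
  show "(\<lambda>x. f x * g x) \<in> borel_measurable lborel"
    using assms by (auto simp: sq_integrable_def)
  have "\<bar>a * b\<bar> \<le> a\<^sup>2 + b\<^sup>2" for a b :: real
  proof -
    have "2 * \<bar>a\<bar> * \<bar>b\<bar> \<le> \<bar>a\<bar>\<^sup>2 + \<bar>b\<bar>\<^sup>2"
      by (rule sum_squares_bound)
    moreover have "0 \<le> \<bar>a\<bar> * \<bar>b\<bar>"
      by simp
    ultimately show ?thesis
      unfolding abs_mult power2_abs by linarith
  qed
  then show "AE x in lborel. norm (f x * g x) \<le> norm ((f x)\<^sup>2 + (g x)\<^sup>2)"
    by simp
qed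

lemma sq_integrable_zero: "sq_integrable (\<lambda>x. 0)"
  by (simp add: sq_integrable_def)

lemma sq_integrable_add:
  assumes "sq_integrable f" "sq_integrable g"
  shows "sq_integrable (\<lambda>x. f x + g x)"
  using assms sq_integrable_mult[OF assms]
  by (auto simp: sq_integrable_def power2_sum mult.assoc)

lemma sq_integrable_scale:
  "sq_integrable f \<Longrightarrow> sq_integrable (\<lambda>x. c * f x)"
  by (auto simp: sq_integrable_def power_mult_distrib)

lemma sq_integrable_minus: "sq_integrable f \<Longrightarrow> sq_integrable (\<lambda>x. - f x)"
  using sq_integrable_scale[of f "-1"] by simp

lemma sq_integrable_diff:
  "sq_integrable f \<Longrightarrow> sq_integrable g \<Longrightarrow> sq_integrable (\<lambda>x. f x - g x)"
  using sq_integrable_add[of f "\<lambda>x. - g x"] sq_integrable_minus[of g] by simp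

definition L2_rel :: "(real^'n \<Rightarrow> real) \<Rightarrow> (real^'n \<Rightarrow> real) \<Rightarrow> bool" where
  "L2_rel f g \<longleftrightarrow> sq_integrable f \<and> sq_integrable g \<and> (AE x in lborel. f x = g x)"

lemma part_equivp_L2_rel: "part_equivp L2_rel"
proof (rule part_equivpI)
  show "\<exists>f. L2_rel f f"
    using sq_integrable_zero by (auto simp: L2_rel_def)
  show "symp L2_rel"
    by (rule sympI) (auto simp: L2_rel_def eq_commute)
  show "transp L2_rel"
  proof (rule transpI)
    fix f g h assume "L2_rel f g" "L2_rel g h"
    then show "L2_rel f h"
      unfolding L2_rel_def by (auto elim: AE_mp)
  qed
qed

quotient_type 'n L2 = "real^'n \<Rightarrow> real" / partial: L2_rel
  by (rule part_equivp_L2_rel)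

text \<open>
  \<open>fun_of f\<close> is an arbitrary representative of the class \<open>f\<close>; use it only in statements
  that are invariant under changes on null sets.
\<close>

abbreviation fun_of :: "'n::finite L2 \<Rightarrow> real^'n \<Rightarrow> real" where
  "fun_of \<equiv> rep_L2"

lemma fun_of_sq_integrable [simp]: "sq_integrable (fun_of f)"
  using Quotient_rep_reflp[OF Quotient_L2, of f] by (simp add: L2_rel_def cr_L2_def)

instantiation L2 :: (finite) real_inner
begin

lift_definition zero_L2 :: "'a L2" is "\<lambda>x. 0"
  by (auto simp: L2_rel_def sq_integrable_zero)

lift_definition plus_L2 :: "'a L2 \<Rightarrow> 'a L2 \<Rightarrow> 'a L2" is "\<lambda>f g x. f x + g x"
  by (auto simp: L2_rel_def sq_integrable_add)

lift_definition minus_L2 :: "'a L2 \<Rightarrow> 'a L2 \<Rightarrow> 'a L2" is "\<lambda>f g x. f x - g x"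
  by (auto simp: L2_rel_def sq_integrable_diff)

lift_definition uminus_L2 :: "'a L2 \<Rightarrow> 'a L2" is "\<lambda>f x. - f x"
  by (auto simp: L2_rel_def sq_integrable_minus)

lift_definition scaleR_L2 :: "real \<Rightarrow> 'a L2 \<Rightarrow> 'a L2" is "\<lambda>c f x. c * f x"
  by (auto simp: L2_rel_def sq_integrable_scale)

lift_definition inner_L2 :: "'a L2 \<Rightarrow> 'a L2 \<Rightarrow> real"
  is "\<lambda>f g. integral\<^sup>L lborel (\<lambda>x. f x * g x)"
  by (intro integral_cong_AE) (auto simp: L2_rel_def sq_integrable_def)

definition norm_L2 :: "'a L2 \<Rightarrow> real" where "norm_L2 f = sqrt (inner f f)"
definition dist_L2 :: "'a L2 \<Rightarrow> 'a L2 \<Rightarrow> real" where "dist_L2 f g = norm (f - g)"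
definition sgn_L2 :: "'a L2 \<Rightarrow> 'a L2" where "sgn_L2 f = inverse (norm f) *\<^sub>R f"
definition uniformity_L2 :: "('a L2 \<times> 'a L2) filter" where
  "uniformity_L2 = (INF e\<in>{0<..}. principal {(x, y). dist x y < e})"
definition open_L2 :: "'a L2 set \<Rightarrow> bool" where
  "open_L2 U \<longleftrightarrow> (\<forall>x\<in>U. \<forall>\<^sub>F (x', y) in uniformity. x' = x \<longrightarrow> y \<in> U)"

instance
proof
  fix f g h :: "'a L2" and c d :: real
  show "f + g + h = f + (g + h)"
    by transfer (auto simp: L2_rel_def sq_integrable_add add.assoc)
  show "f + g = g + f"
    by transfer (auto simp: L2_rel_def sq_integrable_add add.commute)
  show "0 + f = f"
    by transfer (auto simp: L2_rel_def)
  show "- f + f = 0"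
    by transfer (auto simp: L2_rel_def sq_integrable_zero)
  show "f - g = f + - g"
    by transfer (auto simp: L2_rel_def sq_integrable_diff)
  show "c *\<^sub>R (f + g) = c *\<^sub>R f + c *\<^sub>R g"
    by transfer (auto simp: L2_rel_def sq_integrable_add sq_integrable_scale distrib_left)
  show "(c + d) *\<^sub>R f = c *\<^sub>R f + d *\<^sub>R f"
    by transfer (auto simp: L2_rel_def sq_integrable_add sq_integrable_scale distrib_right)
  show "c *\<^sub>R d *\<^sub>R f = (c * d) *\<^sub>R f"
    by transfer (auto simp: L2_rel_def sq_integrable_scale mult.assoc)
  show "1 *\<^sub>R f = f"
    by transfer (auto simp: L2_rel_def)
  show "inner f g = inner g f"
    by transfer (simp add: mult.commute)
  show "inner (f + g) h = inner f h + inner g h"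
    by transfer (simp add: L2_rel_def distrib_right sq_integrable_mult)
  show "inner (c *\<^sub>R f) g = c * inner f g"
    by transfer (simp add: mult.assoc)
  show "0 \<le> inner f f"
    by transfer simp
  show "inner f f = 0 \<longleftrightarrow> f = 0"
  proof transfer
    fix f :: "real^'a \<Rightarrow> real"
    assume "L2_rel f f"
    then have f: "sq_integrable f"
      by (simp add: L2_rel_def)
    then have "integral\<^sup>L lborel (\<lambda>x. f x * f x) = 0 \<longleftrightarrow> (AE x in lborel. f x * f x = 0)"
      by (intro integral_nonneg_eq_0_iff_AE sq_integrable_mult) auto
    then show "integral\<^sup>L lborel (\<lambda>x. f x * f x) = 0 \<longleftrightarrow> L2_rel f (\<lambda>x. 0)"
      using f by (simp add: L2_rel_def sq_integrable_zero)
  qed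
qed (fact norm_L2_def dist_L2_def sgn_L2_def uniformity_L2_def open_L2_def)+

end

lemma L2_rel_imp_AE: "L2_rel f g \<Longrightarrow> AE x in lborel. f x = g x"
  by (simp add: L2_rel_def)

lemma L2_rel_fun_of: "L2_rel (fun_of (abs_L2 f)) f" if "sq_integrable f"
  using that by (intro Quotient3_rep_abs[OF Quotient3_L2]) (simp add: L2_rel_def)

lemma fun_of_add: "AE x in lborel. fun_of (f + g) x = fun_of f x + fun_of g x"
  unfolding plus_L2_def map_fun_def comp_def id_def
  by (intro L2_rel_imp_AE L2_rel_fun_of sq_integrable_add fun_of_sq_integrable)

lemma fun_of_scaleR: "AE x in lborel. fun_of (c *\<^sub>R f) x = c * fun_of f x"
  unfolding scaleR_L2_def map_fun_def comp_def id_def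
  by (intro L2_rel_imp_AE L2_rel_fun_of sq_integrable_scale fun_of_sq_integrable)

definition partial :: "'n::finite \<Rightarrow> (real^'n \<Rightarrow> real) \<Rightarrow> real^'n \<Rightarrow> real" where
  "partial i \<phi> x = frechet_derivative \<phi> (at x) (axis i 1)"

primrec C_k :: "nat \<Rightarrow> (real^'n::finite \<Rightarrow> real) \<Rightarrow> bool" where
  "C_k 0 \<phi> \<longleftrightarrow> continuous_on UNIV \<phi>"
| "C_k (Suc k) \<phi> \<longleftrightarrow> (\<forall>x. \<phi> differentiable (at x)) \<and> (\<forall>i. C_k k (partial i \<phi>))"

definition test_function :: "(real^'n::finite \<Rightarrow> real) \<Rightarrow> bool" where
  "test_function \<phi> \<longleftrightarrow> (\<forall>k. C_k k \<phi>) \<and> compact (closure {x. \<phi> x \<noteq> 0})"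

definition weak_partial :: "'n::finite \<Rightarrow> 'n L2 \<Rightarrow> 'n L2 \<Rightarrow> bool" where
  "weak_partial i f g \<longleftrightarrow> (\<forall>\<phi>. test_function \<phi> \<longrightarrow>
     (\<integral>x. fun_of f x * partial i \<phi> x \<partial>lborel) = - (\<integral>x. fun_of g x * \<phi> x \<partial>lborel))"

lemma sq_integrable_compact_support:
  fixes \<phi> :: "real^'n::finite \<Rightarrow> real"
  assumes "continuous_on UNIV \<phi>" "compact K" "\<And>x. x \<notin> K \<Longrightarrow> \<phi> x = 0"
  shows "sq_integrable \<phi>"
proof -
  have "integrable lborel (\<lambda>x. indicator K x *\<^sub>R (\<phi> x)\<^sup>2)"
    by (rule borel_integrable_compact[OF assms(2)])
       (intro continuous_on_power continuous_on_subset[OF assms(1)], simp)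
  also have "(\<lambda>x. indicator K x *\<^sub>R (\<phi> x)\<^sup>2) = (\<lambda>x. (\<phi> x)\<^sup>2)"
    using assms(3) by (auto simp: fun_eq_iff indicator_def)
  finally show ?thesis
    using borel_measurable_continuous_onI[OF assms(1)] by (simp add: sq_integrable_def)
qed

lemma test_function_sq_integrable:
  assumes "test_function \<phi>"
  shows "sq_integrable \<phi>" "sq_integrable (partial i \<phi>)"
proof -
  let ?K = "closure {x. \<phi> x \<noteq> 0}"
  have C: "C_k 0 \<phi>" "C_k (Suc 0) \<phi>" and K: "compact ?K"
    using assms unfolding test_function_def by blast+
  have out: "\<phi> x = 0" if "x \<notin> ?K" for x
    using that closure_subset[of "{x. \<phi> x \<noteq> 0}"] by blast
  show "sq_integrable \<phi>"
    by (rule sq_integrable_compact_support[OF C(1)[unfolded C_k.simps] K out])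
  have "partial i \<phi> x = 0" if "x \<notin> ?K" for x
  proof -
    have "(\<phi> has_derivative (\<lambda>_. 0)) (at x)"
    proof (rule has_derivative_transform_within_open)
      show "((\<lambda>_. 0) has_derivative (\<lambda>_. 0)) (at x)"
        by simp
      show "open (- ?K)" "x \<in> - ?K"
        using that by (auto simp only: open_Compl closed_closure Compl_iff simp_thms)
      show "0 = \<phi> y" if "y \<in> - ?K" for y
        by (rule out[symmetric]) (use that in blast)
    qed
    then have "frechet_derivative \<phi> (at x) = (\<lambda>_. 0)"
      by (rule frechet_derivative_at[symmetric])
    then show ?thesis
      by (simp add: partial_def)
  qed
  moreover have "continuous_on UNIV (partial i \<phi>)"
    using C(2) by simp
  ultimately show "sq_integrable (partial i \<phi>)"
    using sq_integrable_compact_support K by blast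
qed

lemma integral_fun_of_add:
  assumes "sq_integrable \<psi>"
  shows "(\<integral>x. fun_of (f + g) x * \<psi> x \<partial>lborel)
       = (\<integral>x. fun_of f x * \<psi> x \<partial>lborel) + (\<integral>x. fun_of g x * \<psi> x \<partial>lborel)"
proof -
  have m: "\<psi> \<in> borel_measurable lborel" "fun_of h \<in> borel_measurable lborel" for h
    using assms fun_of_sq_integrable[of h] by (simp_all only: sq_integrable_def)
  have "(\<integral>x. fun_of (f + g) x * \<psi> x \<partial>lborel)
      = (\<integral>x. fun_of f x * \<psi> x + fun_of g x * \<psi> x \<partial>lborel)"
    by (rule integral_cong_AE) (use fun_of_add[of f g] in \<open>auto simp: distrib_right intro!: borel_measurable_times borel_measurable_add m[simplified]\<close>)
  also have "\<dots> = (\<integral>x. fun_of f x * \<psi> x \<partial>lborel) + (\<integral>x. fun_of g x * \<psi> x \<partial>lborel)"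
    using assms by (intro Bochner_Integration.integral_add sq_integrable_mult) simp_all
  finally show ?thesis .
qed

lemma integral_fun_of_scaleR:
  assumes "sq_integrable \<psi>"
  shows "(\<integral>x. fun_of (c *\<^sub>R f) x * \<psi> x \<partial>lborel) = c * (\<integral>x. fun_of f x * \<psi> x \<partial>lborel)"
proof -
  have m: "\<psi> \<in> borel_measurable lborel" "fun_of h \<in> borel_measurable lborel" for h
    using assms fun_of_sq_integrable[of h] by (simp_all only: sq_integrable_def)
  have "(\<integral>x. fun_of (c *\<^sub>R f) x * \<psi> x \<partial>lborel) = (\<integral>x. c * (fun_of f x * \<psi> x) \<partial>lborel)"
    by (rule integral_cong_AE) (use fun_of_scaleR[of c f] in \<open>auto intro!: borel_measurable_times m[simplified]\<close>)
  then show ?thesis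
    by simp
qed

lemma weak_partial_add:
  "weak_partial i f g \<Longrightarrow> weak_partial i f' g' \<Longrightarrow> weak_partial i (f + f') (g + g')"
  by (simp add: weak_partial_def integral_fun_of_add test_function_sq_integrable)

lemma weak_partial_scaleR:
  "weak_partial i f g \<Longrightarrow> weak_partial i (c *\<^sub>R f) (c *\<^sub>R g)"
  by (simp add: weak_partial_def integral_fun_of_scaleR test_function_sq_integrable)

lemma weak_partial_zero: "weak_partial i (0 :: 'a::finite L2) 0"
  unfolding weak_partial_def
  using integral_fun_of_scaleR[where c = 0 and f = "0 :: 'a L2"]
  by (simp add: test_function_sq_integrable)

lemma weak_partial_minus: "weak_partial i f g \<Longrightarrow> weak_partial i (- f) (- g)"
  using weak_partial_scaleR[of i f g "-1"] by simp

lemma weak_partial_diff: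
  "weak_partial i f g \<Longrightarrow> weak_partial i f' g' \<Longrightarrow> weak_partial i (f - f') (g - g')"
  using weak_partial_add[of i f g "- f'" "- g'"] weak_partial_minus[of i f' g'] by simp

text \<open>
  Weak derivatives are unique, so \<open>H\<^sup>1\<close> is isometric to the space of pairs \<open>(f, \<nabla>f)\<close> in
  \<open>L\<^sup>2 \<times> (L\<^sup>2)\<^sup>n\<close> and \<open>H\<^sup>2\<close> to the space of triples \<open>(f, \<nabla>f, \<nabla>\<^sup>2f)\<close>; the inner product inherited
  from the product space is the usual one.
\<close>

typedef 'n H1 = "{(f :: 'n::finite L2, g :: 'n L2^'n). \<forall>i. weak_partial i f (g $ i)}"
proof
  show "(0, 0) \<in> {(f :: 'n::finite L2, g :: 'n L2^'n). \<forall>i. weak_partial i f (g $ i)}"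
    by (simp add: weak_partial_zero)
qed

setup_lifting type_definition_H1

instantiation H1 :: (finite) real_inner
begin

lift_definition zero_H1 :: "'a H1" is 0
  by (simp add: zero_prod_def weak_partial_zero)

lift_definition plus_H1 :: "'a H1 \<Rightarrow> 'a H1 \<Rightarrow> 'a H1" is "(+)"
  by (auto simp: weak_partial_add)

lift_definition minus_H1 :: "'a H1 \<Rightarrow> 'a H1 \<Rightarrow> 'a H1" is "(-)"
  by (auto simp: weak_partial_diff)

lift_definition uminus_H1 :: "'a H1 \<Rightarrow> 'a H1" is uminus
  by (auto simp: weak_partial_minus vector_uminus_component)

lift_definition scaleR_H1 :: "real \<Rightarrow> 'a H1 \<Rightarrow> 'a H1" is scaleR
  by (auto simp: weak_partial_scaleR vector_scaleR_component)

lift_definition inner_H1 :: "'a H1 \<Rightarrow> 'a H1 \<Rightarrow> real" is inner .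

definition norm_H1 :: "'a H1 \<Rightarrow> real" where "norm_H1 f = sqrt (inner f f)"
definition dist_H1 :: "'a H1 \<Rightarrow> 'a H1 \<Rightarrow> real" where "dist_H1 f g = norm (f - g)"
definition sgn_H1 :: "'a H1 \<Rightarrow> 'a H1" where "sgn_H1 f = inverse (norm f) *\<^sub>R f"
definition uniformity_H1 :: "('a H1 \<times> 'a H1) filter" where
  "uniformity_H1 = (INF e\<in>{0<..}. principal {(x, y). dist x y < e})"
definition open_H1 :: "'a H1 set \<Rightarrow> bool" where
  "open_H1 U \<longleftrightarrow> (\<forall>x\<in>U. \<forall>\<^sub>F (x', y) in uniformity. x' = x \<longrightarrow> y \<in> U)"

instance
proof
  fix f g h :: "'a H1" and c d :: real
  show "f + g + h = f + (g + h)" by transfer (rule add.assoc)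
  show "f + g = g + f" by transfer (rule add.commute)
  show "0 + f = f" by transfer (rule add_0)
  show "- f + f = 0" by transfer (rule left_minus)
  show "f - g = f + - g" by transfer (rule diff_conv_add_uminus)
  show "c *\<^sub>R (f + g) = c *\<^sub>R f + c *\<^sub>R g" by transfer (rule scaleR_add_right)
  show "(c + d) *\<^sub>R f = c *\<^sub>R f + d *\<^sub>R f" by transfer (rule scaleR_add_left)
  show "c *\<^sub>R d *\<^sub>R f = (c * d) *\<^sub>R f" by transfer (rule scaleR_scaleR)
  show "1 *\<^sub>R f = f" by transfer (rule scaleR_one)
  show "inner f g = inner g f" by transfer (rule inner_commute)
  show "inner (f + g) h = inner f h + inner g h" by transfer (rule inner_add_left)
  show "inner (c *\<^sub>R f) g = c * inner f g" by transfer (rule inner_scaleR_left)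
  show "0 \<le> inner f f" by transfer (rule inner_ge_zero)
  show "inner f f = 0 \<longleftrightarrow> f = 0" by transfer (rule inner_eq_zero_iff)
qed (fact norm_H1_def dist_H1_def sgn_H1_def uniformity_H1_def open_H1_def)+

end

definition H1_to_L2 :: "'n::finite H1 \<Rightarrow> 'n L2" where
  "H1_to_L2 f = fst (Rep_H1 f)"

typedef 'n H2 = "{(f :: 'n::finite L2, g :: 'n L2^'n, h :: 'n L2^'n^'n).
  (\<forall>i. weak_partial i f (g $ i)) \<and> (\<forall>i j. weak_partial j (g $ i) (h $ i $ j))}"
proof
  show "(0, 0, 0) \<in> {(f :: 'n::finite L2, g :: 'n L2^'n, h :: 'n L2^'n^'n).
    (\<forall>i. weak_partial i f (g $ i)) \<and> (\<forall>i j. weak_partial j (g $ i) (h $ i $ j))}"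
    by (simp add: weak_partial_zero)
qed

setup_lifting type_definition_H2

instantiation H2 :: (finite) real_inner
begin

lift_definition zero_H2 :: "'a H2" is 0
  by (simp add: zero_prod_def weak_partial_zero)

lift_definition plus_H2 :: "'a H2 \<Rightarrow> 'a H2 \<Rightarrow> 'a H2" is "(+)"
  by (auto simp: weak_partial_add)

lift_definition minus_H2 :: "'a H2 \<Rightarrow> 'a H2 \<Rightarrow> 'a H2" is "(-)"
  by (auto simp: weak_partial_diff)

lift_definition uminus_H2 :: "'a H2 \<Rightarrow> 'a H2" is uminus
  by (auto simp: weak_partial_minus vector_uminus_component)

lift_definition scaleR_H2 :: "real \<Rightarrow> 'a H2 \<Rightarrow> 'a H2" is scaleR
  by (auto simp: weak_partial_scaleR vector_scaleR_component)

lift_definition inner_H2 :: "'a H2 \<Rightarrow> 'a H2 \<Rightarrow> real" is inner .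

definition norm_H2 :: "'a H2 \<Rightarrow> real" where "norm_H2 f = sqrt (inner f f)"
definition dist_H2 :: "'a H2 \<Rightarrow> 'a H2 \<Rightarrow> real" where "dist_H2 f g = norm (f - g)"
definition sgn_H2 :: "'a H2 \<Rightarrow> 'a H2" where "sgn_H2 f = inverse (norm f) *\<^sub>R f"
definition uniformity_H2 :: "('a H2 \<times> 'a H2) filter" where
  "uniformity_H2 = (INF e\<in>{0<..}. principal {(x, y). dist x y < e})"
definition open_H2 :: "'a H2 set \<Rightarrow> bool" where
  "open_H2 U \<longleftrightarrow> (\<forall>x\<in>U. \<forall>\<^sub>F (x', y) in uniformity. x' = x \<longrightarrow> y \<in> U)"

instance
proof
  fix f g h :: "'a H2" and c d :: real
  show "f + g + h = f + (g + h)" by transfer (rule add.assoc)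
  show "f + g = g + f" by transfer (rule add.commute)
  show "0 + f = f" by transfer (rule add_0)
  show "- f + f = 0" by transfer (rule left_minus)
  show "f - g = f + - g" by transfer (rule diff_conv_add_uminus)
  show "c *\<^sub>R (f + g) = c *\<^sub>R f + c *\<^sub>R g" by transfer (rule scaleR_add_right)
  show "(c + d) *\<^sub>R f = c *\<^sub>R f + d *\<^sub>R f" by transfer (rule scaleR_add_left)
  show "c *\<^sub>R d *\<^sub>R f = (c * d) *\<^sub>R f" by transfer (rule scaleR_scaleR)
  show "1 *\<^sub>R f = f" by transfer (rule scaleR_one)
  show "inner f g = inner g f" by transfer (rule inner_commute)
  show "inner (f + g) h = inner f h + inner g h" by transfer (rule inner_add_left)
  show "inner (c *\<^sub>R f) g = c * inner f g" by transfer (rule inner_scaleR_left)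
  show "0 \<le> inner f f" by transfer (rule inner_ge_zero)
  show "inner f f = 0 \<longleftrightarrow> f = 0" by transfer (rule inner_eq_zero_iff)
qed (fact norm_H2_def dist_H2_def sgn_H2_def uniformity_H2_def open_H2_def)+

end

definition H2_to_L2 :: "'n::finite H2 \<Rightarrow> 'n L2" where
  "H2_to_L2 f = fst (Rep_H2 f)"

lift_definition H2_to_H1 :: "'n::finite H2 \<Rightarrow> 'n H1" is "\<lambda>(f, g, h). (f, g)"
  by auto

definition laplacian :: "'n::finite H2 \<Rightarrow> 'n L2" where
  "laplacian f = (\<Sum>i\<in>UNIV. snd (snd (Rep_H2 f)) $ i $ i)"

definition strong_solution ::
  "real \<Rightarrow> real \<Rightarrow> real \<Rightarrow> 'n H2 \<Rightarrow> 'n H2 \<Rightarrow> (real \<Rightarrow> 'n::finite H2) \<Rightarrow> (real \<Rightarrow> 'n H2) \<Rightarrow> bool" where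
  "strong_solution b\<^sub>0 \<beta> s g\<^sub>0 g\<^sub>1 w w\<^sub>t \<longleftrightarrow>
     w s = g\<^sub>0 \<and> w\<^sub>t s = g\<^sub>1 \<and> continuous_on {s..} w\<^sub>t \<and>
     (\<forall>t\<ge>s. (w has_vector_derivative w\<^sub>t t) (at t within {s..})) \<and>
     (\<exists>w\<^sub>t\<^sub>t :: real \<Rightarrow> 'n L2. continuous_on {s..} w\<^sub>t\<^sub>t \<and>
        (\<forall>t\<ge>s. ((\<lambda>t. H2_to_L2 (w\<^sub>t t)) has_vector_derivative w\<^sub>t\<^sub>t t) (at t within {s..})) \<and>
        (\<forall>t\<ge>s. w\<^sub>t\<^sub>t t - laplacian (w t) - (b\<^sub>0 / (1 + t) powr \<beta>) *\<^sub>R laplacian (w\<^sub>t t) = 0))"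

text \<open>
  \<open>R_value b\<^sub>0 \<beta> s g\<^sub>0 g\<^sub>1 w\<close> means \<open>w = R(\<cdot>, s)(g\<^sub>0, g\<^sub>1)\<close> on \<open>[s, \<infinity>)\<close>.  The graph of the
  extension of \<open>R(\<cdot>, s)\<close> by density is the closure of its graph over \<open>H\<^sup>2 \<times> H\<^sup>2\<close>, taken in
  \<open>H\<^sup>1 \<times> L\<^sup>2\<close> for the data and in \<open>C([s, \<infinity>); H\<^sup>1) \<inter> C\<^sup>1([s, \<infinity>); L\<^sup>2)\<close> (uniform convergence of the
  function and of its time derivative on compact intervals) for the solution.
\<close>

definition R_value ::
  "real \<Rightarrow> real \<Rightarrow> real \<Rightarrow> 'n H1 \<Rightarrow> 'n L2 \<Rightarrow> (real \<Rightarrow> 'n::finite H1) \<Rightarrow> bool" where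
  "R_value b\<^sub>0 \<beta> s g\<^sub>0 g\<^sub>1 w \<longleftrightarrow>
     (\<exists>w\<^sub>t :: real \<Rightarrow> 'n L2.
        continuous_on {s..} w \<and> continuous_on {s..} w\<^sub>t \<and>
        (\<forall>t\<ge>s. ((\<lambda>t. H1_to_L2 (w t)) has_vector_derivative w\<^sub>t t) (at t within {s..})) \<and>
        (\<exists>(h\<^sub>0 :: nat \<Rightarrow> 'n H2) (h\<^sub>1 :: nat \<Rightarrow> 'n H2) v v\<^sub>t.
           (\<forall>k. strong_solution b\<^sub>0 \<beta> s (h\<^sub>0 k) (h\<^sub>1 k) (v k) (v\<^sub>t k)) \<and>
           (\<lambda>k. H2_to_H1 (h\<^sub>0 k)) \<longlonglongrightarrow> g\<^sub>0 \<and> (\<lambda>k. H2_to_L2 (h\<^sub>1 k)) \<longlonglongrightarrow> g\<^sub>1 \<and>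
           (\<forall>T\<ge>s. uniform_limit {s..T} (\<lambda>k t. H2_to_H1 (v k t)) w sequentially \<and>
                  uniform_limit {s..T} (\<lambda>k t. H2_to_L2 (v\<^sub>t k t)) w\<^sub>t sequentially)))"

text \<open>
  In \<open>mild_solution\<close>, \<open>w\<close> is \<open>R(\<cdot>, 0)(u\<^sub>0, u\<^sub>1)\<close>, the \<open>L\<^sup>2\<close> class \<open>N s\<close> is that of \<open>|u(s)|\<^sup>p\<close>, and
  \<open>z s\<close> is \<open>S(\<cdot>, s)|u(s)|\<^sup>p\<close>.  The Duhamel integral is taken in the normed space \<open>H\<^sup>1\<close>.
\<close>

definition mild_solution ::
  "real \<Rightarrow> real \<Rightarrow> real \<Rightarrow> 'n H1 \<Rightarrow> 'n L2 \<Rightarrow> real \<Rightarrow> (real \<Rightarrow> 'n::finite H1) \<Rightarrow> bool" where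
  "mild_solution b\<^sub>0 \<beta> p u\<^sub>0 u\<^sub>1 T u \<longleftrightarrow>
     continuous_on {0..T} u \<and>
     (\<exists>u\<^sub>t :: real \<Rightarrow> 'n L2. continuous_on {0..T} u\<^sub>t \<and>
        (\<forall>t\<in>{0..T}. ((\<lambda>t. H1_to_L2 (u t)) has_vector_derivative u\<^sub>t t) (at t within {0..T})) \<and>
        u 0 = u\<^sub>0 \<and> u\<^sub>t 0 = u\<^sub>1) \<and>
     (\<exists>w N z.
        R_value b\<^sub>0 \<beta> 0 u\<^sub>0 u\<^sub>1 w \<and>
        (\<forall>s\<in>{0..T}. (AE x in lborel. fun_of (N s) x = \<bar>fun_of (H1_to_L2 (u s)) x\<bar> powr p) \<and>
                     R_value b\<^sub>0 \<beta> s 0 (N s) (z s)) \<and>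
        (\<forall>t\<in>{0..T}. ((\<lambda>s. z s t) has_integral (u t - w t)) {0..t}))"

text \<open>
  \<open>T\<^sub>m\<^sub>a\<^sub>x\<close> may be \<open>\<infinity>\<close>, and then \<open>u\<close> is global.  Only the values of \<open>u\<close> on \<open>[0, T\<^sub>m\<^sub>a\<^sub>x)\<close> matter.
\<close>

definition maximal_mild_solution ::
  "real \<Rightarrow> real \<Rightarrow> real \<Rightarrow> 'n H1 \<Rightarrow> 'n L2 \<Rightarrow> ereal \<Rightarrow> (real \<Rightarrow> 'n::finite H1) \<Rightarrow> bool" where
  "maximal_mild_solution b\<^sub>0 \<beta> p u\<^sub>0 u\<^sub>1 T\<^sub>m\<^sub>a\<^sub>x u \<longleftrightarrow>
     0 < T\<^sub>m\<^sub>a\<^sub>x \<and>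
     (\<forall>T>0. ereal T < T\<^sub>m\<^sub>a\<^sub>x \<longrightarrow> mild_solution b\<^sub>0 \<beta> p u\<^sub>0 u\<^sub>1 T u) \<and>
     \<not> (\<exists>T v. T\<^sub>m\<^sub>a\<^sub>x \<le> ereal T \<and> mild_solution b\<^sub>0 \<beta> p u\<^sub>0 u\<^sub>1 T v \<and>
              (\<forall>t\<ge>0. ereal t < T\<^sub>m\<^sub>a\<^sub>x \<longrightarrow> v t = u t))"

text \<open>\<open>p \<le> a / b\<^sub>+\<close>, where the bound is read as \<open>\<infinity>\<close> if \<open>b\<^sub>+ = 0\<close>.\<close>

definition le_ratio_pos :: "real \<Rightarrow> real \<Rightarrow> real \<Rightarrow> bool" where
  "le_ratio_pos p a b \<longleftrightarrow> max 0 b = 0 \<or> p \<le> a / max 0 b"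

end

(*
  The proof is by the test function method. Suppose that u is global. Against eta(t) phi(x) with phi
  smooth and compactly supported, the Duhamel formula gives the weak form of the equation; exchanging
  the two time integrals there needs a bound for |u(s)|^p in L^2 that is uniform on compact time
  intervals, which comes from the energy inequality and a subcritical Sobolev inequality.
  Put alpha = max 1 ((1 - beta) / 2) and choose eta(t) phi(x) = psi_R as a high power of a cutoff
  living on t <~ R, |x| <~ R^alpha. Every term of the adjoint equation is then O(R^-2 psi_R^(1/p)),
  and the hypothesis on p says exactly that the volume R^(1 + n alpha) does not exceed
  R^(2 p / (p - 1)). Young's inequality bounds the space-time integral I_R of |u|^p psi_R plus the data
  term by l^p (I_R - I_(R/2)) + O(l^(-p / (p - 1))) for every l > 0, because the derivatives of psi_R
  vanish where psi_(R/2) lives. Hence I_R is bounded and the increment tends to 0, so the integral of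
  u_1 would be at most 0.
*)

theory Submission
  imports Defs
begin

section \<open>Smooth functions of one variable\<close>

text \<open>The exponent \<alpha> balances the adjoint equation. For t up to order R the
  coefficients of the spatial Laplacian are at most of order R^(2 \<alpha> - 2): the undamped term
  requires \<alpha> >= 1, and the damping with one time derivative, of order R^(-\<beta> - 1),
  requires 2 \<alpha> >= 1 - \<beta>. The Laplacian contributes R^(-2 \<alpha>). At the endpoint
  value of p the volume factor is bounded but does not decay, so the weight l is used at two values.
  A mild solution makes |u(s)|^p an L^2 class for each s separately, without control in s; hence the
  need for a quantitative Sobolev inequality. It is proved by duality: a pairing is telescoped over
  mollifications at dyadic scales, and strict subcriticality makes the telescope a geometric series.
  Mollification enters only through bilinear forms, which also give integration by parts between
  weakly differentiable functions without density of smooth functions. Kernels and cutoffs are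
  products of functions of one variable, so that differentiation stays one-dimensional.\<close>

primrec ck :: "nat \<Rightarrow> (real \<Rightarrow> real) \<Rightarrow> bool" where
  "ck 0 f \<longleftrightarrow> continuous_on UNIV f"
| "ck (Suc k) f \<longleftrightarrow> (\<forall>x. f differentiable (at x)) \<and> ck k (deriv f)"

definition smooth :: "(real \<Rightarrow> real) \<Rightarrow> bool" where
  "smooth f \<longleftrightarrow> (\<forall>k. ck k f)"

lemma ck_SucI:
  assumes "\<And>x. (f has_real_derivative g x) (at x)" "ck k g"
  shows "ck (Suc k) f"
proof -
  have "deriv f = g"
    using assms(1) by (auto intro!: DERIV_imp_deriv)
  moreover have "f differentiable (at x)" for x
    using assms(1)[of x] by (auto simp: real_differentiable_def)
  ultimately show ?thesis
    using assms(2) by simp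
qed

lemma ck_Suc_DERIV: "ck (Suc k) f \<Longrightarrow> (f has_real_derivative deriv f x) (at x)"
  using DERIV_deriv_iff_real_differentiable by auto

lemma ck_continuous_on: "ck k f \<Longrightarrow> continuous_on UNIV f"
proof (cases k)
  case (Suc j)
  assume "ck k f"
  then show ?thesis
    unfolding Suc by (metis DERIV_isCont ck_Suc_DERIV continuous_at_imp_continuous_on)
qed simp

lemma ck_Suc_imp: "ck (Suc k) f \<Longrightarrow> ck k f"
proof (induction k arbitrary: f)
  case 0
  then show ?case
    using ck_continuous_on[of "Suc 0" f] by (simp del: ck.simps(2))
next
  case (Suc k)
  then show ?case
    by (metis ck.simps(2))
qed

lemma smooth_DERIV: "smooth f \<Longrightarrow> (f has_real_derivative deriv f x) (at x)"
  unfolding smooth_def using ck_Suc_DERIV by blast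

lemma smooth_deriv: "smooth f \<Longrightarrow> smooth (deriv f)"
  unfolding smooth_def using ck.simps(2) by blast

lemma smooth_continuous_on: "smooth f \<Longrightarrow> continuous_on A f"
  unfolding smooth_def by (meson ck_continuous_on continuous_on_subset subset_UNIV)

lemma smooth_measurable [measurable (raw)]: "smooth f \<Longrightarrow> f \<in> borel_measurable borel"
  by (intro borel_measurable_continuous_onI smooth_continuous_on)

lemma ck_const: "ck k (\<lambda>x. c)"
proof (induction k arbitrary: c)
  case (Suc k)
  show ?case
    by (rule ck_SucI[where g = "\<lambda>_. 0"]) (auto intro!: Suc derivative_eq_intros)
qed simp

lemma ck_add: "ck k f \<Longrightarrow> ck k g \<Longrightarrow> ck k (\<lambda>x. f x + g x)"
proof (induction k arbitrary: f g)
  case (Suc k)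
  show ?case
    by (rule ck_SucI[where g = "\<lambda>x. deriv f x + deriv g x"])
       (use Suc in \<open>auto intro!: derivative_eq_intros ck_Suc_DERIV\<close>)
qed (auto intro!: continuous_intros)

lemma ck_mult: "ck k f \<Longrightarrow> ck k g \<Longrightarrow> ck k (\<lambda>x. f x * g x)"
proof (induction k arbitrary: f g)
  case (Suc k)
  have "ck k f" "ck k g" "ck k (deriv f)" "ck k (deriv g)"
    using Suc.prems ck_Suc_imp by auto
  then show ?case
    by (intro ck_SucI[where g = "\<lambda>x. deriv f x * g x + deriv g x * f x"] ck_add Suc.IH)
       (use Suc.prems in \<open>auto intro!: derivative_eq_intros ck_Suc_DERIV\<close>)
qed (auto intro!: continuous_intros)

lemma ck_affine: "ck k f \<Longrightarrow> ck k (\<lambda>x. f (a * x + b))"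
proof (induction k arbitrary: f)
  case 0
  then show ?case
    by (auto intro!: continuous_on_compose2[where g = f and t = UNIV] continuous_intros)
next
  case (Suc k)
  have D: "(f has_real_derivative deriv f x) (at x)" for x
    using Suc.prems ck_Suc_DERIV by blast
  show ?case
  proof (rule ck_SucI)
    show "((\<lambda>x. f (a * x + b)) has_real_derivative a * deriv f (a * x + b)) (at x)" for x
      by (rule DERIV_cong, rule DERIV_chain'[OF _ D]) (auto intro!: derivative_eq_intros)
    show "ck k (\<lambda>x. a * deriv f (a * x + b))"
      using Suc by (auto intro!: ck_mult ck_const)
  qed
qed

lemma ck_inverse: "ck k f \<Longrightarrow> (\<And>x. f x \<noteq> 0) \<Longrightarrow> ck k (\<lambda>x. inverse (f x))"
proof (induction k arbitrary: f)
  case (Suc k)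
  have "ck k f" "ck k (deriv f)"
    using Suc.prems ck_Suc_imp by auto
  then have "ck k (\<lambda>x. - 1 * (deriv f x * (inverse (f x) * inverse (f x))))"
    by (intro ck_mult ck_const Suc.IH) (use Suc.prems in auto)
  then show ?case
    by (intro ck_SucI[where g = "\<lambda>x. - 1 * (deriv f x * (inverse (f x) * inverse (f x)))"])
       (use Suc.prems in \<open>auto intro!: derivative_eq_intros ck_Suc_DERIV\<close>)
qed (auto intro!: continuous_intros)

lemma smooth_const: "smooth (\<lambda>x. c)"
  and smooth_add: "smooth f \<Longrightarrow> smooth g \<Longrightarrow> smooth (\<lambda>x. f x + g x)"
  and smooth_mult: "smooth f \<Longrightarrow> smooth g \<Longrightarrow> smooth (\<lambda>x. f x * g x)"
  and smooth_affine: "smooth f \<Longrightarrow> smooth (\<lambda>x. f (a * x + b))"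
  and smooth_inverse: "smooth f \<Longrightarrow> (\<And>x. f x \<noteq> 0) \<Longrightarrow> smooth (\<lambda>x. inverse (f x))"
  unfolding smooth_def by (blast intro: ck_const ck_add ck_mult ck_affine ck_inverse)+

lemma smooth_cmult: "smooth f \<Longrightarrow> smooth (\<lambda>x. c * f x)"
  by (intro smooth_mult smooth_const)

lemma smooth_diff: "smooth f \<Longrightarrow> smooth g \<Longrightarrow> smooth (\<lambda>x. f x - g x)"
  using smooth_add[of f "\<lambda>x. -1 * g x"] smooth_cmult[of g "-1"] by simp

lemma smooth_power: "smooth f \<Longrightarrow> smooth (\<lambda>x. f x ^ m)"
  by (induction m) (auto intro!: smooth_const smooth_mult)

section \<open>A smooth step built from exp(-1/x)\<close>

definition flat :: "real poly \<Rightarrow> real \<Rightarrow> real" where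
  "flat q x = (if x > 0 then poly q (1 / x) * exp (- 1 / x) else 0)"

lemma poly_mult_exp_tendsto_0: "((\<lambda>y::real. poly q y * exp (- y)) \<longlongrightarrow> 0) at_top"
proof -
  have "((\<lambda>y::real. \<Sum>i\<le>degree q. coeff q i * (y ^ i / exp y)) \<longlongrightarrow> (\<Sum>i\<le>degree q. coeff q i * 0)) at_top"
    by (intro tendsto_intros tendsto_power_div_exp_0)
  then show ?thesis
    by (simp add: poly_altdef sum_distrib_right exp_minus field_simps sum_distrib_left)
qed

text \<open>With y = 1/x the derivative of q(y) exp(-y) is y^2 (q - q')(y) exp(-y), which is again
  of the form \<open>flat\<close>. Keeping the polynomial general makes the family closed under
  differentiation, so that smoothness follows by induction.\<close>

lemma flat_DERIV: "(flat q has_real_derivative flat ([:0, 0, 1:] * (q - pderiv q)) x) (at x)"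
proof (cases "x = 0")
  case False
  show ?thesis
  proof (cases "x > 0")
    case True
    have "((\<lambda>x. poly q (1 / x) * exp (- 1 / x)) has_real_derivative
        flat ([:0, 0, 1:] * (q - pderiv q)) x) (at x)"
      using True
      by (auto intro!: derivative_eq_intros DERIV_chain'[OF _ poly_DERIV]
               simp: flat_def field_simps power2_eq_square)
    then show ?thesis
      by (rule has_field_derivative_transform_within_open[where S = "{0<..}"])
         (use True in \<open>auto simp: flat_def\<close>)
  next
    case neg: False
    have "((\<lambda>x. 0) has_real_derivative 0) (at x)"
      by simp
    then have "(flat q has_real_derivative 0) (at x)"
      by (rule has_field_derivative_transform_within_open[where S = "{..<0}"])
         (use neg False in \<open>auto simp: flat_def\<close>)
    then show ?thesis
      using neg by (simp add: flat_def)
  qed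
next
  case True
  have "((\<lambda>h. flat q h / h) \<longlongrightarrow> 0) (at 0)"
    unfolding filterlim_at_split
  proof
    show "((\<lambda>h. flat q h / h) \<longlongrightarrow> 0) (at_left 0)"
      by (rule tendsto_eventually) (auto simp: flat_def eventually_at_filter)
    \<comment> \<open>For h > 0 and y = 1/h the difference quotient is y q(y) exp(-y), whence the
      extra factor \<open>pCons 0\<close>.\<close>
    have "((\<lambda>h. poly (pCons 0 q) (inverse h) * exp (- inverse h)) \<longlongrightarrow> 0) (at_right (0::real))"
      by (rule filterlim_compose[OF poly_mult_exp_tendsto_0 filterlim_inverse_at_top_right])
    then show "((\<lambda>h. flat q h / h) \<longlongrightarrow> 0) (at_right 0)"
      by (rule Lim_transform_eventually)
         (auto simp: flat_def eventually_at_filter field_simps)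
  qed
  then show ?thesis
    using True by (simp add: has_field_derivative_iff flat_def)
qed

lemma smooth_flat: "smooth (flat q)"
proof -
  have "ck k (flat q)" for k
  proof (induction k arbitrary: q)
    case 0
    show ?case
      using flat_DERIV by (auto intro!: continuous_at_imp_continuous_on DERIV_isCont)
  qed (use flat_DERIV ck_SucI in blast)
  then show ?thesis
    by (simp add: smooth_def)
qed

text \<open>The transition from 0 to 1 takes place on [-1, 0]. The denominator never vanishes
  because x + 1 and -x are not both nonpositive.\<close>

definition step :: "real \<Rightarrow> real" where
  "step x = flat 1 (x + 1) / (flat 1 (x + 1) + flat 1 (- x))"

lemma flat_nonneg: "0 \<le> flat 1 x" and flat_pos: "0 < x \<Longrightarrow> 0 < flat 1 x"
  and flat_eq_0: "x \<le> 0 \<Longrightarrow> flat q x = 0"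
  by (auto simp: flat_def)

lemma step_denom_pos: "0 < flat 1 (x + 1) + flat 1 (- x)"
  using flat_nonneg[of "x + 1"] flat_nonneg[of "- x"] flat_pos[of "x + 1"] flat_pos[of "- x"]
  by (cases "x < 0") auto

lemma smooth_step: "smooth step"
proof -
  have "smooth (\<lambda>x. flat 1 (1 * x + 1) * inverse (flat 1 (1 * x + 1) + flat 1 (- 1 * x + 0)))"
    by (intro smooth_mult smooth_inverse smooth_add smooth_affine smooth_flat)
       (use step_denom_pos in \<open>simp add: less_imp_neq[symmetric]\<close>)
  moreover have "(\<lambda>x. flat 1 (1 * x + 1) * inverse (flat 1 (1 * x + 1) + flat 1 (- 1 * x + 0))) = step"
    by (auto simp: step_def field_simps)
  ultimately show ?thesis
    by simp
qed

lemma step_eq_0: "x \<le> - 1 \<Longrightarrow> step x = 0" and step_eq_1: "0 \<le> x \<Longrightarrow> step x = 1"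
  using step_denom_pos[of x] by (auto simp: step_def flat_eq_0)

lemma step_nonneg: "0 \<le> step x" and step_le_1: "step x \<le> 1"
  using step_denom_pos[of x] flat_nonneg[of "x + 1"] flat_nonneg[of "- x"] by (auto simp: step_def)

lemma deriv_eq_0_of_const_on:
  assumes "open S" "x \<in> S" "\<And>y. y \<in> S \<Longrightarrow> f y = c"
  shows "deriv f x = (0 :: real)"
proof (rule DERIV_imp_deriv)
  have "((\<lambda>_. c) has_real_derivative 0) (at x)"
    by simp
  then show "(f has_real_derivative 0) (at x)"
    by (rule has_field_derivative_transform_within_open) (use assms in auto)
qed

lemma smooth_compact_support_bounded:
  assumes "smooth f" "\<And>x. c < \<bar>x\<bar> \<Longrightarrow> f x = 0"
  shows "\<exists>M>0. \<forall>x. \<bar>f x\<bar> \<le> M"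
proof -
  have "compact (f ` {- c..c})"
    by (intro compact_continuous_image smooth_continuous_on assms) simp
  then obtain M where M: "\<And>x. x \<in> {- c..c} \<Longrightarrow> \<bar>f x\<bar> \<le> M"
    by (fastforce simp: bounded_iff dest!: compact_imp_bounded)
  have "\<bar>f x\<bar> \<le> max M 1" for x
    using M[of x] assms(2)[of x] by (cases "x \<in> {- c..c}") (force simp: le_max_iff_disj)+
  then show ?thesis
    by (intro exI[of _ "max M 1"]) auto
qed

text \<open>As the derivative of \<open>step\<close> it has integral 1 without normalization. The
  explicit antiderivative serves again when mollifiers at two scales are compared, in
  \<open>deriv_step_scaled\<close>.\<close>

definition mollifier :: "real \<Rightarrow> real" where
  "mollifier = deriv step"

lemma smooth_mollifier: "smooth mollifier"
  unfolding mollifier_def by (intro smooth_deriv smooth_step)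

lemma step_DERIV: "(step has_real_derivative mollifier x) (at x)"
  unfolding mollifier_def by (intro smooth_DERIV smooth_step)

lemma mollifier_eq_0: "1 < \<bar>x\<bar> \<Longrightarrow> mollifier x = 0"
  unfolding mollifier_def
  using deriv_eq_0_of_const_on[of "{..<-1}" x step 0] deriv_eq_0_of_const_on[of "{1<..}" x step 1]
  by (auto simp: step_eq_0 step_eq_1 abs_if split: if_splits)

lemma has_bochner_integral_mollifier: "has_bochner_integral lborel mollifier 1"
proof -
  have "has_bochner_integral lborel (\<lambda>x. mollifier x * indicator {-1..1} x) (step 1 - step (-1))"
    by (rule has_bochner_integral_FTC_Icc_real)
       (auto intro!: step_DERIV has_field_derivative_at_within smooth_mollifier
          continuous_on_interior[OF smooth_continuous_on[of _ UNIV]])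
  moreover have "mollifier x * indicator {-1..1} x = mollifier x" for x
    using mollifier_eq_0[of x] by (cases "\<bar>x\<bar> \<le> 1") (auto simp: indicator_def abs_if split: if_splits)
  ultimately show ?thesis
    by (simp add: step_eq_0 step_eq_1)
qed

text \<open>The plateau ends at 3/2 and not at 1, so that the derivatives vanish on a neighbourhood
  of [-1, 1]; powers of this function then meet the conditions of \<open>profile\<close> on the
  closed interval.\<close>

definition cutoff :: "real \<Rightarrow> real" where
  "cutoff x = step (3 - 2 * x) * step (3 + 2 * x)"

lemma smooth_cutoff: "smooth cutoff"
proof -
  have "smooth (\<lambda>x. step (- 2 * x + 3) * step (2 * x + 3))"
    by (intro smooth_mult smooth_affine smooth_step)
  then show ?thesis
    by (simp add: cutoff_def[abs_def] algebra_simps)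
qed

lemma cutoff_eq_1: "\<bar>x\<bar> \<le> 3 / 2 \<Longrightarrow> cutoff x = 1"
  by (auto simp: cutoff_def step_eq_1 abs_if split: if_splits)

lemma cutoff_eq_0: "2 \<le> \<bar>x\<bar> \<Longrightarrow> cutoff x = 0"
  by (auto simp: cutoff_def step_eq_0 abs_if split: if_splits)

lemma cutoff_nonneg: "0 \<le> cutoff x" and cutoff_le_1: "cutoff x \<le> 1"
  by (auto simp: cutoff_def step_nonneg step_le_1 intro: mult_le_one)

section \<open>Tensor products of smooth functions\<close>

text \<open>Products of functions of the single coordinates are closed under \<open>partial\<close>,
  which replaces one factor by its derivative. The mollifiers and cutoffs on the whole space have
  this form.\<close>

definition tensor :: "('n \<Rightarrow> real \<Rightarrow> real) \<Rightarrow> real^'n::finite \<Rightarrow> real" where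
  "tensor h x = (\<Prod>i\<in>UNIV. h i (x $ i))"

lemma tensor_measurable [measurable]:
  assumes "\<And>i. h i \<in> borel_measurable borel"
  shows "tensor h \<in> borel_measurable borel"
proof -
  have "(\<lambda>x :: real^'a. h i (x $ i)) \<in> borel_measurable borel" for i
    by (intro measurable_compose[OF _ assms] borel_measurable_continuous_onI continuous_intros)
  then show ?thesis
    unfolding tensor_def[abs_def] by (intro borel_measurable_prod)
qed

lemma has_derivative_tensor:
  assumes "\<And>i. smooth (h i)"
  shows "(tensor h has_derivative
    (\<lambda>v. \<Sum>i\<in>UNIV. (deriv (h i) (x $ i) * v $ i) * (\<Prod>j\<in>UNIV - {i}. h j (x $ j)))) (at x)"
proof -
  have "((\<lambda>x. h i (x $ i)) has_derivative (\<lambda>v. deriv (h i) (x $ i) * v $ i)) (at x)" for i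
    by (rule has_derivative_compose[where g = "h i" and f = "\<lambda>x. x $ i"])
       (use smooth_DERIV[OF assms] in \<open>auto simp: has_field_derivative_def
          intro!: bounded_linear_imp_has_derivative bounded_linear_vec_nth\<close>)
  then show ?thesis
    unfolding tensor_def[abs_def] by (intro has_derivative_prod)
qed

lemma partial_tensor:
  assumes "\<And>i. smooth (h i)"
  shows "partial i (tensor h) = tensor (h(i := deriv (h i)))"
proof
  fix x :: "real^'a"
  have "partial i (tensor h) x
      = (\<Sum>k\<in>UNIV. (deriv (h k) (x $ k) * axis i 1 $ k) * (\<Prod>j\<in>UNIV - {k}. h j (x $ j)))"
    unfolding partial_def by (simp add: frechet_derivative_at[OF has_derivative_tensor[of h, OF assms], symmetric])
  also have "\<dots> = deriv (h i) (x $ i) * (\<Prod>j\<in>UNIV - {i}. h j (x $ j))"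
    by (subst sum.remove[of _ i]) (auto simp: axis_def)
  also have "\<dots> = tensor (h(i := deriv (h i))) x"
    unfolding tensor_def by (subst prod.remove[of UNIV i]) auto
  finally show "partial i (tensor h) x = tensor (h(i := deriv (h i))) x" .
qed

lemma continuous_on_tensor:
  assumes "\<And>i. smooth (h i)"
  shows "continuous_on A (tensor h)"
  by (intro continuous_at_imp_continuous_on ballI)
     (rule has_derivative_continuous[OF has_derivative_tensor[of h, OF assms]])

lemma C_k_tensor:
  assumes "\<And>i. smooth (h i)"
  shows "C_k k (tensor h)"
  using assms
proof (induction k arbitrary: h)
  case (Suc k)
  have "smooth ((h(i := deriv (h i))) j)" for i j
    using Suc.prems by (auto intro: smooth_deriv)
  then show ?case
    using Suc has_derivative_tensor[of h, OF Suc.prems]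
    by (simp add: partial_tensor differentiable_def) blast
qed (simp add: continuous_on_tensor)

text \<open>The ball of the maximum norm, the natural support of a tensor product of functions
  supported in [-r, r].\<close>

definition cube :: "real \<Rightarrow> (real^'n::finite) set" where
  "cube r = {x. \<forall>i. \<bar>x $ i\<bar> \<le> r}"

lemma cube_eq_cbox: "cube r = cbox (\<chi> i. - r) (\<chi> i. r)"
proof -
  have "\<bar>t\<bar> \<le> r \<longleftrightarrow> - r \<le> t \<and> t \<le> r" for t
    by linarith
  then show ?thesis
    by (simp add: cube_def set_eq_iff mem_box_cart)
qed

lemma cube_measurable [measurable]: "cube r \<in> sets borel"
  by (simp add: cube_eq_cbox)

lemma uminus_cube [simp]: "- x \<in> cube r \<longleftrightarrow> x \<in> cube r"
  by (simp add: cube_def)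

lemma tensor_eq_0: "(\<And>i x. r < \<bar>x\<bar> \<Longrightarrow> h i x = 0) \<Longrightarrow> x \<notin> cube r \<Longrightarrow> tensor h x = 0"
  unfolding tensor_def cube_def by (auto simp: not_le)

lemma test_functionI:
  assumes "\<And>k. C_k k f" "\<And>x. x \<notin> K \<Longrightarrow> f x = 0" "compact K"
  shows "test_function f"
  unfolding test_function_def
proof
  have "{x. f x \<noteq> 0} \<subseteq> K"
    using assms(2) by auto
  then show "compact (closure {x. f x \<noteq> 0})"
    using assms(3) by (meson bounded_subset compact_closure compact_imp_bounded)
qed (use assms(1) in blast)

lemma test_function_tensor:
  assumes "\<And>i. smooth (h i)" "\<And>x. x \<notin> K \<Longrightarrow> tensor h x = 0" "compact K"
  shows "test_function (tensor h)"
  by (rule test_functionI[OF _ assms(2,3)]) (intro C_k_tensor assms(1))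

lemma measure_translated_cube:
  assumes "0 \<le> r"
  shows "emeasure lborel ((\<lambda>x. x - a) -` cube r :: (real^'n::finite) set) = ennreal ((2 * r) ^ CARD('n))"
proof -
  have eq: "(\<lambda>x. x - a) -` cube r = cbox (\<chi> i. a $ i - r) (\<chi> i. a $ i + r)"
  proof -
    have "\<bar>t - c\<bar> \<le> r \<longleftrightarrow> c - r \<le> t \<and> t \<le> c + r" for t c
      by linarith
    then show ?thesis
      by (simp add: cube_def set_eq_iff mem_box_cart)
  qed
  have ne: "cbox (\<chi> i. a $ i - r) (\<chi> i. a $ i + r) \<noteq> {}"
    using assms by (auto simp: interval_ne_empty_cart)
  have "measure lborel ((\<lambda>x. x - a) -` cube r) = (2 * r) ^ CARD('n)"
    unfolding eq content_cbox_cart[OF ne] by simp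
  then show ?thesis
    using emeasure_lborel_cbox_finite[of "\<chi> i. a $ i - r" "\<chi> i. a $ i + r"]
    by (subst emeasure_eq_ennreal_measure) (auto simp: eq)
qed

lemma integral_tensor:
  assumes "\<And>i. integrable lborel (h i)"
  shows "integrable lborel (tensor h)" "integral\<^sup>L lborel (tensor h) = (\<Prod>i\<in>UNIV. integral\<^sup>L lborel (h i))"
proof -
  interpret product_sigma_finite "\<lambda>_. lborel :: real measure" ..
  let ?B = "Basis :: (real^'a) set"
  \<comment> \<open>Recovers the index of a basis vector: \<open>lborel_eq\<close> presents Lebesgue
    measure as a product over \<open>Basis\<close>, whereas \<open>tensor\<close> is indexed by
    coordinates.\<close>
  let ?\<iota> = "\<lambda>b :: real^'a. THE i. b = axis i 1"
  have \<iota>: "?\<iota> (axis i 1) = i" for i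
    by (auto simp: axis_eq_axis)
  have B: "?B = (\<lambda>i. axis i 1) ` UNIV"
    by (auto simp: Basis_vec_def)
  have inj: "inj (\<lambda>i. axis i 1 :: real^'a)"
    by (auto simp: inj_on_def axis_eq_axis)
  have m: "h i \<in> borel_measurable borel" for i
    using assms[of i] by auto
  have mt: "tensor h \<in> borel_measurable borel"
    by (rule tensor_measurable) (rule m)
  have T: "(\<lambda>f. \<Sum>b\<in>?B. f b *\<^sub>R b) \<in> (\<Pi>\<^sub>M b\<in>?B. lborel) \<rightarrow>\<^sub>M borel"
    by measurable
  have eq: "tensor h (\<Sum>b\<in>?B. f b *\<^sub>R b) = (\<Prod>b\<in>?B. h (?\<iota> b) (f b))" for f
  proof -
    have "(\<Sum>b\<in>?B. f b *\<^sub>R b) $ i = f (axis i 1)" for i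
      unfolding B by (subst sum.reindex[OF inj]) (simp add: axis_def if_distrib[of "\<lambda>x. _ * x"] cong: if_cong)
    then show ?thesis
      unfolding tensor_def B by (subst prod.reindex[OF inj]) (simp add: \<iota>)
  qed
  have i: "integrable (\<Pi>\<^sub>M b\<in>?B. lborel) (\<lambda>f. \<Prod>b\<in>?B. h (?\<iota> b) (f b))"
    by (rule product_integrable_prod) (auto intro: assms)
  show "integrable lborel (tensor h)"
    by (subst lborel_eq, subst integrable_distr_eq[OF T]) (auto simp: eq i mt)
  have "integral\<^sup>L lborel (tensor h) = (\<integral>f. (\<Prod>b\<in>?B. h (?\<iota> b) (f b)) \<partial>(\<Pi>\<^sub>M b\<in>?B. lborel))"
    by (subst lborel_eq, subst integral_distr[OF T]) (auto simp: eq mt)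
  also have "\<dots> = (\<Prod>b\<in>?B. integral\<^sup>L lborel (h (?\<iota> b)))"
    by (rule product_integral_prod) (auto intro: assms)
  also have "\<dots> = (\<Prod>i\<in>UNIV. integral\<^sup>L lborel (h i))"
    unfolding B by (subst prod.reindex[OF inj]) (simp add: \<iota>)
  finally show "integral\<^sup>L lborel (tensor h) = (\<Prod>i\<in>UNIV. integral\<^sup>L lborel (h i))" .
qed

section \<open>The inner products of the function spaces\<close>

lemma fun_of_measurable [measurable]: "fun_of f \<in> borel_measurable borel"
  using fun_of_sq_integrable[of f] by (simp add: sq_integrable_def)

lemma inner_L2_eq: "inner f g = (\<integral>x. fun_of f x * fun_of g x \<partial>lborel)"
  by (simp add: inner_L2_def)

lemma inner_abs_L2:
  assumes "sq_integrable \<phi>"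
  shows "inner f (abs_L2 \<phi>) = (\<integral>x. fun_of f x * \<phi> x \<partial>lborel)"
proof -
  have "AE x in lborel. fun_of (abs_L2 \<phi>) x = \<phi> x"
    using L2_rel_fun_of[OF assms] by (rule L2_rel_imp_AE)
  moreover have "\<phi> \<in> borel_measurable borel"
    using assms by (simp add: sq_integrable_def)
  ultimately show ?thesis
    unfolding inner_L2_eq by (intro integral_cong_AE) auto
qed

lemma norm_L2_sq: "(norm f)\<^sup>2 = (\<integral>x. (fun_of f x)\<^sup>2 \<partial>lborel)"
  by (simp only: power2_norm_eq_inner inner_L2_eq) (simp add: power2_eq_square)

lemma weak_partial_inner:
  assumes "weak_partial i f g" "test_function \<phi>"
  shows "inner f (abs_L2 (partial i \<phi>)) = - inner g (abs_L2 \<phi>)"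
  using assms by (simp add: weak_partial_def inner_abs_L2 test_function_sq_integrable)

definition H1_grad :: "'n::finite H1 \<Rightarrow> 'n L2^'n" where
  "H1_grad f = snd (Rep_H1 f)"

definition H2_grad :: "'n::finite H2 \<Rightarrow> 'n L2^'n" where
  "H2_grad f = fst (snd (Rep_H2 f))"

definition H2_hess :: "'n::finite H2 \<Rightarrow> 'n L2^'n^'n" where
  "H2_hess f = snd (snd (Rep_H2 f))"

lemma bounded_linear_Rep_H1: "bounded_linear Rep_H1"
  by (rule bounded_linear_intro[where K = 1])
     (simp_all add: plus_H1.rep_eq scaleR_H1.rep_eq norm_H1_def inner_H1.rep_eq norm_eq_sqrt_inner)

lemma bounded_linear_Rep_H2: "bounded_linear Rep_H2"
  by (rule bounded_linear_intro[where K = 1])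
     (simp_all add: plus_H2.rep_eq scaleR_H2.rep_eq norm_H2_def inner_H2.rep_eq norm_eq_sqrt_inner)

lemma bounded_linear_H1_to_L2: "bounded_linear H1_to_L2"
  unfolding H1_to_L2_def by (intro bounded_linear_fst_comp bounded_linear_Rep_H1)

lemma bounded_linear_H1_grad: "bounded_linear H1_grad"
  unfolding H1_grad_def by (intro bounded_linear_snd_comp bounded_linear_Rep_H1)

lemma bounded_linear_H2_to_L2: "bounded_linear H2_to_L2"
  unfolding H2_to_L2_def by (intro bounded_linear_fst_comp bounded_linear_Rep_H2)

lemma bounded_linear_H2_grad: "bounded_linear H2_grad"
  unfolding H2_grad_def by (intro bounded_linear_fst_comp bounded_linear_snd_comp bounded_linear_Rep_H2)

lemma H2_to_H1_simps [simp]: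
  "H1_to_L2 (H2_to_H1 f) = H2_to_L2 f" "H1_grad (H2_to_H1 f) = H2_grad f"
  by (auto simp: H1_to_L2_def H2_to_L2_def H1_grad_def H2_grad_def H2_to_H1.rep_eq split: prod.split)

lemma laplacian_eq: "laplacian f = (\<Sum>i\<in>UNIV. H2_hess f $ i $ i)"
  by (simp add: laplacian_def H2_hess_def)

lemma weak_partial_H1: "weak_partial i (H1_to_L2 f) (H1_grad f $ i)"
  using Rep_H1[of f] by (auto simp: H1_to_L2_def H1_grad_def)

lemma weak_partial_H2:
  "weak_partial i (H2_to_L2 f) (H2_grad f $ i)" "weak_partial j (H2_grad f $ i) (H2_hess f $ i $ j)"
  using Rep_H2[of f] by (auto simp: H2_to_L2_def H2_grad_def H2_hess_def)

lemma norm_H1_sq: "(norm f)\<^sup>2 = (norm (H1_to_L2 f))\<^sup>2 + (norm (H1_grad f))\<^sup>2"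
  by (simp add: power2_norm_eq_inner inner_H1.rep_eq H1_to_L2_def H1_grad_def inner_prod_def)

lemma norm_H1_to_L2_le: "norm (H1_to_L2 f) \<le> norm f"
  and norm_H1_grad_le: "norm (H1_grad f) \<le> norm f"
  by (rule power2_le_imp_le; simp add: norm_H1_sq)+

section \<open>Convolution forms and mollification\<close>

abbreviation lborel2 :: "((real^'n::finite) \<times> (real^'n)) measure" where
  "lborel2 \<equiv> lborel \<Otimes>\<^sub>M lborel"

lemma integrable_indicator_cube:
  fixes x :: "real^'n::finite"
  assumes "0 \<le> r"
  shows "integrable lborel (\<lambda>y. indicator (cube r) (y - x) :: real)"
    and "(\<integral>y. indicator (cube r) (y - x) \<partial>lborel) = (2 * r) ^ CARD('n)"
proof -
  have eq: "(\<lambda>y. indicator (cube r) (y - x) :: real) = indicator ((\<lambda>y. y - x) -` cube r)"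
    by (auto simp: indicator_def)
  have "(\<lambda>y. y - x) -` cube r \<in> sets (lborel :: (real^'n) measure)"
    using measurable_sets[of "\<lambda>y. y - x" lborel borel "cube r"] by simp
  with measure_translated_cube[OF assms, of x] assms
  show "integrable lborel (\<lambda>y. indicator (cube r) (y - x) :: real)"
    "(\<integral>y. indicator (cube r) (y - x) \<partial>lborel) = (2 * r) ^ CARD('n)"
    unfolding eq by (auto simp: measure_def)
qed

text \<open>Integrating out the variable on which h does not depend leaves the volume of a cube.
  These functions serve to dominate the bilinear forms.\<close>

lemma integrable_cube_pair:
  fixes h :: "real^'n::finite \<Rightarrow> real"
  assumes h: "integrable lborel h" and r: "0 \<le> r"
  shows "integrable lborel2 (\<lambda>(x, y). h x * indicator (cube r) (y - x))" (is ?A)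
    and "(\<integral>(x, y). h x * indicator (cube r) (y - x) \<partial>lborel2) = (2 * r) ^ CARD('n) * integral\<^sup>L lborel h" (is ?B)
    and "integrable lborel2 (\<lambda>(x, y). h y * indicator (cube r) (y - x))" (is ?C)
    and "(\<integral>(x, y). h y * indicator (cube r) (y - x) \<partial>lborel2) = (2 * r) ^ CARD('n) * integral\<^sup>L lborel h" (is ?D)
proof -
  have [measurable]: "h \<in> borel_measurable borel"
    using h by auto
  show A: ?A
  proof (rule lborel_pair.Fubini_integrable)
    have "(\<lambda>x. \<integral>y. norm (case (x, y) of (x, y) \<Rightarrow> h x * indicator (cube r) (y - x)) \<partial>lborel)
        = (\<lambda>x. \<bar>h x\<bar> * (2 * r) ^ CARD('n))"
      using r by (simp add: abs_mult integrable_indicator_cube)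
    then show "integrable lborel (\<lambda>x. \<integral>y. norm (case (x, y) of (x, y) \<Rightarrow> h x * indicator (cube r) (y - x)) \<partial>lborel)"
      using h by simp
  qed (use r in \<open>auto intro!: integrable_mult_right integrable_indicator_cube\<close>)
  have "(\<integral>x. (\<integral>y. h x * indicator (cube r) (y - x) \<partial>lborel) \<partial>lborel) = (2 * r) ^ CARD('n) * integral\<^sup>L lborel h"
    using r by (simp add: integrable_indicator_cube mult.commute)
  then show B: ?B
    using lborel_pair.integral_fst[OF A] by simp
  have sw: "(\<lambda>(x, y). (case (y, x) of (x, y) \<Rightarrow> h x * indicator (cube r) (y - x)))
      = (\<lambda>(x, y). h y * indicator (cube r) (y - x))"
  proof -
    have "x - y \<in> cube r \<longleftrightarrow> y - x \<in> cube r" for x y :: "real^'n"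
      using uminus_cube[of "x - y" r] by simp
    then show ?thesis
      by (auto simp: indicator_def)
  qed
  show ?C
    using lborel_pair.integrable_product_swap[OF A] unfolding sw .
  show ?D
    using lborel_pair.integral_product_swap[of "\<lambda>(x, y). h x * indicator (cube r) (y - x)"] B
    unfolding sw by simp
qed

lemma integrable_product_pair:
  fixes f g :: "real^'n::finite \<Rightarrow> real"
  assumes f: "integrable lborel f" and g: "integrable lborel g"
  shows "integrable lborel2 (\<lambda>(x, y). f x * g y)" (is ?A)
    and "(\<integral>(x, y). f x * g y \<partial>lborel2) = integral\<^sup>L lborel f * integral\<^sup>L lborel g" (is ?B)
proof -
  have [measurable]: "f \<in> borel_measurable borel" "g \<in> borel_measurable borel"
    using f g by auto
  show A: ?A
    by (rule lborel_pair.Fubini_integrable) (use f g in \<open>auto simp: abs_mult\<close>)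
  show ?B
    using lborel_pair.integral_fst[OF A] by simp
qed

text \<open>The pairing of g with the convolution of f and k. Keeping the double integral avoids
  constructing the convolution as an L^2 class.\<close>

definition conv_form ::
  "(real^'n::finite \<Rightarrow> real) \<Rightarrow> (real^'n \<Rightarrow> real) \<Rightarrow> (real^'n \<Rightarrow> real) \<Rightarrow> real" where
  "conv_form k f g = (\<integral>(x, y). f x * g y * k (y - x) \<partial>lborel2)"

definition kernel_bound :: "real \<Rightarrow> real \<Rightarrow> (real^'n::finite \<Rightarrow> real) \<Rightarrow> bool" where
  "kernel_bound M r k \<longleftrightarrow> k \<in> borel_measurable borel \<and> 0 \<le> M \<and> 0 \<le> r \<and>
     (\<forall>z. \<bar>k z\<bar> \<le> M * indicator (cube r) z)"

lemma abs_mult_le_weighted: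
  fixes a b \<theta> :: real
  assumes "0 < \<theta>"
  shows "\<bar>a * b\<bar> \<le> (\<theta> * a\<^sup>2 + b\<^sup>2 / \<theta>) / 2"
proof -
  have "0 \<le> (\<theta> * \<bar>a\<bar> - \<bar>b\<bar>)\<^sup>2 / \<theta>"
    using assms by simp
  also have "\<dots> = \<theta> * a\<^sup>2 + b\<^sup>2 / \<theta> - 2 * \<bar>a * b\<bar>"
    using assms by (simp add: power2_diff power_mult_distrib field_simps abs_mult) (simp add: power2_eq_square)
  finally show ?thesis
    by simp
qed

text \<open>A Schur test in which AM-GM with weight \<theta> replaces Cauchy-Schwarz, so that a
  caller can balance a large factor against a small one. For kernels bounded by (M / r)^n on a cube
  of half-side r the constant does not depend on r.\<close>

lemma conv_form_bound:
  fixes k :: "real^'n::finite \<Rightarrow> real"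
  assumes k: "kernel_bound M r k" and f: "sq_integrable f" and g: "sq_integrable g"
  shows "integrable lborel2 (\<lambda>(x, y). f x * g y * k (y - x))"
    and "0 < \<theta> \<Longrightarrow> \<bar>conv_form k f g\<bar>
      \<le> M * (2 * r) ^ CARD('n) * (\<theta> * (\<integral>x. (f x)\<^sup>2 \<partial>lborel) + (\<integral>x. (g x)\<^sup>2 \<partial>lborel) / \<theta>) / 2"
proof -
  have [measurable]: "f \<in> borel_measurable borel" "g \<in> borel_measurable borel" "k \<in> borel_measurable borel"
    using assms by (auto simp: sq_integrable_def kernel_bound_def)
  have M: "0 \<le> M" "0 \<le> r" "\<bar>k z\<bar> \<le> M * indicator (cube r) z" for z
    using k by (auto simp: kernel_bound_def)
  have f2: "integrable lborel (\<lambda>x. (f x)\<^sup>2)" and g2: "integrable lborel (\<lambda>x. (g x)\<^sup>2)"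
    using f g by (auto simp: sq_integrable_def)
  define H where "H \<theta> = (\<lambda>(x, y). M / 2 * (\<theta> * ((f x)\<^sup>2 * indicator (cube r) (y - x))
      + ((g y)\<^sup>2 * indicator (cube r) (y - x)) / \<theta>))" for \<theta>
  have H: "integrable lborel2 (H \<theta>)" "integral\<^sup>L lborel2 (H \<theta>)
      = M * (2 * r) ^ CARD('n) * (\<theta> * (\<integral>x. (f x)\<^sup>2 \<partial>lborel) + (\<integral>x. (g x)\<^sup>2 \<partial>lborel) / \<theta>) / 2" for \<theta>
    using integrable_cube_pair[OF f2 M(2)] integrable_cube_pair[OF g2 M(2)]
    unfolding H_def split_def by (simp_all add: algebra_simps add_divide_distrib)
  have le: "\<bar>f x * g y * k (y - x)\<bar> \<le> H \<theta> (x, y)" if "0 < \<theta>" for x y \<theta>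
  proof -
    have "\<bar>f x * g y * k (y - x)\<bar> \<le> (\<theta> * (f x)\<^sup>2 + (g y)\<^sup>2 / \<theta>) / 2 * (M * indicator (cube r) (y - x))"
      unfolding abs_mult[of "f x * g y"] by (intro mult_mono abs_mult_le_weighted that M(3)) (use that in auto)
    also have "\<dots> = H \<theta> (x, y)"
      by (simp add: H_def algebra_simps)
    finally show ?thesis .
  qed
  show int: "integrable lborel2 (\<lambda>(x, y). f x * g y * k (y - x))"
    by (rule Bochner_Integration.integrable_bound[OF H(1)[of 1]]) (use le[of 1] in \<open>auto intro!: AE_I2 order_trans[OF _ abs_ge_self]\<close>)
  assume \<theta>: "0 < \<theta>"
  have "\<bar>conv_form k f g\<bar> \<le> (\<integral>p. \<bar>(\<lambda>(x, y). f x * g y * k (y - x)) p\<bar> \<partial>lborel2)"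
    unfolding conv_form_def by (rule integral_abs_bound)
  also have "\<dots> \<le> integral\<^sup>L lborel2 (H \<theta>)"
    by (rule integral_mono) (use int H(1) le[OF \<theta>] in auto)
  finally show "\<bar>conv_form k f g\<bar>
      \<le> M * (2 * r) ^ CARD('n) * (\<theta> * (\<integral>x. (f x)\<^sup>2 \<partial>lborel) + (\<integral>x. (g x)\<^sup>2 \<partial>lborel) / \<theta>) / 2"
    unfolding H(2) .
qed

lemma kernel_bound_tensor:
  fixes h :: "'n::finite \<Rightarrow> real \<Rightarrow> real"
  assumes "\<And>i. h i \<in> borel_measurable borel" "\<And>i x. \<bar>h i x\<bar> \<le> M" "\<And>i x. r < \<bar>x\<bar> \<Longrightarrow> h i x = 0" "0 \<le> r"
  shows "kernel_bound (M ^ CARD('n)) r (tensor h)"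
proof -
  have "0 \<le> M"
    using assms(2)[of undefined 0] by linarith
  moreover have "\<bar>tensor h z\<bar> \<le> M ^ CARD('n) * indicator (cube r) z" for z
  proof (cases "z \<in> cube r")
    case True
    have "\<bar>tensor h z\<bar> \<le> (\<Prod>i\<in>(UNIV :: 'n set). M)"
      unfolding tensor_def abs_prod by (intro prod_mono) (auto intro: assms)
    then show ?thesis
      using True by simp
  next
    case False
    then show ?thesis
      using tensor_eq_0[of r h z] assms(3) by simp
  qed
  ultimately show ?thesis
    using assms by (auto simp: kernel_bound_def)
qed

lemma tensor_reflect: "tensor h (a - x) = tensor (\<lambda>i s. h i (- 1 * s + a $ i)) x"
  and tensor_translate: "tensor h (x - a) = tensor (\<lambda>i s. h i (1 * s + (- a $ i))) x"
  by (auto simp: tensor_def intro!: prod.cong)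

lemma deriv_affine:
  assumes "smooth h"
  shows "deriv (\<lambda>s. h (a * s + b)) = (\<lambda>s. a * deriv h (a * s + b))"
proof
  fix x
  show "deriv (\<lambda>s. h (a * s + b)) x = a * deriv h (a * x + b)"
    by (rule DERIV_imp_deriv, rule DERIV_cong, rule DERIV_chain'[OF _ smooth_DERIV[OF assms]])
       (auto intro!: derivative_eq_intros)
qed

lemma tensor_upd_scale: "tensor (h(i := (\<lambda>s. c * g s))) x = c * tensor (h(i := g)) x"
  unfolding tensor_def by (subst (1 2) prod.remove[of UNIV i]) auto

text \<open>The kernel is tested as a function of x. In the first identity the reflection x -> y - x
  produces a sign that cancels the one in the definition of a weak derivative; in the second, a
  translation, that sign remains.\<close>

lemma weak_partial_tensor:
  fixes f g :: "'n::finite L2"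
  assumes wp: "weak_partial i f g" and h: "\<And>j. smooth (h j)" and r: "\<And>j x. r < \<bar>x\<bar> \<Longrightarrow> h j x = 0"
  shows "(\<integral>x. fun_of g x * tensor h (y - x) \<partial>lborel) = (\<integral>x. fun_of f x * partial i (tensor h) (y - x) \<partial>lborel)"
    and "(\<integral>x. fun_of g x * tensor h (x - y) \<partial>lborel) = - (\<integral>x. fun_of f x * partial i (tensor h) (x - y) \<partial>lborel)"
proof -
  have c: "compact ((\<lambda>z. y - z) ` cube r)" "compact ((\<lambda>z. z + y) ` cube r)"
    by (auto simp: cube_eq_cbox intro!: compact_continuous_image continuous_intros)
  let ?R = "\<lambda>i s. h i (- 1 * s + y $ i)" and ?T = "\<lambda>i s. h i (1 * s + (- y $ i))"
  have sR: "smooth (?R j)" and sT: "smooth (?T j)" for j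
    by (intro smooth_affine h)+
  have tR: "test_function (tensor ?R)"
  proof (rule test_function_tensor[OF sR _ c(1)])
    fix x assume x: "x \<notin> (\<lambda>z. y - z) ` cube r"
    have "y - x \<notin> cube r"
    proof
      assume "y - x \<in> cube r"
      then have "y - (y - x) \<in> (\<lambda>z. y - z) ` cube r"
        by (rule imageI)
      then show False
        using x by simp
    qed
    then show "tensor ?R x = 0"
      unfolding tensor_reflect[symmetric] using r by (intro tensor_eq_0)
  qed
  have tT: "test_function (tensor ?T)"
  proof (rule test_function_tensor[OF sT _ c(2)])
    fix x assume x: "x \<notin> (\<lambda>z. z + y) ` cube r"
    have "x - y \<notin> cube r"
    proof
      assume "x - y \<in> cube r"
      then have "(x - y) + y \<in> (\<lambda>z. z + y) ` cube r"
        by (rule imageI)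
      then show False
        using x by simp
    qed
    then show "tensor ?T x = 0"
      unfolding tensor_translate[symmetric] using r by (intro tensor_eq_0)
  qed
  have pR: "partial i (tensor ?R) x = - partial i (tensor h) (y - x)" for x
  proof -
    have "?R(i := deriv (?R i)) = ?R(i := (\<lambda>s. - 1 * deriv (h i) (- 1 * s + y $ i)))"
      using deriv_affine[OF h, of i "-1" "y $ i"] by simp
    then have "partial i (tensor ?R) x = - 1 * tensor (?R(i := (\<lambda>s. deriv (h i) (- 1 * s + y $ i)))) x"
      unfolding partial_tensor[of ?R, OF sR] by (simp only: tensor_upd_scale)
    also have "?R(i := (\<lambda>s. deriv (h i) (- 1 * s + y $ i))) = (\<lambda>j s. (h(i := deriv (h i))) j (- 1 * s + y $ j))"
      by auto
    finally show ?thesis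
      unfolding partial_tensor[of h, OF h] tensor_reflect by simp
  qed
  have pT: "partial i (tensor ?T) x = partial i (tensor h) (x - y)" for x
  proof -
    have "?T(i := deriv (?T i)) = (\<lambda>j s. (h(i := deriv (h i))) j (1 * s + (- y $ j)))"
      using deriv_affine[OF h, of i 1 "- y $ i"] by auto
    then show ?thesis
      unfolding partial_tensor[of ?T, OF sT] partial_tensor[of h, OF h] tensor_translate by simp
  qed
  show "(\<integral>x. fun_of g x * tensor h (y - x) \<partial>lborel) = (\<integral>x. fun_of f x * partial i (tensor h) (y - x) \<partial>lborel)"
    using wp[unfolded weak_partial_def, rule_format, OF tR] unfolding pR by (simp add: tensor_reflect)
  show "(\<integral>x. fun_of g x * tensor h (x - y) \<partial>lborel) = - (\<integral>x. fun_of f x * partial i (tensor h) (x - y) \<partial>lborel)"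
    using wp[unfolded weak_partial_def, rule_format, OF tT] unfolding pT by (simp add: tensor_translate)
qed

lemma kernel_bound_smooth_tensor:
  fixes h :: "'n::finite \<Rightarrow> real \<Rightarrow> real"
  assumes "\<And>j. smooth (h j)" "\<And>j x. r < \<bar>x\<bar> \<Longrightarrow> h j x = 0" "0 \<le> r"
  shows "\<exists>M. kernel_bound M r (tensor h)"
proof -
  have "\<exists>M>0. \<forall>x. \<bar>h j x\<bar> \<le> M" for j
    by (rule smooth_compact_support_bounded[OF assms(1,2)])
  then obtain M where M: "\<And>j x. \<bar>h j x\<bar> \<le> M j"
    by metis
  have "\<bar>h j x\<bar> \<le> Max (range M)" for j x
    by (rule order_trans[OF M]) simp
  then show ?thesis
    using kernel_bound_tensor[of h "Max (range M)" r] assms by (auto intro: smooth_measurable)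
qed

lemma deriv_eq_0_outside:
  assumes "\<And>x. r < \<bar>x\<bar> \<Longrightarrow> h x = (0::real)" "r < \<bar>x\<bar>"
  shows "deriv h x = 0"
proof (rule deriv_eq_0_of_const_on)
  show "open {x :: real. r < \<bar>x\<bar>}"
    by (intro open_Collect_less continuous_intros)
qed (use assms in auto)

text \<open>A weak derivative moves from either argument onto the kernel, with opposite signs. Used
  for both arguments, this carries a derivative from one function over to the other.\<close>

lemma conv_form_weak_partial:
  fixes f g :: "'n::finite L2"
  assumes wp: "weak_partial i f g" and h: "\<And>j. smooth (h j)" and r: "\<And>j x. r < \<bar>x\<bar> \<Longrightarrow> h j x = 0" "0 \<le> r"
    and k: "sq_integrable k"
  shows "conv_form (tensor h) (fun_of g) k = conv_form (partial i (tensor h)) (fun_of f) k"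
    and "conv_form (tensor h) k (fun_of g) = - conv_form (partial i (tensor h)) k (fun_of f)"
proof -
  obtain M where M: "kernel_bound M r (tensor h)"
    using kernel_bound_smooth_tensor[of h r, OF h r] by blast
  let ?h = "h(i := deriv (h i))"
  have sm: "smooth (?h j)" for j
    using h by (auto intro: smooth_deriv)
  have "?h j x = 0" if "r < \<bar>x\<bar>" for j x
    using r(1) that by (auto intro: deriv_eq_0_outside)
  then obtain M' where M': "kernel_bound M' r (partial i (tensor h))"
    using kernel_bound_smooth_tensor[of ?h r, OF sm _ r(2)] unfolding partial_tensor[of h, OF h] by blast
  note sq = fun_of_sq_integrable
  have "conv_form (tensor h) (fun_of g) k = (\<integral>y. k y * (\<integral>x. fun_of g x * tensor h (y - x) \<partial>lborel) \<partial>lborel)"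
    unfolding conv_form_def lborel_pair.integral_snd[OF conv_form_bound(1)[OF M sq k], symmetric]
    by (simp add: mult_ac flip: integral_mult_right_zero)
  also have "\<dots> = (\<integral>y. k y * (\<integral>x. fun_of f x * partial i (tensor h) (y - x) \<partial>lborel) \<partial>lborel)"
    using weak_partial_tensor(1)[OF wp h r(1)] by simp
  also have "\<dots> = conv_form (partial i (tensor h)) (fun_of f) k"
    unfolding conv_form_def lborel_pair.integral_snd[OF conv_form_bound(1)[OF M' sq k], symmetric]
    by (simp add: mult_ac flip: integral_mult_right_zero)
  finally show "conv_form (tensor h) (fun_of g) k = conv_form (partial i (tensor h)) (fun_of f) k" .
  have "conv_form (tensor h) k (fun_of g) = (\<integral>x. k x * (\<integral>y. fun_of g y * tensor h (y - x) \<partial>lborel) \<partial>lborel)"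
    unfolding conv_form_def lborel_pair.integral_fst[OF conv_form_bound(1)[OF M k sq], symmetric]
    by (simp add: mult_ac flip: integral_mult_right_zero)
  also have "\<dots> = (\<integral>x. k x * (- (\<integral>y. fun_of f y * partial i (tensor h) (y - x) \<partial>lborel)) \<partial>lborel)"
    using weak_partial_tensor(2)[OF wp h r(1)] by simp
  also have "\<dots> = - conv_form (partial i (tensor h)) k (fun_of f)"
    unfolding conv_form_def lborel_pair.integral_fst[OF conv_form_bound(1)[OF M' k sq], symmetric]
    by (simp add: mult_ac flip: integral_mult_right_zero)
  finally show "conv_form (tensor h) k (fun_of g) = - conv_form (partial i (tensor h)) k (fun_of f)" .
qed

section \<open>Mollifiers as an approximate identity in L^2\<close>

definition mollifier_kernel :: "real \<Rightarrow> real^'n::finite \<Rightarrow> real" where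
  "mollifier_kernel r = tensor (\<lambda>i s. mollifier (s / r) / r)"

lemma smooth_scaled: "smooth h \<Longrightarrow> smooth (\<lambda>s. h (s / r) / r)"
  using smooth_mult[OF smooth_const[of "1 / r"] smooth_affine[of h "1 / r" 0]] by simp

lemma mollifier_kernel_bound:
  assumes M: "\<And>x. \<bar>mollifier x\<bar> \<le> M" and r: "0 < r"
  shows "kernel_bound ((M / r) ^ CARD('n)) r (mollifier_kernel r :: real^'n::finite \<Rightarrow> real)"
  unfolding mollifier_kernel_def
proof (rule kernel_bound_tensor)
  fix x :: real assume "r < \<bar>x\<bar>"
  then show "mollifier (x / r) / r = 0"
    using r by (auto intro!: mollifier_eq_0)
qed (use M r in \<open>auto intro!: divide_right_mono smooth_measurable smooth_scaled smooth_mollifier\<close>)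

lemma integral_mollifier_kernel:
  fixes x :: "real^'n::finite"
  assumes r: "0 < r"
  shows "(\<integral>y. mollifier_kernel r (y - x) \<partial>lborel) = 1"
proof -
  let ?h = "\<lambda>i s. mollifier ((1 * s + (- x $ i)) / r) / r"
  have "has_bochner_integral lborel (\<lambda>s. mollifier (- x $ i / r + (1 / r) * s)) (1 /\<^sub>R \<bar>1 / r\<bar>)" for i
    using lborel_has_bochner_integral_real_affine_iff[of "1 / r" mollifier 1 "- x $ i / r"]
      has_bochner_integral_mollifier r by simp
  then have "has_bochner_integral lborel (?h i) (1 /\<^sub>R \<bar>1 / r\<bar> / r)" for i
    using r by (intro has_bochner_integral_divide_zero) (simp add: diff_divide_distrib)
  then have "integrable lborel (?h i)" "integral\<^sup>L lborel (?h i) = 1" for i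
    using r by (simp_all add: has_bochner_integral_iff)
  then have "integral\<^sup>L lborel (tensor ?h) = 1"
    by (simp add: integral_tensor)
  then show ?thesis
    unfolding mollifier_kernel_def tensor_translate by simp
qed

lemma conv_form_diff_right:
  assumes "kernel_bound M r k" "sq_integrable f" "sq_integrable g" "sq_integrable h"
  shows "conv_form k f (\<lambda>x. g x - h x) = conv_form k f g - conv_form k f h"
  using conv_form_bound(1)[OF assms(1,2,3)] conv_form_bound(1)[OF assms(1,2,4)]
  unfolding conv_form_def
  by (subst Bochner_Integration.integral_diff[symmetric]) (auto simp: split_def algebra_simps)

text \<open>Since the kernel has mass 1, the error is the form with g(y) replaced by g(y) - g(x). On
  the support of the kernel that difference is uniformly small, and it vanishes unless x lies in a
  fixed cube, on which f is integrable.\<close>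

lemma conv_form_mollifier_tendsto_continuous:
  fixes f g :: "real^'n::finite \<Rightarrow> real"
  assumes f: "sq_integrable f" and g: "continuous_on UNIV g" "\<And>x. x \<notin> cube c \<Longrightarrow> g x = 0" "0 \<le> c"
    and r: "\<And>m. 0 < r m" "r \<longlonglongrightarrow> 0"
  shows "(\<lambda>m. conv_form (mollifier_kernel (r m)) f g) \<longlonglongrightarrow> (\<integral>x. f x * g x \<partial>lborel)"
proof (rule LIMSEQ_I)
  fix \<epsilon> :: real assume \<epsilon>: "0 < \<epsilon>"
  obtain M where M: "0 < M" "\<And>x. \<bar>mollifier x\<bar> \<le> M"
    using smooth_compact_support_bounded[OF smooth_mollifier, of 1] mollifier_eq_0 by auto
  have [measurable]: "f \<in> borel_measurable borel" "g \<in> borel_measurable borel"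
    using f borel_measurable_continuous_onI[OF g(1)] by (auto simp: sq_integrable_def)
  have comp: "compact (cube c :: (real^'n) set)" for c
    by (simp add: cube_eq_cbox)
  have gs: "sq_integrable g"
    by (rule sq_integrable_compact_support[OF g(1) comp g(2)])
  have fg: "integrable lborel (\<lambda>x. f x * g x)"
    by (rule sq_integrable_mult[OF f gs])
  define F where "F x = \<bar>f x\<bar> * indicator (cube (c + 1)) x" for x
  have ind: "sq_integrable (indicator (cube (c + 1)) :: real^'n \<Rightarrow> real)"
    using integrable_indicator_cube(1)[of "c + 1" 0] g(3)
    by (simp add: sq_integrable_def power2_eq_square flip: indicator_inter_arith)
  have "sq_integrable (\<lambda>x. \<bar>f x\<bar>)"
    using f by (auto simp: sq_integrable_def)
  then have F: "integrable lborel F"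
    unfolding F_def by (rule sq_integrable_mult[OF _ ind])
  \<comment> \<open>Chosen so that the total error, \<omega> times (2 M)^n times the integral of
    \<open>F\<close>, is at most \<epsilon> / 2; the added 1 keeps the denominator positive.\<close>
  define \<omega> where "\<omega> = \<epsilon> / 2 / ((2 * M) ^ CARD('n) * (integral\<^sup>L lborel F + 1))"
  have F0: "0 \<le> integral\<^sup>L lborel F"
    by (simp add: F_def)
  have \<omega>: "0 < \<omega>"
    unfolding \<omega>_def using \<epsilon> M F0 by (intro divide_pos_pos mult_pos_pos) auto
  have "uniformly_continuous_on (cube (c + 1)) g"
    by (intro compact_uniformly_continuous comp continuous_on_subset[OF g(1)]) simp
  then obtain \<delta> where \<delta>: "0 < \<delta>" "\<And>x y. x \<in> cube (c + 1) \<Longrightarrow> y \<in> cube (c + 1) \<Longrightarrow> dist y x < \<delta> \<Longrightarrow> dist (g y) (g x) < \<omega>"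
    using \<omega> unfolding uniformly_continuous_on_def by metis
  \<comment> \<open>The bound 1 keeps both points in \<open>cube (c + 1)\<close> once one of them is
    in \<open>cube c\<close>; division by the dimension accounts for the passage from the maximum
    norm to the Euclidean norm.\<close>
  have "0 < min 1 (\<delta> / real CARD('n))"
    using \<delta> by simp
  from LIMSEQ_D[OF r(2) this] r(1) obtain N where N: "\<And>m. N \<le> m \<Longrightarrow> r m < min 1 (\<delta> / real CARD('n))"
    by (auto simp: less_le)
  show "\<exists>N. \<forall>m\<ge>N. norm (conv_form (mollifier_kernel (r m)) f g - (\<integral>x. f x * g x \<partial>lborel)) < \<epsilon>"
  proof (intro exI allI impI)
    fix m assume "N \<le> m"
    define s where "s = r m"
    have s: "0 < s" "s < 1" "CARD('n) * s < \<delta>"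
      using N[OF \<open>N \<le> m\<close>] r(1)[of m] by (auto simp: s_def field_simps)
    let ?k = "mollifier_kernel s :: real^'n \<Rightarrow> real"
    note kb = mollifier_kernel_bound[OF M(2) s(1), where 'n = 'n]
    have k: "\<bar>?k z\<bar> \<le> (M / s) ^ CARD('n) * indicator (cube s) z" for z
      using kb by (auto simp: kernel_bound_def)
    have [measurable]: "?k \<in> borel_measurable borel"
      using kb by (auto simp: kernel_bound_def)
    \<comment> \<open>If neither point lies in \<open>cube c\<close>, then g vanishes at both;
      otherwise both lie in the enlarged cube, where uniform continuity applies.\<close>
    have d: "\<bar>g y - g x\<bar> * indicator (cube s) (y - x) \<le> \<omega> * indicator (cube (c + 1)) x * indicator (cube s) (y - x)" for x y
    proof (cases "y - x \<in> cube s")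
      case True
      have nb: "u \<in> cube (c + 1)" if "v \<in> cube c" "\<And>i. \<bar>u $ i - v $ i\<bar> \<le> s" for u v :: "real^'n"
        unfolding cube_def
      proof (intro CollectI allI)
        fix i
        have "\<bar>v $ i\<bar> \<le> c"
          using that by (auto simp: cube_def)
        then show "\<bar>u $ i\<bar> \<le> c + 1"
          using that(2)[of i] s(2) by linarith
      qed
      have yx: "\<bar>y $ i - x $ i\<bar> \<le> s" "\<bar>x $ i - y $ i\<bar> \<le> s" for i
        using True by (auto simp: cube_def abs_minus_commute)
      show ?thesis
      proof (cases "x \<in> cube c \<or> y \<in> cube c")
        case True
        have xy: "x \<in> cube (c + 1)" "y \<in> cube (c + 1)"
          using True nb[of x y] nb[of y x] nb[of x x] nb[of y y] yx s by auto
        have "dist y x \<le> (\<Sum>i\<in>UNIV. \<bar>(y - x) $ i\<bar>)"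
          unfolding dist_norm by (rule norm_le_l1_cart)
        also have "\<dots> \<le> (\<Sum>i\<in>(UNIV :: 'n set). s)"
          using yx by (intro sum_mono) auto
        finally have "dist y x < \<delta>"
          using s by simp
        from \<delta>(2)[OF xy this] show ?thesis
          using xy by (auto simp: dist_real_def indicator_def)
      next
        case False
        then show ?thesis
          using g(2) \<omega> by auto
      qed
    qed simp
    let ?D = "\<lambda>(x, y). f x * (g y - g x) * ?k (y - x)"
    let ?G = "\<lambda>(x, y). \<omega> * (M / s) ^ CARD('n) * (F x * indicator (cube s) (y - x))"
    have G: "integrable lborel2 ?G" "integral\<^sup>L lborel2 ?G = \<omega> * (2 * M) ^ CARD('n) * integral\<^sup>L lborel F"
      using integrable_cube_pair(1,2)[OF F, of s] s
      by (auto simp: split_def power_mult_distrib power_divide)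
    have DG: "\<bar>?D p\<bar> \<le> ?G p" for p
    proof (cases p)
      case (Pair x y)
      have "\<bar>f x * (g y - g x) * ?k (y - x)\<bar> \<le> \<bar>f x\<bar> * \<bar>g y - g x\<bar> * ((M / s) ^ CARD('n) * indicator (cube s) (y - x))"
        unfolding abs_mult by (intro mult_left_mono k) auto
      also have "\<dots> = \<bar>f x\<bar> * (M / s) ^ CARD('n) * (\<bar>g y - g x\<bar> * indicator (cube s) (y - x))"
        by simp
      also have "\<dots> \<le> \<bar>f x\<bar> * (M / s) ^ CARD('n) * (\<omega> * indicator (cube (c + 1)) x * indicator (cube s) (y - x))"
        using M(1) s(1) by (intro mult_left_mono d) auto
      finally show ?thesis
        by (simp add: Pair F_def mult_ac)
    qed
    have fgk: "integrable lborel2 (\<lambda>(x, y). f x * g x * ?k (y - x))"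
    proof (rule Bochner_Integration.integrable_bound)
      show "integrable lborel2 (\<lambda>(x, y). (M / s) ^ CARD('n) * (f x * g x * indicator (cube s) (y - x)))"
        using integrable_cube_pair(1)[OF fg, of s] s by (auto simp: split_def)
      have "\<bar>f x * g x * ?k (y - x)\<bar> \<le> \<bar>(M / s) ^ CARD('n) * (f x * g x * indicator (cube s) (y - x))\<bar>" for x y
        using mult_left_mono[OF k[of "y - x"], of "\<bar>f x * g x\<bar>"] M(1) s(1)
        by (simp add: abs_mult mult_ac)
      then show "AE p in lborel2. norm (case p of (x, y) \<Rightarrow> f x * g x * ?k (y - x))
          \<le> norm (case p of (x, y) \<Rightarrow> (M / s) ^ CARD('n) * (f x * g x * indicator (cube s) (y - x)))"
        by auto
    qed simp
    have "(\<integral>(x, y). f x * g x * ?k (y - x) \<partial>lborel2) = (\<integral>x. (\<integral>y. f x * g x * ?k (y - x) \<partial>lborel) \<partial>lborel)"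
      using lborel_pair.integral_fst[OF fgk] by simp
    also have "\<dots> = (\<integral>x. f x * g x \<partial>lborel)"
      by (simp add: integral_mollifier_kernel s(1))
    finally have fgk_eq: "(\<integral>(x, y). f x * g x * ?k (y - x) \<partial>lborel2) = (\<integral>x. f x * g x \<partial>lborel)" .
    have "?D = (\<lambda>p. (case p of (x, y) \<Rightarrow> f x * g y * ?k (y - x)) - (case p of (x, y) \<Rightarrow> f x * g x * ?k (y - x)))"
      by (auto simp: algebra_simps)
    then have "conv_form ?k f g - (\<integral>x. f x * g x \<partial>lborel) = integral\<^sup>L lborel2 ?D"
      using conv_form_bound(1)[OF kb f gs] fgk
      by (simp only: conv_form_def Bochner_Integration.integral_diff fgk_eq)
    moreover have "\<bar>integral\<^sup>L lborel2 ?D\<bar> \<le> integral\<^sup>L lborel2 ?G"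
      by (rule order_trans[OF integral_abs_bound]) (intro integral_mono' G DG order_trans[OF abs_ge_zero DG])
    moreover have "\<omega> * (2 * M) ^ CARD('n) * integral\<^sup>L lborel F \<le> \<epsilon> / 2"
    proof -
      have V: "0 < (2 * M) ^ CARD('n)"
        using M(1) by simp
      have "\<omega> * (2 * M) ^ CARD('n) * integral\<^sup>L lborel F = \<epsilon> / 2 * (integral\<^sup>L lborel F / (integral\<^sup>L lborel F + 1))"
      proof -
        have "\<epsilon> / 2 / (V * (I + 1)) * V * I = \<epsilon> / 2 * (I / (I + 1))" if "0 < V" for V I :: real
          using that by simp
        from this[OF V] show ?thesis
          unfolding \<omega>_def .
      qed
      also have "\<dots> \<le> \<epsilon> / 2 * 1"
        using \<epsilon> F0 by (intro mult_left_mono) auto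
      finally show ?thesis
        by simp
    qed
    ultimately show "norm (conv_form (mollifier_kernel (r m)) f g - (\<integral>x. f x * g x \<partial>lborel)) < \<epsilon>"
      using \<epsilon> G(2) unfolding s_def by simp
  qed
qed

text \<open>Two approximations. Cutting g off in space and in height converges in L^2 by domination.
  Inside the cutoffs g is then replaced by continuous functions converging to it almost everywhere,
  for which the cutoffs supply the dominating function.\<close>

lemma exists_continuous_L2_approx:
  fixes g :: "real^'n::finite \<Rightarrow> real"
  assumes g: "sq_integrable g" and \<epsilon>: "0 < \<epsilon>"
  shows "\<exists>h c. continuous_on UNIV h \<and> 0 \<le> c \<and> (\<forall>x. x \<notin> cube c \<longrightarrow> h x = 0) \<and>
    (\<integral>x. (g x - h x)\<^sup>2 \<partial>lborel) < \<epsilon>"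
proof -
  have gm [measurable]: "g \<in> borel_measurable borel"
    using g by (simp add: sq_integrable_def)
  have "g measurable_on UNIV"
    by (intro lebesgue_measurable_imp_measurable_on_real measurable_completion) (use gm in auto)
  then obtain N a where N: "negligible N" and a: "\<And>n. continuous_on UNIV (a n)"
    and lim: "\<And>x. x \<notin> N \<Longrightarrow> (\<lambda>n. a n x) \<longlonglongrightarrow> g x"
    unfolding measurable_on_def by auto
  have N0: "AE x in lborel. x \<notin> N"
    using N AE_not_in[of N lebesgue] by (simp only: negligible_iff_null_sets AE_completion_iff)
  define \<zeta> where "\<zeta> j = (tensor (\<lambda>_ s. cutoff (s / real (Suc j))) :: real^'n \<Rightarrow> real)" for j
  have sm: "smooth (\<lambda>s. cutoff (s / real (Suc j)))" for j
    using smooth_affine[OF smooth_cutoff, of "1 / real (Suc j)" 0] by simp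
  have \<zeta>c: "continuous_on UNIV (\<zeta> j)" for j
    unfolding \<zeta>_def by (intro continuous_on_tensor sm)
  have \<zeta>01: "0 \<le> \<zeta> j x" "\<zeta> j x \<le> 1" for j x
    unfolding \<zeta>_def tensor_def by (auto intro!: prod_nonneg prod_le_1 simp: cutoff_nonneg cutoff_le_1)
  have \<zeta>0: "\<zeta> j x = 0" if "x \<notin> cube (2 * real (Suc j))" for j x
    unfolding \<zeta>_def
    by (rule tensor_eq_0[OF _ that], rule cutoff_eq_0) (simp add: field_simps)
  have \<zeta>1: "\<zeta> j x = 1" if "norm x \<le> real (Suc j)" for j x
  proof -
    have "\<bar>x $ i / real (Suc j)\<bar> \<le> 1" for i
      using order_trans[OF component_le_norm_cart that, of i] by (simp add: field_simps)
    then show ?thesis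
      unfolding \<zeta>_def tensor_def by (intro prod.neutral ballI cutoff_eq_1) (rule order_trans, assumption, simp)
  qed
  define cl where "cl j v = max (- real j) (min (real j) v)" for j and v :: real
  have g2: "integrable lborel (\<lambda>x. (g x)\<^sup>2)"
    using g by (simp add: sq_integrable_def)
  have [measurable]: "\<zeta> j \<in> borel_measurable borel" "a n \<in> borel_measurable borel" for j n
    by (intro borel_measurable_continuous_onI \<zeta>c a)+
  have "(\<lambda>j. \<integral>x. (g x - \<zeta> j x * cl j (g x))\<^sup>2 \<partial>lborel) \<longlonglongrightarrow> (\<integral>x. 0 \<partial>(lborel :: (real^'n) measure))"
  proof (rule integral_dominated_convergence[OF _ _ g2])
    show "AE x in lborel. (\<lambda>j. (g x - \<zeta> j x * cl j (g x))\<^sup>2) \<longlonglongrightarrow> 0"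
    proof (rule AE_I2, rule tendsto_eventually)
      fix x
      obtain J where J: "\<bar>g x\<bar> \<le> real J" "norm x \<le> real J"
        by (meson real_arch_simple max.bounded_iff)
      show "\<forall>\<^sub>F j in sequentially. (g x - \<zeta> j x * cl j (g x))\<^sup>2 = 0"
        using eventually_ge_at_top[of J]
      proof eventually_elim
        case (elim j)
        then have "\<bar>g x\<bar> \<le> real j" "norm x \<le> real (Suc j)"
          using J by auto
        then show ?case
          using \<zeta>1[of x j] by (auto simp: cl_def)
      qed
    qed
    show "AE x in lborel. norm ((g x - \<zeta> j x * cl j (g x))\<^sup>2) \<le> (g x)\<^sup>2" for j
    proof (rule AE_I2)
      fix x
      have "\<bar>g x - \<zeta> j x * cl j (g x)\<bar> \<le> \<bar>g x\<bar>"
      proof (cases "0 \<le> g x")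
        case True
        then have "0 \<le> cl j (g x)" "cl j (g x) \<le> g x"
          by (auto simp: cl_def)
        then have "0 \<le> \<zeta> j x * cl j (g x)" "\<zeta> j x * cl j (g x) \<le> g x"
          using \<zeta>01[of j x] mult_mono[of "\<zeta> j x" 1 "cl j (g x)" "g x"] by auto
        then show ?thesis
          by simp
      next
        case False
        then have "cl j (g x) \<le> 0" "g x \<le> cl j (g x)"
          by (auto simp: cl_def)
        then have "\<zeta> j x * cl j (g x) \<le> 0" "g x \<le> \<zeta> j x * cl j (g x)"
          using \<zeta>01[of j x] mult_mono[of "\<zeta> j x" 1 "- cl j (g x)" "- g x"] by (auto simp: mult_le_0_iff)
        then show ?thesis
          by simp
      qed
      then show "norm ((g x - \<zeta> j x * cl j (g x))\<^sup>2) \<le> (g x)\<^sup>2"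
        by (simp add: abs_le_square_iff)
    qed
  qed (auto simp: cl_def)
  then have "(\<lambda>j. \<integral>x. (g x - \<zeta> j x * cl j (g x))\<^sup>2 \<partial>lborel) \<longlonglongrightarrow> 0"
    by simp
  \<comment> \<open>Each of the two errors is kept below \<epsilon> / 4 because (a + b)^2 <= 2 a^2 +
    2 b^2 doubles both.\<close>
  from LIMSEQ_D[OF this, of "\<epsilon> / 4"] \<epsilon> obtain j where
    j: "(\<integral>x. (g x - \<zeta> j x * cl j (g x))\<^sup>2 \<partial>lborel) < \<epsilon> / 4"
    by fastforce
  let ?c = "2 * real (Suc j)"
  have ind: "integrable lborel (indicator (cube ?c) :: real^'n \<Rightarrow> real)"
    using integrable_indicator_cube(1)[of ?c 0] by simp
  have cl_diff: "(\<zeta> j x * cl j u - \<zeta> j x * cl j v)\<^sup>2 \<le> (2 * real j)\<^sup>2 * indicator (cube ?c) x" for x u v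
  proof (cases "x \<in> cube ?c")
    case True
    have "\<bar>cl j u - cl j v\<bar> \<le> 2 * real j"
      by (auto simp: cl_def)
    then have "\<bar>\<zeta> j x\<bar> * \<bar>cl j u - cl j v\<bar> \<le> 1 * (2 * real j)"
      using \<zeta>01[of j x] by (intro mult_mono) auto
    then have "\<bar>\<zeta> j x * cl j u - \<zeta> j x * cl j v\<bar> \<le> \<bar>2 * real j\<bar>"
      by (simp add: abs_mult flip: right_diff_distrib)
    then show ?thesis
      using True unfolding abs_le_square_iff by simp
  qed (simp add: \<zeta>0)
  have "(\<lambda>n. \<integral>x. (\<zeta> j x * cl j (g x) - \<zeta> j x * cl j (a n x))\<^sup>2 \<partial>lborel) \<longlonglongrightarrow> (\<integral>x. 0 \<partial>(lborel :: (real^'n) measure))"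
  proof (rule integral_dominated_convergence[where w = "\<lambda>x. (2 * real j)\<^sup>2 * indicator (cube ?c) x"])
    show "AE x in lborel. (\<lambda>n. (\<zeta> j x * cl j (g x) - \<zeta> j x * cl j (a n x))\<^sup>2) \<longlonglongrightarrow> 0"
      using N0
    proof eventually_elim
      case (elim x)
      have "(\<lambda>n. (\<zeta> j x * cl j (g x) - \<zeta> j x * cl j (a n x))\<^sup>2) \<longlonglongrightarrow>
          (\<zeta> j x * cl j (g x) - \<zeta> j x * cl j (g x))\<^sup>2"
        unfolding cl_def by (intro tendsto_intros lim[OF elim])
      then show ?case
        by simp
    qed
  qed (use ind cl_diff in \<open>auto simp: cl_def\<close>)
  then have "(\<lambda>n. \<integral>x. (\<zeta> j x * cl j (g x) - \<zeta> j x * cl j (a n x))\<^sup>2 \<partial>lborel) \<longlonglongrightarrow> 0"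
    by simp
  from LIMSEQ_D[OF this, of "\<epsilon> / 4"] \<epsilon> obtain n where
    n: "(\<integral>x. (\<zeta> j x * cl j (g x) - \<zeta> j x * cl j (a n x))\<^sup>2 \<partial>lborel) < \<epsilon> / 4"
    by fastforce
  define h where "h x = \<zeta> j x * cl j (a n x)" for x
  have h: "continuous_on UNIV h"
    unfolding h_def cl_def by (intro continuous_intros \<zeta>c a)
  have h0: "h x = 0" if "x \<notin> cube ?c" for x
    unfolding h_def using \<zeta>0[OF that] by simp
  have hs: "sq_integrable h"
    by (rule sq_integrable_compact_support[OF h _ h0]) (simp_all add: cube_eq_cbox)
  have ks: "sq_integrable (\<lambda>x. \<zeta> j x * cl j (g x))"
  proof -
    have "integrable lborel (\<lambda>x. (\<zeta> j x * cl j (g x))\<^sup>2)"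
      by (rule Bochner_Integration.integrable_bound[where f = "\<lambda>x. (2 * real j)\<^sup>2 * indicator (cube ?c) x"])
         (use ind cl_diff[of _ "g _" 0] in \<open>auto simp: cl_def\<close>)
    then show ?thesis
      by (auto simp: sq_integrable_def cl_def)
  qed
  let ?k = "\<lambda>x. \<zeta> j x * cl j (g x)"
  have i1: "integrable lborel (\<lambda>x. (g x - ?k x)\<^sup>2)" and i2: "integrable lborel (\<lambda>x. (?k x - h x)\<^sup>2)"
    and i3: "integrable lborel (\<lambda>x. (g x - h x)\<^sup>2)"
    using sq_integrable_diff[OF g ks] sq_integrable_diff[OF ks hs] sq_integrable_diff[OF g hs]
    by (simp_all only: sq_integrable_def)
  have "(\<integral>x. (g x - h x)\<^sup>2 \<partial>lborel) \<le> (\<integral>x. 2 * (g x - ?k x)\<^sup>2 + 2 * (?k x - h x)\<^sup>2 \<partial>lborel)"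
  proof (rule integral_mono[OF i3])
    fix x
    have "0 \<le> ((g x - ?k x) - (?k x - h x))\<^sup>2"
      by simp
    then show "(g x - h x)\<^sup>2 \<le> 2 * (g x - ?k x)\<^sup>2 + 2 * (?k x - h x)\<^sup>2"
      unfolding power2_eq_square by (simp only: algebra_simps)
  qed (use i1 i2 in auto)
  also have "\<dots> < \<epsilon>"
    using j n i1 i2 by (simp add: h_def)
  finally show ?thesis
    using h h0 by (intro exI[of _ h] exI[of _ ?c]) auto
qed

text \<open>Density of compactly supported continuous functions, combined with a bound of the forms
  that is uniform in the scale. Three errors arise, each below \<epsilon> / 4: the form with g - h,
  the limit pairing with g - h, and the convergence for h.\<close>

lemma conv_form_mollifier_tendsto:
  fixes f g :: "real^'n::finite \<Rightarrow> real"
  assumes f: "sq_integrable f" and g: "sq_integrable g"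
    and r: "\<And>m. 0 < r m" "r \<longlonglongrightarrow> 0"
  shows "(\<lambda>m. conv_form (mollifier_kernel (r m)) f g) \<longlonglongrightarrow> (\<integral>x. f x * g x \<partial>lborel)"
proof (rule LIMSEQ_I)
  fix \<epsilon> :: real assume \<epsilon>: "0 < \<epsilon>"
  obtain M where M: "0 < M" "\<And>x. \<bar>mollifier x\<bar> \<le> M"
    using smooth_compact_support_bounded[OF smooth_mollifier, of 1] mollifier_eq_0 by auto
  \<comment> \<open>\<open>A\<close> exceeds the constants of both estimates for g - h: (2 M)^n for
    the forms and 1 for the pairing in the limit. \<open>B\<close> stays positive when f
    vanishes.\<close>
  define A where "A = 1 + (2 * M) ^ CARD('n)"
  define B where "B = 1 + (\<integral>x. (f x)\<^sup>2 \<partial>lborel)"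
  have A: "1 \<le> A" and B: "1 \<le> B"
    using M by (auto simp: A_def B_def)
  \<comment> \<open>\<open>\<theta>\<close> balances the two halves of the bilinear estimate for the error \<open>g - h\<close>.\<close>
  define \<theta> where "\<theta> = \<epsilon> / (4 * A * B)"
  have \<theta>: "0 < \<theta>"
    using A B \<epsilon> by (simp add: \<theta>_def)
  have pos: "0 < \<theta> * \<epsilon> / (4 * A)"
    using A \<epsilon> \<theta> by simp
  obtain h c where h: "continuous_on UNIV h" "0 \<le> c" "\<And>x. x \<notin> cube c \<Longrightarrow> h x = 0"
    "(\<integral>x. (g x - h x)\<^sup>2 \<partial>lborel) < \<theta> * \<epsilon> / (4 * A)"
    using exists_continuous_L2_approx[OF g pos] by blast
  have hs: "sq_integrable h"
    by (rule sq_integrable_compact_support[OF h(1) _ h(3)]) (simp_all add: cube_eq_cbox)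
  have gh: "sq_integrable (\<lambda>x. g x - h x)"
    by (rule sq_integrable_diff[OF g hs])
  define d where "d = (\<integral>x. (g x - h x)\<^sup>2 \<partial>lborel)"
  have "d / \<theta> < \<epsilon> / (4 * A)"
    using h(4) \<theta> A unfolding d_def by (simp add: field_simps)
  moreover have "\<theta> * (B - 1) \<le> \<epsilon> / (4 * A)"
    using A B \<epsilon> by (simp add: \<theta>_def field_simps)
  ultimately have small: "A * (\<theta> * (B - 1) + d / \<theta>) / 2 < \<epsilon> / 4"
    using A by (simp add: field_simps)
  have d0: "0 \<le> d"
    by (simp add: d_def)
  have s0: "0 \<le> \<theta> * (B - 1) + d / \<theta>"
    using \<theta> B d0 by simp
  have e1: "\<bar>conv_form (mollifier_kernel (r m)) f (\<lambda>x. g x - h x)\<bar> < \<epsilon> / 4" for m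
  proof -
    have "\<bar>conv_form (mollifier_kernel (r m)) f (\<lambda>x. g x - h x)\<bar>
        \<le> (M / r m) ^ CARD('n) * (2 * r m) ^ CARD('n) * (\<theta> * (B - 1) + d / \<theta>) / 2"
      using conv_form_bound(2)[OF mollifier_kernel_bound[OF M(2) r(1)[of m]] f gh \<theta>] by (simp add: B_def d_def)
    also have "(M / r m) ^ CARD('n) * (2 * r m) ^ CARD('n) = (2 * M) ^ CARD('n)"
    proof -
      have "M / r m * (2 * r m) = 2 * M"
        using r(1)[of m] by simp
      then show ?thesis
        by (simp only: power_mult_distrib[symmetric])
    qed
    also have "\<dots> * (\<theta> * (B - 1) + d / \<theta>) / 2 \<le> A * (\<theta> * (B - 1) + d / \<theta>) / 2"
      using s0 by (intro divide_right_mono mult_right_mono) (auto simp: A_def)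
    finally show ?thesis
      using small by linarith
  qed
  have e2: "\<bar>\<integral>x. f x * (g x - h x) \<partial>lborel\<bar> < \<epsilon> / 4"
  proof -
    have f2: "integrable lborel (\<lambda>x. (f x)\<^sup>2)" and gh2: "integrable lborel (\<lambda>x. (g x - h x)\<^sup>2)"
      using f gh by (simp_all only: sq_integrable_def)
    have "\<bar>\<integral>x. f x * (g x - h x) \<partial>lborel\<bar> \<le> (\<integral>x. (\<theta> * (f x)\<^sup>2 + (g x - h x)\<^sup>2 / \<theta>) / 2 \<partial>lborel)"
      by (rule order_trans[OF integral_abs_bound])
         (intro integral_mono integrable_abs sq_integrable_mult f gh abs_mult_le_weighted \<theta>
            integrable_divide_zero Bochner_Integration.integrable_add integrable_mult_right f2 gh2)
    also have "\<dots> = 1 * (\<theta> * (B - 1) + d / \<theta>) / 2"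
      using f2 gh2 by (simp add: B_def d_def add_divide_distrib)
    also have "\<dots> \<le> A * (\<theta> * (B - 1) + d / \<theta>) / 2"
      using s0 A by (intro divide_right_mono mult_right_mono) auto
    finally show ?thesis
      using small by linarith
  qed
  have "(\<lambda>m. conv_form (mollifier_kernel (r m)) f h) \<longlonglongrightarrow> (\<integral>x. f x * h x \<partial>lborel)"
    by (rule conv_form_mollifier_tendsto_continuous[OF f h(1,3,2) r])
  from LIMSEQ_D[OF this, of "\<epsilon> / 4"] \<epsilon> obtain N where
    N: "\<And>m. N \<le> m \<Longrightarrow> \<bar>conv_form (mollifier_kernel (r m)) f h - (\<integral>x. f x * h x \<partial>lborel)\<bar> < \<epsilon> / 4"
    by auto
  show "\<exists>N. \<forall>m\<ge>N. norm (conv_form (mollifier_kernel (r m)) f g - (\<integral>x. f x * g x \<partial>lborel)) < \<epsilon>"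
  proof (intro exI allI impI)
    fix m assume "N \<le> m"
    have "(\<integral>x. f x * (g x - h x) \<partial>lborel) = (\<integral>x. f x * g x \<partial>lborel) - (\<integral>x. f x * h x \<partial>lborel)"
      using sq_integrable_mult[OF f g] sq_integrable_mult[OF f hs]
      by (simp add: right_diff_distrib)
    with e1[of m] e2 N[OF \<open>N \<le> m\<close>] \<epsilon>
    show "norm (conv_form (mollifier_kernel (r m)) f g - (\<integral>x. f x * g x \<partial>lborel)) < \<epsilon>"
      unfolding conv_form_diff_right[OF mollifier_kernel_bound[OF M(2) r(1)[of m]] f g hs] real_norm_def
      by linarith
  qed
qed

text \<open>Integration by parts between two functions that are only weakly differentiable. With a
  mollifier between them the derivative passes from one argument through the kernel to the other;
  then the scale tends to 0.\<close>

lemma weak_partial_inner_commute: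
  fixes f f' g g' :: "'n::finite L2"
  assumes "weak_partial i f f'" "weak_partial i g g'"
  shows "inner f' g = - inner f g'"
proof -
  define r where "r m = (1 / 2 :: real) ^ m" for m :: nat
  have r: "0 < r m" "r \<longlonglongrightarrow> 0" for m
    unfolding r_def by (auto intro!: LIMSEQ_realpow_zero)
  have "conv_form (mollifier_kernel (r m)) (fun_of f') (fun_of g)
      = - conv_form (mollifier_kernel (r m)) (fun_of f) (fun_of g')" for m
  proof -
    have h: "smooth (\<lambda>s. mollifier (s / r m) / r m)"
      by (intro smooth_scaled smooth_mollifier)
    have z: "mollifier (x / r m) / r m = 0" if "r m < \<bar>x\<bar>" for x
      using that r(1)[of m] by (auto intro!: mollifier_eq_0)
    show ?thesis
      unfolding mollifier_kernel_def
      using conv_form_weak_partial(1)[OF assms(1), of "\<lambda>_ s. mollifier (s / r m) / r m" "r m" "fun_of g"]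
        conv_form_weak_partial(2)[OF assms(2), of "\<lambda>_ s. mollifier (s / r m) / r m" "r m" "fun_of f"]
        h z r(1)[of m] by simp
  qed
  then have "(\<lambda>m. - conv_form (mollifier_kernel (r m)) (fun_of f) (fun_of g')) \<longlonglongrightarrow> inner f' g"
    using conv_form_mollifier_tendsto[OF fun_of_sq_integrable[of f'] fun_of_sq_integrable[of g] r]
    by (simp add: inner_L2_eq)
  moreover have "(\<lambda>m. - conv_form (mollifier_kernel (r m)) (fun_of f) (fun_of g')) \<longlonglongrightarrow> - inner f g'"
    unfolding inner_L2_eq by (intro tendsto_minus conv_form_mollifier_tendsto r) simp_all
  ultimately show ?thesis
    by (rule LIMSEQ_unique)
qed

section \<open>A subcritical Sobolev inequality\<close>

text \<open>Weighted AM-GM with the weights \<alpha>, 1 / (2 p) and 1 / 2, which sum to 1; q is the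
  conjugate exponent of 2 p. With V the volume of the cube that supports a kernel, the three terms
  on the right give double integrals that are all proportional to V.\<close>

lemma three_term_young:
  fixes f g V :: real
  assumes p: "1 < p" and V: "0 < V"
  defines "\<alpha> \<equiv> 1 / 2 - 1 / (2 * p)" and "q \<equiv> 2 * p / (2 * p - 1)"
  shows "\<bar>f\<bar> * \<bar>g\<bar> * V powr \<alpha> \<le> \<alpha> * (V * (f\<^sup>2 * \<bar>g\<bar> powr q)) + 1 / (2 * p) * f\<^sup>2 + 1 / 2 * \<bar>g\<bar> powr q"
proof (cases "f = 0 \<or> g = 0")
  case True
  then show ?thesis
    using p by (auto simp: \<alpha>_def)
next
  case False
  define a b where "a = f\<^sup>2" and "b = \<bar>g\<bar> powr q"
  have ab: "0 < a" "0 < b"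
    using False by (auto simp: a_def b_def)
  have \<alpha>: "0 < \<alpha>" "2 * \<alpha> + 1 / p = 1"
    using p by (auto simp: \<alpha>_def field_simps)
  have q: "q * (\<alpha> + 1 / 2) = 1"
    using p by (simp add: q_def \<alpha>_def field_simps)
  \<comment> \<open>The geometric mean of the first two terms with weights 2 \<alpha> and 1 / p; two
    applications of the two-term inequality then give the three-term one.\<close>
  define x where "x = (V * (a * b)) powr (2 * \<alpha>) * a powr (1 / p)"
  have x: "0 < x"
    using ab V by (simp add: x_def)
  have "x powr (1 / 2) * b powr (1 / 2) \<le> 1 / 2 * x + 1 / 2 * b"
    by (rule Youngs_inequality_0) (use x ab in auto)
  moreover have "x \<le> 2 * \<alpha> * (V * (a * b)) + 1 / p * a"
    unfolding x_def by (rule Youngs_inequality_0) (use \<alpha> ab V p in auto)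
  moreover have "x powr (1 / 2) * b powr (1 / 2) = \<bar>f\<bar> * \<bar>g\<bar> * V powr \<alpha>"
  proof -
    have "x = V powr (2 * \<alpha>) * a powr (2 * \<alpha> + 1 / p) * b powr (2 * \<alpha>)"
      using ab V by (simp add: x_def powr_mult powr_add)
    then have "x powr (1 / 2) * b powr (1 / 2) = V powr \<alpha> * a powr (1 / 2) * b powr (\<alpha> + 1 / 2)"
      using ab V \<alpha> by (simp add: powr_mult powr_powr powr_add)
    also have "a powr (1 / 2) = \<bar>f\<bar>"
      by (simp add: a_def powr_half_sqrt)
    also have "b powr (\<alpha> + 1 / 2) = \<bar>g\<bar>"
      unfolding b_def powr_powr q by simp
    finally show ?thesis
      by simp
  qed
  ultimately show ?thesis
    by (simp add: a_def b_def)
qed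

text \<open>Measuring g in L^q instead of L^2 costs the factor (2 r)^(-n \<alpha>) compared with
  \<open>conv_form_bound\<close>. The right side is left inhomogeneous in f and g; the scaling of
  the test function in \<open>sobolev_truncated\<close> makes up for this.\<close>

lemma conv_form_young:
  fixes k :: "real^'n::finite \<Rightarrow> real"
  assumes k: "kernel_bound K r k" and f: "sq_integrable f" and g: "sq_integrable g"
    and p: "1 < p" and r: "0 < r"
  defines "\<alpha> \<equiv> 1 / 2 - 1 / (2 * p)" and "q \<equiv> 2 * p / (2 * p - 1)"
  assumes gq: "integrable lborel (\<lambda>x. \<bar>g x\<bar> powr q)" and A: "(\<integral>x. (f x)\<^sup>2 \<partial>lborel) \<le> A"
  shows "\<bar>conv_form k f g\<bar> \<le> K * (2 * r) ^ CARD('n) * (2 * r) powr (- real CARD('n) * \<alpha>)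
    * ((\<alpha> * A + 1 / 2) * (\<integral>x. \<bar>g x\<bar> powr q \<partial>lborel) + A / (2 * p))"
proof -
  define V where "V = (2 * r) ^ CARD('n)"
  have V: "0 < V"
    using r by (simp add: V_def)
  define Y where "Y = (\<integral>x. \<bar>g x\<bar> powr q \<partial>lborel)"
  define G where "G = (\<integral>x. (f x)\<^sup>2 \<partial>lborel)"
  have \<alpha>: "0 \<le> \<alpha>"
    using p by (simp add: \<alpha>_def field_simps)
  have Y: "0 \<le> Y"
    by (simp add: Y_def)
  have K: "0 \<le> K" "\<bar>k z\<bar> \<le> K * indicator (cube r) z" for z
    using k by (auto simp: kernel_bound_def)
  have f2: "integrable lborel (\<lambda>x. (f x)\<^sup>2)"
    using f by (simp add: sq_integrable_def)
  let ?H = "\<lambda>(x, y). K * V powr (- \<alpha>) * (\<alpha> * V * ((f x)\<^sup>2 * \<bar>g y\<bar> powr q)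
      + 1 / (2 * p) * ((f x)\<^sup>2 * indicator (cube r) (y - x)) + 1 / 2 * (\<bar>g y\<bar> powr q * indicator (cube r) (y - x)))"
  have H: "integrable lborel2 ?H" "integral\<^sup>L lborel2 ?H
      = K * V powr (- \<alpha>) * (\<alpha> * V * (G * Y) + 1 / (2 * p) * (V * G) + 1 / 2 * (V * Y))"
    using integrable_product_pair[OF f2 gq] integrable_cube_pair(1,2)[OF f2, of r]
      integrable_cube_pair(3,4)[OF gq, of r] r
    unfolding split_def V_def G_def Y_def by simp_all
  have le: "\<bar>case z of (x, y) \<Rightarrow> f x * g y * k (y - x)\<bar> \<le> ?H z" for z
  proof (cases z)
    case (Pair x y)
    have "\<bar>f x * g y\<bar> * \<bar>k (y - x)\<bar> \<le> \<bar>f x * g y\<bar> * (K * indicator (cube r) (y - x))"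
      by (intro mult_left_mono K) auto
    also have "\<dots> = K * V powr (- \<alpha>) * (\<bar>f x\<bar> * \<bar>g y\<bar> * V powr \<alpha> * indicator (cube r) (y - x))"
      using V by (simp add: abs_mult powr_minus)
    also have "\<dots> \<le> K * V powr (- \<alpha>) * ((\<alpha> * (V * ((f x)\<^sup>2 * \<bar>g y\<bar> powr q)) + 1 / (2 * p) * (f x)\<^sup>2
        + 1 / 2 * \<bar>g y\<bar> powr q) * indicator (cube r) (y - x))"
      using three_term_young[OF p V, of "f x" "g y"] K(1)
      unfolding \<alpha>_def q_def by (intro mult_left_mono mult_right_mono) auto
    \<comment> \<open>The indicator is dropped in the first term only: the explicit factor V already
      stands for the volume there, and f(x)^2 |g(y)|^q is integrable over all pairs.\<close>
    also have "\<dots> \<le> ?H (x, y)"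
      using \<alpha> V K(1) p by (auto simp: indicator_def intro!: mult_left_mono)
    finally show ?thesis
      by (simp add: Pair abs_mult)
  qed
  have "\<bar>conv_form k f g\<bar> \<le> integral\<^sup>L lborel2 ?H"
    unfolding conv_form_def
    by (rule order_trans[OF integral_abs_bound]) (intro integral_mono integrable_abs conv_form_bound(1)[OF k f g] H(1) le)
  also have "\<dots> = K * (V * V powr (- \<alpha>)) * ((\<alpha> * G + 1 / 2) * Y + G / (2 * p))"
    unfolding H(2) by (simp add: algebra_simps)
  also have "\<dots> \<le> K * (V * V powr (- \<alpha>)) * ((\<alpha> * A + 1 / 2) * Y + A / (2 * p))"
    using A \<alpha> K(1) V Y p unfolding G_def[symmetric]
    by (intro mult_left_mono add_mono mult_right_mono divide_right_mono) auto
  also have "V powr (- \<alpha>) = (2 * r) powr (- real CARD('n) * \<alpha>)"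
  proof -
    have "V = (2 * r) powr real CARD('n)"
      using r by (simp add: V_def powr_realpow)
    then show ?thesis
      by (simp add: powr_powr)
  qed
  finally show ?thesis
    by (simp add: V_def Y_def mult.assoc)
qed

lemma tensor_upd_diff: "tensor (h(i := (\<lambda>s. a s - b s))) x = tensor (h(i := a)) x - tensor (h(i := b)) x"
  unfolding tensor_def by (subst (1 2 3) prod.remove[of UNIV i]) (auto simp: algebra_simps)

lemma conv_form_diff_kernel:
  assumes "kernel_bound K r k" "kernel_bound K' r' k'" "sq_integrable f" "sq_integrable g"
  shows "conv_form (\<lambda>z. k z - k' z) f g = conv_form k f g - conv_form k' f g"
proof -
  have "(\<lambda>(x, y). f x * g y * (k (y - x) - k' (y - x)))
      = (\<lambda>z. (case z of (x, y) \<Rightarrow> f x * g y * k (y - x)) - (case z of (x, y) \<Rightarrow> f x * g y * k' (y - x)))"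
    by (auto simp: algebra_simps)
  then show ?thesis
    unfolding conv_form_def
    using conv_form_bound(1)[OF assms(1,3,4)] conv_form_bound(1)[OF assms(2,3,4)]
    by (simp only: Bochner_Integration.integral_diff)
qed

lemma kernel_bound_cmult:
  "kernel_bound K r k \<Longrightarrow> 0 \<le> c \<Longrightarrow> kernel_bound (c * K) r (\<lambda>z. c * k z)"
  by (auto simp: kernel_bound_def abs_mult mult.assoc intro: mult_left_mono)

text \<open>An antiderivative of the difference of the mollifiers at scales r and r / 2. It has
  compact support because both have mass 1.\<close>

definition step_scaled :: "real \<Rightarrow> real \<Rightarrow> real" where
  "step_scaled r s = step (s / r) - step (s / (r / 2))"

lemma smooth_step_scaled: "smooth (step_scaled r)"
  using smooth_diff[OF smooth_affine[OF smooth_step, of "1 / r" 0] smooth_affine[OF smooth_step, of "1 / (r / 2)" 0]]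
  by (simp add: step_scaled_def[abs_def] mult.commute)

lemma deriv_step_scaled:
  assumes "0 < r"
  shows "deriv (step_scaled r) = (\<lambda>s. mollifier (s / r) / r - mollifier (s / (r / 2)) / (r / 2))"
proof
  fix s
  have *: "((\<lambda>s. step (s / a)) has_real_derivative mollifier (s / a) * (1 / a)) (at s)" if "0 < a" for a
    by (rule DERIV_chain'[OF _ step_DERIV]) (use that in \<open>auto intro!: derivative_eq_intros\<close>)
  show "deriv (step_scaled r) s = mollifier (s / r) / r - mollifier (s / (r / 2)) / (r / 2)"
    unfolding step_scaled_def[abs_def]
    by (rule DERIV_imp_deriv) (rule DERIV_cong[OF DERIV_diff[OF * *]], use assms in auto)
qed

lemma step_scaled_eq_0:
  assumes "0 < r" "r < \<bar>s\<bar>"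
  shows "step_scaled r s = 0"
proof (cases "0 < s")
  case True
  then show ?thesis
    using assms by (simp add: step_scaled_def step_eq_1)
next
  case False
  then have "s / r \<le> - 1" "s / (r / 2) \<le> - 1"
    using assms by (auto simp: field_simps)
  then show ?thesis
    by (simp add: step_scaled_def step_eq_0)
qed

lemma abs_step_scaled_le: "\<bar>step_scaled r s\<bar> \<le> 1"
  using step_nonneg[of "s / r"] step_le_1[of "s / r"] step_nonneg[of "s / (r / 2)"] step_le_1[of "s / (r / 2)"]
  by (auto simp: step_scaled_def abs_le_iff)

text \<open>The difference of the two kernels is a sum of derivatives, one for each coordinate, and
  each derivative is moved onto u. The antiderivative gains a factor r against the loss r^(-n
  \<alpha>) of \<open>conv_form_young\<close>, hence the exponent 1 - n \<alpha>.\<close>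

lemma mollifier_kernel_step:
  fixes u :: "'n::finite L2" and D :: "'n \<Rightarrow> 'n L2"
  assumes M: "\<And>x. \<bar>mollifier x\<bar> \<le> M" "1 \<le> M" and r: "0 < r" and p: "1 < p"
    and D: "\<And>i. weak_partial i u (D i)" "\<And>i. (norm (D i))\<^sup>2 \<le> A"
  defines "\<alpha> \<equiv> 1 / 2 - 1 / (2 * p)" and "q \<equiv> 2 * p / (2 * p - 1)"
  assumes g: "sq_integrable g" and gq: "integrable lborel (\<lambda>x. \<bar>g x\<bar> powr q)"
  shows "\<bar>conv_form (mollifier_kernel r) (fun_of u) g - conv_form (mollifier_kernel (r / 2)) (fun_of u) g\<bar>
    \<le> real CARD('n) * (4 * M) ^ CARD('n) * (r powr (1 - real CARD('n) * \<alpha>)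
      * ((\<alpha> * A + 1 / 2) * (\<integral>x. \<bar>g x\<bar> powr q \<partial>lborel) + A / (2 * p)))"
proof -
  let ?a = "\<lambda>s. mollifier (s / r) / r" and ?b = "\<lambda>s. mollifier (s / (r / 2)) / (r / 2)"
  \<comment> \<open>Hybrid kernels: the coordinates in \<open>S\<close> are at scale r, the others
    at scale r / 2. Enlarging \<open>S\<close> by one coordinate at a time joins the two
    mollifiers.\<close>
  define h where "h S = (\<lambda>i. if i \<in> S then ?a else ?b)" for S :: "'n set"
  define X where "X = (\<alpha> * A + 1 / 2) * (\<integral>x. \<bar>g x\<bar> powr q \<partial>lborel) + A / (2 * p)"
  define E where "E = (4 * M) ^ CARD('n) * (r powr (1 - real CARD('n) * \<alpha>) * X)"
  have \<alpha>: "0 \<le> \<alpha>"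
    using p by (simp add: \<alpha>_def field_simps)
  have A: "0 \<le> A"
    using D(2) zero_le_power2 order_trans by blast
  have X: "0 \<le> X"
    unfolding X_def using A \<alpha> p by (intro add_nonneg_nonneg mult_nonneg_nonneg) auto
  have sm: "smooth ?a" "smooth ?b"
    by (intro smooth_scaled smooth_mollifier)+
  have smh: "smooth (h S i)" for S i
    using sm by (simp add: h_def)
  have le: "\<bar>h S i x\<bar> \<le> 2 * M / r" for S i x
    using M(1)[of "x / r"] M(1)[of "x / (r / 2)"] M(2) r by (auto simp: h_def field_simps)
  have z: "h S i x = 0" if "r < \<bar>x\<bar>" for S i x
    using that r by (auto simp: h_def intro!: mollifier_eq_0)
  have kb: "kernel_bound ((2 * M / r) ^ CARD('n)) r (tensor (h S))" for S
    by (rule kernel_bound_tensor) (use r le z smh in \<open>auto intro: smooth_measurable\<close>)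
  have step: "\<bar>conv_form (tensor (h (insert i S))) (fun_of u) g - conv_form (tensor (h S)) (fun_of u) g\<bar> \<le> E"
    if i: "i \<notin> S" for i S
  proof -
    let ?\<kappa> = "(h S)(i := step_scaled r)"
    have sk: "smooth (?\<kappa> j)" for j
      using smh smooth_step_scaled by simp
    have zk: "?\<kappa> j x = 0" if "r < \<bar>x\<bar>" for j x
      using z step_scaled_eq_0[OF r that] that by simp
    have "h (insert i S) = (h S)(i := ?a)" "h S = (h S)(i := ?b)"
      using i by (auto simp: h_def)
    then have "tensor (h (insert i S)) z - tensor (h S) z = partial i (tensor ?\<kappa>) z" for z
      using tensor_upd_diff[of "h S" i ?a ?b z] deriv_step_scaled[OF r]
      by (simp add: partial_tensor[of ?\<kappa>, OF sk])
    then have "conv_form (tensor (h (insert i S))) (fun_of u) g - conv_form (tensor (h S)) (fun_of u) g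
        = conv_form (partial i (tensor ?\<kappa>)) (fun_of u) g"
      using conv_form_diff_kernel[OF kb[of "insert i S"] kb[of S] fun_of_sq_integrable[of u] g] by simp
    also have "\<dots> = conv_form (tensor ?\<kappa>) (fun_of (D i)) g"
      by (rule conv_form_weak_partial(1)[OF D(1), of ?\<kappa> r, symmetric]) (use sk zk r g in auto)
    also have "\<bar>\<dots>\<bar> \<le> r * (2 * M / r) ^ CARD('n) * (2 * r) ^ CARD('n) * (2 * r) powr (- real CARD('n) * \<alpha>) * X"
      unfolding X_def \<alpha>_def q_def
    proof (rule conv_form_young)
      \<comment> \<open>\<open>step_scaled\<close> is bounded by 1, the other factors by 2 M / r.
        Division by r puts all factors under the same bound; the factor r is restored afterwards by
        \<open>kernel_bound_cmult\<close>.\<close>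
      have "kernel_bound ((2 * M / r) ^ CARD('n)) r (tensor ((h S)(i := (\<lambda>s. (1 / r) * step_scaled r s))))"
      proof (rule kernel_bound_tensor)
        fix j x
        show "\<bar>((h S)(i := (\<lambda>s. (1 / r) * step_scaled r s))) j x\<bar> \<le> 2 * M / r"
          using le[of S j x] abs_step_scaled_le[of r x] r M(2) by (auto simp: abs_mult field_simps)
        show "((h S)(i := (\<lambda>s. (1 / r) * step_scaled r s))) j x = 0" if "r < \<bar>x\<bar>"
          using z step_scaled_eq_0[OF r that] that by simp
        show "((h S)(i := (\<lambda>s. (1 / r) * step_scaled r s))) j \<in> borel_measurable borel"
          by (rule smooth_measurable) (use smh smooth_cmult[OF smooth_step_scaled, of "1 / r"] in simp)
      qed (use r in simp)
      from kernel_bound_cmult[OF this, of r] r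
      show "kernel_bound (r * (2 * M / r) ^ CARD('n)) r (tensor ?\<kappa>)"
        unfolding tensor_upd_scale by simp
      show "(\<integral>x. (fun_of (D i) x)\<^sup>2 \<partial>lborel) \<le> A"
        using D(2)[of i] by (simp add: norm_L2_sq)
    qed (use p r g gq in \<open>auto simp: q_def\<close>)
    also have "\<dots> \<le> E"
    proof -
      have "2 * M / r * (2 * r) = 4 * M"
        using r by simp
      then have "(2 * M / r) ^ CARD('n) * (2 * r) ^ CARD('n) = (4 * M) ^ CARD('n)"
        by (simp only: power_mult_distrib[symmetric])
      moreover have "r * (2 * r) powr (- real CARD('n) * \<alpha>) \<le> r powr (1 - real CARD('n) * \<alpha>)"
      proof -
        have "r * (2 * r) powr (- real CARD('n) * \<alpha>) \<le> r * r powr (- real CARD('n) * \<alpha>)"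
          using r \<alpha> by (intro mult_left_mono powr_mono2') auto
        also have "\<dots> = r powr (1 - real CARD('n) * \<alpha>)"
          using r by (simp add: powr_diff powr_minus field_simps)
        finally show ?thesis .
      qed
      ultimately have "(2 * M / r) ^ CARD('n) * (2 * r) ^ CARD('n) * (r * (2 * r) powr (- real CARD('n) * \<alpha>)) * X
          \<le> (4 * M) ^ CARD('n) * r powr (1 - real CARD('n) * \<alpha>) * X"
        using M(2) X by (intro mult_right_mono) auto
      then show ?thesis
        by (simp add: E_def mult_ac)
    qed
    finally show ?thesis .
  qed
  have "\<bar>conv_form (tensor (h S)) (fun_of u) g - conv_form (tensor (h {})) (fun_of u) g\<bar> \<le> real (card S) * E"
    if "finite S" for S
    using that
  proof induction
    case (insert i S)
    then show ?case
      using step[of i S] by (simp add: algebra_simps)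
  qed simp
  from this[of UNIV] show ?thesis
    by (simp add: h_def E_def X_def mollifier_kernel_def mult.assoc)
qed

lemma half_powr_less_1: "0 < a \<Longrightarrow> (1 / 2 :: real) powr a < 1"
  by (simp add: powr_def mult_pos_neg)

text \<open>The pairing is the limit of mollified pairings at the scales 2^(-m). Scale 1 is bounded
  directly, and the increments are dominated by a geometric series with ratio \<rho>, which is below
  1 because n \<alpha> < 1, that is, n (p - 1) < 2 p.\<close>

lemma L2_pairing_bound:
  fixes u :: "'n::finite L2" and D :: "'n \<Rightarrow> 'n L2"
  assumes M: "\<And>x. \<bar>mollifier x\<bar> \<le> M" "1 \<le> M" and p: "1 < p"
    and D: "\<And>i. weak_partial i u (D i)" "\<And>i. (norm (D i))\<^sup>2 \<le> A" and u: "(norm u)\<^sup>2 \<le> A"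
  defines "\<alpha> \<equiv> 1 / 2 - 1 / (2 * p)" and "q \<equiv> 2 * p / (2 * p - 1)"
  defines "\<rho> \<equiv> (1 / 2) powr (1 - real CARD('n) * \<alpha>)"
  assumes \<alpha>: "real CARD('n) * \<alpha> < 1"
    and g: "sq_integrable g" and gq: "integrable lborel (\<lambda>x. \<bar>g x\<bar> powr q)"
  shows "\<bar>\<integral>x. fun_of u x * g x \<partial>lborel\<bar> \<le> (4 * M) ^ CARD('n) * (1 + real CARD('n) / (1 - \<rho>))
      * ((\<alpha> * A + 1 / 2) * (\<integral>x. \<bar>g x\<bar> powr q \<partial>lborel) + A / (2 * p))"
proof -
  define X where "X = (\<alpha> * A + 1 / 2) * (\<integral>x. \<bar>g x\<bar> powr q \<partial>lborel) + A / (2 * p)"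
  define r where "r m = (1 / 2 :: real) ^ m" for m :: nat
  have r: "0 < r m" "r \<longlonglongrightarrow> 0" for m
    unfolding r_def by (auto intro!: LIMSEQ_realpow_zero)
  have \<alpha>0: "0 \<le> \<alpha>"
    using p by (simp add: \<alpha>_def field_simps)
  have A: "0 \<le> A"
    using D(2) zero_le_power2 order_trans by blast
  have X: "0 \<le> X"
    unfolding X_def using A \<alpha>0 p by (intro add_nonneg_nonneg mult_nonneg_nonneg) auto
  have \<rho>: "0 < \<rho>" "\<rho> < 1"
    using \<alpha> half_powr_less_1[of "1 - real CARD('n) * \<alpha>"] by (auto simp: \<rho>_def)
  define c where "c m = conv_form (mollifier_kernel (r m)) (fun_of u) g" for m
  let ?E = "real CARD('n) * (4 * M) ^ CARD('n) * X"
  have E: "0 \<le> ?E"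
    using M X by simp
  have c0: "\<bar>c 0\<bar> \<le> (4 * M) ^ CARD('n) * X"
  proof -
    have "\<bar>c 0\<bar> \<le> M ^ CARD('n) * (2 * 1) ^ CARD('n) * (2 * 1) powr (- real CARD('n) * \<alpha>) * X"
      unfolding X_def \<alpha>_def q_def c_def
    proof (rule conv_form_young)
      show "kernel_bound (M ^ CARD('n)) 1 (mollifier_kernel (r 0) :: real^'n \<Rightarrow> real)"
        using mollifier_kernel_bound[OF M(1), of 1] by (simp add: r_def)
      show "(\<integral>x. (fun_of u x)\<^sup>2 \<partial>lborel) \<le> A"
        using u by (simp add: norm_L2_sq)
    qed (use p g gq in \<open>auto simp: q_def\<close>)
    also have "\<dots> \<le> M ^ CARD('n) * (2 * 1) ^ CARD('n) * 1 * X"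
      using X M(2) \<alpha>0 powr_mono[of "- real CARD('n) * \<alpha>" 0 2]
      by (intro mult_right_mono mult_left_mono) auto
    also have "\<dots> = (2 * M) ^ CARD('n) * X"
      by (simp add: power_mult_distrib)
    also have "\<dots> \<le> (4 * M) ^ CARD('n) * X"
      using X M(2) by (intro mult_right_mono power_mono) auto
    finally show ?thesis .
  qed
  have dc: "\<bar>c m - c (Suc m)\<bar> \<le> ?E * \<rho> ^ m" for m
  proof -
    have "\<bar>c m - c (Suc m)\<bar> \<le> real CARD('n) * (4 * M) ^ CARD('n) * (r m powr (1 - real CARD('n) * \<alpha>) * X)"
      using mollifier_kernel_step[OF M r(1)[of m] p D g gq[unfolded q_def]]
      by (simp add: c_def r_def X_def q_def \<alpha>_def)
    also have "r m powr (1 - real CARD('n) * \<alpha>) = \<rho> ^ m"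
      by (simp add: r_def \<rho>_def powr_powr mult.commute flip: powr_realpow)
    finally show ?thesis
      by (simp add: mult_ac)
  qed
  have "\<bar>c 0 - c m\<bar> \<le> ?E * (1 - \<rho> ^ m) / (1 - \<rho>)" for m
  proof (induction m)
    case (Suc m)
    have "\<bar>c 0 - c (Suc m)\<bar> \<le> ?E * (1 - \<rho> ^ m) / (1 - \<rho>) + ?E * \<rho> ^ m"
      using Suc dc[of m] by linarith
    also have "\<dots> = ?E * (1 - \<rho> ^ Suc m) / (1 - \<rho>)"
      using \<rho> by (simp add: field_simps)
    finally show ?case .
  qed simp
  moreover have "?E * (1 - \<rho> ^ m) / (1 - \<rho>) \<le> ?E * 1 / (1 - \<rho>)" for m
    using \<rho> E by (intro divide_right_mono mult_left_mono) auto
  ultimately have cm: "\<bar>c m\<bar> \<le> (4 * M) ^ CARD('n) * X + ?E / (1 - \<rho>)" for m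
    using c0 by (smt (verit) mult_cancel_left2)
  have "(\<lambda>m. \<bar>c m\<bar>) \<longlonglongrightarrow> \<bar>\<integral>x. fun_of u x * g x \<partial>lborel\<bar>"
    unfolding c_def by (intro tendsto_rabs conv_form_mollifier_tendsto r g) simp
  then have "\<bar>\<integral>x. fun_of u x * g x \<partial>lborel\<bar> \<le> (4 * M) ^ CARD('n) * X + ?E / (1 - \<rho>)"
    by (rule LIMSEQ_le_const2) (use cm in auto)
  also have "\<dots> = (4 * M) ^ CARD('n) * (1 + real CARD('n) / (1 - \<rho>)) * X"
    by (simp add: distrib_left distrib_right mult_ac)
  finally show ?thesis
    unfolding X_def .
qed

text \<open>Duality: the pairing bound is applied to u and a small multiple \<nu> of sgn u |u|^(2 p
  - 1). The bound is affine in the integral of |\<psi>|^q, which is of order \<nu>^q, while the left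
  side is of order \<nu>; as q > 1, a small \<nu> permits absorption. The truncation |u| <= L makes
  the absorbed term finite and does not enter the constant.\<close>

lemma sobolev_truncated:
  fixes p A :: real
  assumes p: "1 < p" and n: "real CARD('n::finite) * (p - 1) < 2 * p"
  shows "\<exists>C. \<forall>(u :: 'n L2) D. (\<forall>i. weak_partial i u (D i) \<and> (norm (D i))\<^sup>2 \<le> A) \<and> (norm u)\<^sup>2 \<le> A \<longrightarrow>
    (\<forall>L>0. (\<integral>x. \<bar>fun_of u x\<bar> powr (2 * p) * indicator {v. \<bar>v\<bar> \<le> L} (fun_of u x) \<partial>lborel) \<le> C)"
proof -
  obtain M0 where M0: "0 < M0" "\<And>x. \<bar>mollifier x\<bar> \<le> M0"
    using smooth_compact_support_bounded[OF smooth_mollifier, of 1] mollifier_eq_0 by auto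
  define M where "M = max 1 M0"
  have M: "\<bar>mollifier x\<bar> \<le> M" "1 \<le> M" for x
    using M0(2)[of x] by (auto simp: M_def)
  define \<alpha> where "\<alpha> = 1 / 2 - 1 / (2 * p)"
  define q where "q = 2 * p / (2 * p - 1)"
  define \<rho> where "\<rho> = (1 / 2 :: real) powr (1 - real CARD('n) * \<alpha>)"
  have \<alpha>: "0 < \<alpha>" "real CARD('n) * \<alpha> < 1"
    using p n by (auto simp: \<alpha>_def field_simps)
  have \<rho>: "0 < \<rho>" "\<rho> < 1"
    using \<alpha> half_powr_less_1[of "1 - real CARD('n) * \<alpha>"] by (auto simp: \<rho>_def)
  have q: "1 < q" "q * (2 * p - 1) = 2 * p"
    using p by (auto simp: q_def field_simps)
  define C0 where "C0 = (4 * M) ^ CARD('n) * (1 + real CARD('n) / (1 - \<rho>))"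
  have C0: "0 < C0"
    using M \<rho> unfolding C0_def by (intro mult_pos_pos add_pos_nonneg) auto
  \<comment> \<open>\<open>max 0 A\<close> keeps \<open>B\<close> positive for every A; for negative
    A the claim is vacuous.\<close>
  define B where "B = 2 * C0 * (\<alpha> * max 0 A + 1 / 2)"
  have B: "0 < B"
    using C0 \<alpha> unfolding B_def by (intro mult_pos_pos add_nonneg_pos) auto
  \<comment> \<open>\<open>B\<close> is twice the coefficient of the term to be absorbed when A >=
    0, so \<nu>^(q - 1) = 1 / B turns that term into half of the left side.\<close>
  define \<nu> where "\<nu> = (1 / B) powr (1 / (q - 1))"
  have \<nu>: "0 < \<nu>" "\<nu> powr (q - 1) = 1 / B"
    using B q by (auto simp: \<nu>_def powr_powr)
  show ?thesis
  proof (intro exI allI impI)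
    fix u :: "'n L2" and D and L :: real
    assume uD: "(\<forall>i. weak_partial i u (D i) \<and> (norm (D i))\<^sup>2 \<le> A) \<and> (norm u)\<^sup>2 \<le> A" and L: "0 < L"
    have A: "0 \<le> A"
      using uD zero_le_power2[of "norm u"] by linarith
    define I where "I x = (indicator {v. \<bar>v\<bar> \<le> L} (fun_of u x) :: real)" for x
    define \<psi> where "\<psi> x = \<nu> * (sgn (fun_of u x) * \<bar>fun_of u x\<bar> powr (2 * p - 1) * I x)" for x
    have [measurable]: "I \<in> borel_measurable borel" "\<psi> \<in> borel_measurable borel"
      unfolding \<psi>_def I_def by measurable
    define Y where "Y = (\<integral>x. \<bar>fun_of u x\<bar> powr (2 * p) * I x \<partial>lborel)"
    have u2: "integrable lborel (\<lambda>x. (fun_of u x)\<^sup>2)"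
      using fun_of_sq_integrable[of u] by (simp only: sq_integrable_def)
    have pw: "\<bar>v\<bar> powr a \<le> L powr (a - 2) * v\<^sup>2" if "\<bar>v\<bar> \<le> L" "2 \<le> a" for v a
    proof -
      have "\<bar>v\<bar> powr a = \<bar>v\<bar> powr (a - 2) * v\<^sup>2" if "v \<noteq> 0"
        using that by (simp add: powr_diff)
      moreover have "\<bar>v\<bar> powr (a - 2) \<le> L powr (a - 2)"
        using that by (intro powr_mono2) auto
      ultimately show ?thesis
        by (cases "v = 0") (auto intro: mult_right_mono)
    qed
    have Yi: "integrable lborel (\<lambda>x. \<bar>fun_of u x\<bar> powr (2 * p) * I x)"
      by (rule Bochner_Integration.integrable_bound[OF integrable_mult_right[OF u2, of "L powr (2 * p - 2)"]])
         (use pw[of _ "2 * p"] p in \<open>auto simp: I_def indicator_def\<close>)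
    have \<psi>s: "sq_integrable \<psi>"
      unfolding sq_integrable_def
    proof
      show "integrable lborel (\<lambda>x. (\<psi> x)\<^sup>2)"
      proof (rule Bochner_Integration.integrable_bound[OF integrable_mult_right[OF u2, of "\<nu>\<^sup>2 * L powr (4 * p - 2 - 2)"]])
        have "norm ((\<psi> x)\<^sup>2) \<le> norm (\<nu>\<^sup>2 * L powr (4 * p - 2 - 2) * (fun_of u x)\<^sup>2)" for x
        proof -
          have "(\<bar>fun_of u x\<bar> powr (2 * p - 1))\<^sup>2 = \<bar>fun_of u x\<bar> powr (4 * p - 2)"
            by (simp add: power2_eq_square flip: powr_add)
          then have "(\<psi> x)\<^sup>2 \<le> \<nu>\<^sup>2 * (\<bar>fun_of u x\<bar> powr (4 * p - 2) * I x)"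
            by (auto simp: \<psi>_def power_mult_distrib I_def indicator_def sgn_if)
          also have "\<dots> \<le> \<nu>\<^sup>2 * (L powr (4 * p - 2 - 2) * (fun_of u x)\<^sup>2)"
            using pw[of "fun_of u x" "4 * p - 2"] p by (intro mult_left_mono) (auto simp: I_def indicator_def)
          finally show ?thesis
            by (simp add: mult.assoc)
        qed
        then show "AE x in lborel. norm ((\<psi> x)\<^sup>2) \<le> norm (\<nu>\<^sup>2 * L powr (4 * p - 2 - 2) * (fun_of u x)\<^sup>2)"
          by simp
      qed simp
    qed simp
    have \<psi>q: "\<bar>\<psi> x\<bar> powr q = \<nu> powr q * (\<bar>fun_of u x\<bar> powr (2 * p) * I x)" for x
    proof -
      have "\<bar>\<psi> x\<bar> = \<nu> * (\<bar>fun_of u x\<bar> powr (2 * p - 1) * I x)"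
        using \<nu>(1) by (auto simp: \<psi>_def abs_mult sgn_if I_def indicator_def)
      moreover have "(2 * p - 1) * q = 2 * p"
        using q(2) by (simp add: mult.commute)
      ultimately show ?thesis
        using \<nu>(1) by (auto simp: powr_mult powr_powr I_def indicator_def)
    qed
    have "fun_of u x * \<psi> x = \<nu> * (\<bar>fun_of u x\<bar> powr (2 * p) * I x)" for x
    proof -
      have "fun_of u x * sgn (fun_of u x) * \<bar>fun_of u x\<bar> powr (2 * p - 1) = \<bar>fun_of u x\<bar> powr (2 * p)"
        by (cases "fun_of u x = 0") (auto simp: powr_diff sgn_if)
      then show ?thesis
        by (simp add: \<psi>_def mult_ac)
    qed
    then have "\<nu> * Y = (\<integral>x. fun_of u x * \<psi> x \<partial>lborel)"
      by (simp add: Y_def)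
    also have "\<dots> \<le> C0 * ((\<alpha> * A + 1 / 2) * (\<integral>x. \<bar>\<psi> x\<bar> powr q \<partial>lborel) + A / (2 * p))"
      using L2_pairing_bound[OF M p, of u D A \<psi>] uD \<alpha>(2) \<psi>s Yi \<psi>q
      unfolding C0_def \<rho>_def \<alpha>_def q_def by auto
    also have "(\<integral>x. \<bar>\<psi> x\<bar> powr q \<partial>lborel) = \<nu> * \<nu> powr (q - 1) * Y"
      unfolding \<psi>q Y_def using \<nu>(1) by (simp add: powr_diff)
    also have "C0 * ((\<alpha> * A + 1 / 2) * (\<nu> * \<nu> powr (q - 1) * Y) + A / (2 * p)) = \<nu> * Y / 2 + C0 * A / (2 * p)"
    proof -
      have "C0 * (\<alpha> * A + 1 / 2) / B = 1 / 2"
      proof -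
        have "x / (2 * x) = 1 / 2" if "0 < x" for x :: real
          using that by simp
        from this[of "C0 * (\<alpha> * A + 1 / 2)"] show ?thesis
          using B A by (simp add: B_def mult.assoc)
      qed
      moreover have "C0 * (\<alpha> * A + 1 / 2) * (\<nu> * (1 / B) * Y) = C0 * (\<alpha> * A + 1 / 2) / B * (\<nu> * Y)"
        by simp
      ultimately have "C0 * (\<alpha> * A + 1 / 2) * (\<nu> * (1 / B) * Y) = \<nu> * Y / 2"
        by (metis mult.commute mult.right_neutral times_divide_eq_right)
      then show ?thesis
        unfolding \<nu>(2) distrib_left mult.assoc[symmetric] by simp
    qed
    also have "C0 * A / (2 * p) = C0 * A / p / 2"
      by simp
    finally have "\<nu> * Y \<le> \<nu> * Y / 2 + C0 * A / p / 2" .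
    moreover have "x \<le> y" if "x \<le> x / 2 + y / 2" for x y :: real
      using that by linarith
    ultimately have "\<nu> * Y \<le> C0 * A / p"
      by blast
    then have "Y \<le> C0 * A / p / \<nu>"
      using \<nu>(1) by (simp only: pos_le_divide_eq mult.commute)
    then show "(\<integral>x. \<bar>fun_of u x\<bar> powr (2 * p) * indicator {v. \<bar>v\<bar> \<le> L} (fun_of u x) \<partial>lborel) \<le> C0 * A / p / \<nu>"
      unfolding Y_def I_def .
  qed
qed

text \<open>Removes the truncation by dominated convergence. Integrability of |f|^(2 p) is at hand
  in the application, where |u(s)|^p is an L^2 class; the point is a bound that depends on the H^1
  norm only.\<close>

lemma sobolev:
  fixes p A :: real
  assumes p: "1 < p" and n: "real CARD('n::finite) * (p - 1) < 2 * p"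
  shows "\<exists>C. \<forall>f :: 'n H1. norm f \<le> A \<longrightarrow> integrable lborel (\<lambda>x. \<bar>fun_of (H1_to_L2 f) x\<bar> powr (2 * p)) \<longrightarrow>
    (\<integral>x. \<bar>fun_of (H1_to_L2 f) x\<bar> powr (2 * p) \<partial>lborel) \<le> C"
proof -
  obtain C where C: "\<And>(u :: 'n L2) D L. (\<And>i. weak_partial i u (D i)) \<Longrightarrow> (\<And>i. (norm (D i))\<^sup>2 \<le> A\<^sup>2) \<Longrightarrow>
      (norm u)\<^sup>2 \<le> A\<^sup>2 \<Longrightarrow> 0 < L \<Longrightarrow>
      (\<integral>x. \<bar>fun_of u x\<bar> powr (2 * p) * indicator {v. \<bar>v\<bar> \<le> L} (fun_of u x) \<partial>lborel) \<le> C"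
    using sobolev_truncated[OF assms, of "A\<^sup>2"] by blast
  show ?thesis
  proof (intro exI allI impI)
    fix f :: "'n H1"
    assume fA: "norm f \<le> A" and int: "integrable lborel (\<lambda>x. \<bar>fun_of (H1_to_L2 f) x\<bar> powr (2 * p))"
    let ?u = "H1_to_L2 f"
    have le: "(norm ?u)\<^sup>2 \<le> A\<^sup>2" "(norm (H1_grad f $ i))\<^sup>2 \<le> A\<^sup>2" for i
      using norm_H1_to_L2_le[of f] norm_H1_grad_le[of f] Finite_Cartesian_Product.norm_nth_le[of "H1_grad f" i] fA
      by (auto intro!: power_mono)
    have "(\<lambda>m. \<integral>x. \<bar>fun_of ?u x\<bar> powr (2 * p) * indicator {v. \<bar>v\<bar> \<le> real (Suc m)} (fun_of ?u x) \<partial>lborel)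
        \<longlonglongrightarrow> (\<integral>x. \<bar>fun_of ?u x\<bar> powr (2 * p) \<partial>lborel)"
    proof (rule integral_dominated_convergence[OF _ _ int])
      show "AE x in lborel. (\<lambda>m. \<bar>fun_of ?u x\<bar> powr (2 * p) * indicator {v. \<bar>v\<bar> \<le> real (Suc m)} (fun_of ?u x))
          \<longlonglongrightarrow> \<bar>fun_of ?u x\<bar> powr (2 * p)"
      proof (rule AE_I2, rule tendsto_eventually)
        fix x
        obtain J where "\<bar>fun_of ?u x\<bar> \<le> real J"
          using real_arch_simple by blast
        then show "\<forall>\<^sub>F m in sequentially. \<bar>fun_of ?u x\<bar> powr (2 * p) * indicator {v. \<bar>v\<bar> \<le> real (Suc m)} (fun_of ?u x)
            = \<bar>fun_of ?u x\<bar> powr (2 * p)"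
          by (auto intro!: eventually_sequentiallyI[of J])
      qed
    qed (auto simp: indicator_def)
    then show "(\<integral>x. \<bar>fun_of ?u x\<bar> powr (2 * p) \<partial>lborel) \<le> C"
      by (rule LIMSEQ_le_const2) (auto intro!: C[where D = "\<lambda>i. H1_grad f $ i"] weak_partial_H1 le)
  qed
qed

section \<open>The linear equation\<close>

lemma laplacian_inner: "inner (laplacian f) (H2_to_L2 g) = - inner (H2_grad f) (H2_grad g)"
proof -
  have "inner (H2_hess f $ i $ i) (H2_to_L2 g) = - inner (H2_grad f $ i) (H2_grad g $ i)" for i
    by (rule weak_partial_inner_commute[OF weak_partial_H2(2) weak_partial_H2(1)])
  then show ?thesis
    by (simp add: laplacian_eq inner_sum_left inner_vec_def sum_negf)
qed

text \<open>The relation \<psi> = \<Delta>\<phi>, tested only against H^2 functions, since those are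
  the values of strong solutions.\<close>

definition weak_laplacian :: "'n::finite L2 \<Rightarrow> 'n L2 \<Rightarrow> bool" where
  "weak_laplacian \<phi> \<psi> \<longleftrightarrow> (\<forall>f. inner (laplacian f) \<phi> = inner (H2_to_L2 f) \<psi>)"

text \<open>After integration by parts the terms of the undamped equation cancel, and the derivative
  of the energy is -2 b |grad w_t|^2 with b > 0.\<close>

lemma strong_solution_energy:
  assumes sol: "strong_solution b\<^sub>0 \<beta> s g\<^sub>0 g\<^sub>1 w w\<^sub>t" and b: "0 < b\<^sub>0" and t: "s \<le> t"
  shows "(norm (H2_to_L2 (w\<^sub>t t)))\<^sup>2 + (norm (H2_grad (w t)))\<^sup>2
    \<le> (norm (H2_to_L2 g\<^sub>1))\<^sup>2 + (norm (H2_grad g\<^sub>0))\<^sup>2"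
proof -
  obtain w\<^sub>t\<^sub>t where w: "w s = g\<^sub>0" "w\<^sub>t s = g\<^sub>1"
    and D: "\<And>t. s \<le> t \<Longrightarrow> (w has_vector_derivative w\<^sub>t t) (at t within {s..})"
    and D2: "\<And>t. s \<le> t \<Longrightarrow> ((\<lambda>t. H2_to_L2 (w\<^sub>t t)) has_vector_derivative w\<^sub>t\<^sub>t t) (at t within {s..})"
    and eq: "\<And>t. s \<le> t \<Longrightarrow> w\<^sub>t\<^sub>t t - laplacian (w t) - (b\<^sub>0 / (1 + t) powr \<beta>) *\<^sub>R laplacian (w\<^sub>t t) = 0"
    using sol unfolding strong_solution_def by blast
  define E where "E t = inner (H2_to_L2 (w\<^sub>t t)) (H2_to_L2 (w\<^sub>t t)) + inner (H2_grad (w t)) (H2_grad (w t))" for t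
  have "E t \<le> E s"
  proof (cases "s = t")
    case False
    then have st: "s < t"
      using t by simp
    let ?E' = "\<lambda>x. 2 * inner (w\<^sub>t\<^sub>t x) (H2_to_L2 (w\<^sub>t x)) + 2 * inner (H2_grad (w x)) (H2_grad (w\<^sub>t x))"
    have "(E has_vector_derivative ?E' x) (at x within {s..t})" if "s \<le> x" for x
    proof -
      have "(E has_vector_derivative ?E' x) (at x within {s..})"
        unfolding E_def
        by (rule has_vector_derivative_eq_rhs,
            rule has_vector_derivative_add[OF
              bounded_bilinear.has_vector_derivative[OF bounded_bilinear_inner D2[OF that] D2[OF that]]
              bounded_bilinear.has_vector_derivative[OF bounded_bilinear_inner
                bounded_linear.has_vector_derivative[OF bounded_linear_H2_grad D[OF that]]
                bounded_linear.has_vector_derivative[OF bounded_linear_H2_grad D[OF that]]]])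
           (simp add: inner_commute)
      then show ?thesis
        by (rule has_vector_derivative_within_subset) auto
    qed
    then have "\<exists>x\<in>{s<..<t}. E t - E s = (t - s) * ?E' x"
      using mvt_simple[OF st, of E "\<lambda>x h. h * ?E' x"] by (auto simp: has_vector_derivative_def)
    then obtain x where x: "s < x" "E t - E s = (t - s) * ?E' x"
      by auto
    let ?b = "b\<^sub>0 / (1 + x) powr \<beta>"
    have "w\<^sub>t\<^sub>t x = laplacian (w x) + ?b *\<^sub>R laplacian (w\<^sub>t x)"
      using eq[of x] x by (simp add: algebra_simps)
    then have "?E' x = - 2 * (?b * inner (H2_grad (w\<^sub>t x)) (H2_grad (w\<^sub>t x)))"
      by (simp add: inner_add_left laplacian_inner)
    moreover have "0 \<le> ?b * inner (H2_grad (w\<^sub>t x)) (H2_grad (w\<^sub>t x))"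
      using b by (intro mult_nonneg_nonneg) auto
    ultimately have "?E' x \<le> 0"
      by linarith
    then have "(t - s) * ?E' x \<le> 0"
      using st by (intro mult_nonneg_nonpos) auto
    then show ?thesis
      using x by simp
  qed simp
  then show ?thesis
    by (simp add: E_def w power2_norm_eq_inner)
qed

text \<open>Integrates in time the velocity bound contained in the energy estimate.\<close>

lemma strong_solution_norm:
  assumes sol: "strong_solution b\<^sub>0 \<beta> s g\<^sub>0 g\<^sub>1 w w\<^sub>t" and b: "0 < b\<^sub>0" and t: "s \<le> t"
  shows "norm (H2_to_L2 (w t)) \<le> norm (H2_to_L2 g\<^sub>0)
    + (t - s) * sqrt ((norm (H2_to_L2 g\<^sub>1))\<^sup>2 + (norm (H2_grad g\<^sub>0))\<^sup>2)"
proof -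
  define B where "B = sqrt ((norm (H2_to_L2 g\<^sub>1))\<^sup>2 + (norm (H2_grad g\<^sub>0))\<^sup>2)"
  have w: "w s = g\<^sub>0" and D: "\<And>t. s \<le> t \<Longrightarrow> (w has_vector_derivative w\<^sub>t t) (at t within {s..})"
    using sol unfolding strong_solution_def by blast+
  have B: "norm (H2_to_L2 (w\<^sub>t x)) \<le> B" if "s \<le> x" for x
    unfolding B_def using strong_solution_energy[OF sol b that]
    by (intro real_le_rsqrt) (smt (verit) zero_le_power2)
  have "norm (H2_to_L2 (w t) - H2_to_L2 (w s)) \<le> B * norm (t - s)"
  proof (rule differentiable_bound[where S = "{s..}" and f = "\<lambda>t. H2_to_L2 (w t)" and f' = "\<lambda>x h. h *\<^sub>R H2_to_L2 (w\<^sub>t x)"])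
    show "((\<lambda>t. H2_to_L2 (w t)) has_derivative (\<lambda>h. h *\<^sub>R H2_to_L2 (w\<^sub>t x))) (at x within {s..})" if "x \<in> {s..}" for x
      using bounded_linear.has_vector_derivative[OF bounded_linear_H2_to_L2 D[of x]] that
      by (simp add: has_vector_derivative_def)
    show "onorm (\<lambda>h. h *\<^sub>R H2_to_L2 (w\<^sub>t x)) \<le> B" if "x \<in> {s..}" for x
      by (rule onorm_le) (use B[of x] that in \<open>simp add: mult.commute[of B] mult_left_mono\<close>)
  qed (use t in auto)
  then show ?thesis
    using norm_triangle_ineq2[of "H2_to_L2 (w t)" "H2_to_L2 (w s)"] t
    by (simp add: w B_def mult.commute)
qed

lemma R_value_initial:
  assumes "R_value b\<^sub>0 \<beta> s g\<^sub>0 g\<^sub>1 w"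
  shows "w s = g\<^sub>0"
proof -
  obtain h0 h1 v vt where sol: "\<And>k. strong_solution b\<^sub>0 \<beta> s (h0 k) (h1 k) (v k) (vt k)"
    and lim: "(\<lambda>k. H2_to_H1 (h0 k)) \<longlonglongrightarrow> g\<^sub>0"
    and unif: "uniform_limit {s..s} (\<lambda>k t. H2_to_H1 (v k t)) w sequentially"
    using assms unfolding R_value_def by blast
  have "v k s = h0 k" for k
    using sol[of k] by (simp add: strong_solution_def)
  then show ?thesis
    using tendsto_uniform_limitI[OF unif, of s] lim LIMSEQ_unique by fastforce
qed

text \<open>The limit of the estimate for strong solutions, in which the first datum and its
  gradient tend to 0. It provides the domination for the exchange of integrals in
  \<open>duhamel_weak\<close>.\<close>

lemma R_value_norm:
  assumes "R_value b\<^sub>0 \<beta> s 0 g z" and b: "0 < b\<^sub>0" and t: "s \<le> t"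
  shows "norm (H1_to_L2 (z t)) \<le> (t - s) * norm g"
proof -
  obtain h0 h1 v vt where sol: "\<And>k. strong_solution b\<^sub>0 \<beta> s (h0 k) (h1 k) (v k) (vt k)"
    and l0: "(\<lambda>k. H2_to_H1 (h0 k)) \<longlonglongrightarrow> 0" and l1: "(\<lambda>k. H2_to_L2 (h1 k)) \<longlonglongrightarrow> g"
    and unif: "uniform_limit {s..t} (\<lambda>k t. H2_to_H1 (v k t)) z sequentially"
    using assms unfolding R_value_def by blast
  have "(\<lambda>k. H2_to_H1 (v k t)) \<longlonglongrightarrow> z t"
    using tendsto_uniform_limitI[OF unif, of t] t by simp
  from bounded_linear.tendsto[OF bounded_linear_H1_to_L2 this]
  have lhs: "(\<lambda>k. norm (H2_to_L2 (v k t))) \<longlonglongrightarrow> norm (H1_to_L2 (z t))"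
    by (simp add: tendsto_norm)
  have "(\<lambda>k. H2_to_L2 (h0 k)) \<longlonglongrightarrow> 0" "(\<lambda>k. H2_grad (h0 k)) \<longlonglongrightarrow> 0"
    using bounded_linear.tendsto[OF bounded_linear_H1_to_L2 l0]
      bounded_linear.tendsto[OF bounded_linear_H1_grad l0]
    by (simp_all add: linear_0 bounded_linear.linear[OF bounded_linear_H1_to_L2]
        bounded_linear.linear[OF bounded_linear_H1_grad])
  then have "(\<lambda>k. norm (H2_to_L2 (h0 k)) + (t - s) * sqrt ((norm (H2_to_L2 (h1 k)))\<^sup>2 + (norm (H2_grad (h0 k)))\<^sup>2))
      \<longlonglongrightarrow> norm (0 :: 'a L2) + (t - s) * sqrt ((norm g)\<^sup>2 + (norm (0 :: 'a L2^'a))\<^sup>2)"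
    by (intro tendsto_intros l1)
  then have rhs: "(\<lambda>k. norm (H2_to_L2 (h0 k)) + (t - s) * sqrt ((norm (H2_to_L2 (h1 k)))\<^sup>2 + (norm (H2_grad (h0 k)))\<^sup>2))
      \<longlonglongrightarrow> (t - s) * norm g"
    by simp
  show ?thesis
    by (rule LIMSEQ_le[OF lhs rhs]) (use strong_solution_norm[OF sol b t] in blast)
qed

text \<open>The weight and its first derivative vanish at the final time T, so that integration by
  parts in time leaves boundary terms at the initial time only.\<close>

locale time_weight =
  fixes b\<^sub>0 \<beta> :: real and \<eta> \<eta>1 \<eta>2 :: "real \<Rightarrow> real" and T :: real
  assumes b0: "0 < b\<^sub>0"
    and \<eta>: "\<And>t. (\<eta> has_real_derivative \<eta>1 t) (at t)"
    and \<eta>1: "\<And>t. (\<eta>1 has_real_derivative \<eta>2 t) (at t)"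
    and \<eta>2: "continuous_on UNIV \<eta>2"
    and \<eta>T: "\<eta> T = 0" "\<eta>1 T = 0"
begin

definition damping :: "real \<Rightarrow> real" where
  "damping t = b\<^sub>0 / (1 + t) powr \<beta>"

definition damping' :: "real \<Rightarrow> real" where
  "damping' t = - (\<beta> * b\<^sub>0) * (1 + t) powr (- \<beta> - 1)"

\<comment> \<open>The formal adjoint of the linear operator maps \<open>\<eta>(t) \<phi>(x)\<close> to \<open>\<eta>''(t) \<phi>(x) + adj t \<Delta>\<phi>(x)\<close>.\<close>
definition adj :: "real \<Rightarrow> real" where
  "adj t = - \<eta> t + damping' t * \<eta> t + damping t * \<eta>1 t"

lemma damping_DERIV: "0 \<le> t \<Longrightarrow> (damping has_real_derivative damping' t) (at t)"
  unfolding damping_def[abs_def] damping'_def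
  by (auto intro!: derivative_eq_intros simp: powr_minus divide_simps powr_diff)

lemma continuous_on_adj: "continuous_on {0..} adj" "continuous_on A \<eta>2"
proof -
  have "continuous_on {0..} \<eta>" "continuous_on {0..} \<eta>1" "continuous_on {0..} damping"
    using \<eta> \<eta>1 damping_DERIV by (auto intro!: continuous_at_imp_continuous_on DERIV_isCont)
  then show "continuous_on {0..} adj"
    unfolding adj_def[abs_def] damping'_def by (intro continuous_intros) auto
  show "continuous_on A \<eta>2"
    using \<eta>2 continuous_on_subset by blast
qed

text \<open>For \<psi> = \<Delta>\<phi> this pairs f with the formal adjoint applied to the product
  of the time weight and \<phi>.\<close>

definition pairing :: "'n::finite L2 \<Rightarrow> 'n L2 \<Rightarrow> real \<Rightarrow> 'n L2 \<Rightarrow> real" where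
  "pairing \<phi> \<psi> t f = \<eta>2 t * inner f \<phi> + adj t * inner f \<psi>"

text \<open>The boundary terms at time s of the integrations by parts in time, for a solution with
  value f and velocity g at that time.\<close>

definition data_pairing :: "'n::finite L2 \<Rightarrow> 'n L2 \<Rightarrow> real \<Rightarrow> 'n L2 \<Rightarrow> 'n L2 \<Rightarrow> real" where
  "data_pairing \<phi> \<psi> s f g = \<eta> s * inner g \<phi> - \<eta>1 s * inner f \<phi> - damping s * \<eta> s * inner f \<psi>"

text \<open>Minus \<open>data_pairing\<close> along the solution is an antiderivative of
  \<open>pairing\<close>, since the equation replaces the second time derivative. It vanishes at T,
  so only the data at s remain.\<close>

lemma strong_solution_weak:
  assumes sol: "strong_solution b\<^sub>0 \<beta> s g\<^sub>0 g\<^sub>1 w w\<^sub>t" and \<phi>: "weak_laplacian \<phi> \<psi>" and s: "0 \<le> s" "s \<le> T"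
  shows "((\<lambda>t. pairing \<phi> \<psi> t (H2_to_L2 (w t))) has_integral
    data_pairing \<phi> \<psi> s (H2_to_L2 g\<^sub>0) (H2_to_L2 g\<^sub>1)) {s..T}"
proof -
  obtain w\<^sub>t\<^sub>t where w: "w s = g\<^sub>0" "w\<^sub>t s = g\<^sub>1"
    and D: "\<And>t. s \<le> t \<Longrightarrow> (w has_vector_derivative w\<^sub>t t) (at t within {s..})"
    and D2: "\<And>t. s \<le> t \<Longrightarrow> ((\<lambda>t. H2_to_L2 (w\<^sub>t t)) has_vector_derivative w\<^sub>t\<^sub>t t) (at t within {s..})"
    and eq: "\<And>t. s \<le> t \<Longrightarrow> w\<^sub>t\<^sub>t t - laplacian (w t) - (b\<^sub>0 / (1 + t) powr \<beta>) *\<^sub>R laplacian (w\<^sub>t t) = 0"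
    using sol unfolding strong_solution_def by blast
  let ?Q = "\<lambda>t. - data_pairing \<phi> \<psi> t (H2_to_L2 (w t)) (H2_to_L2 (w\<^sub>t t))"
  have "((\<lambda>t. pairing \<phi> \<psi> t (H2_to_L2 (w t))) has_integral (?Q T - ?Q s)) {s..T}"
  proof (rule fundamental_theorem_of_calculus[OF s(2)])
    fix t assume "t \<in> {s..T}"
    then have t: "s \<le> t" "0 \<le> t"
      using s by auto
    have F: "((\<lambda>t. inner (F t) c) has_real_derivative inner F' c) (at t within {s..})"
      if "(F has_vector_derivative F') (at t within {s..})" for F :: "real \<Rightarrow> 'a L2" and F' c
      using bounded_linear.has_vector_derivative[OF bounded_linear_inner_left that]
      by (simp add: has_real_derivative_iff_has_vector_derivative)
    have L: "((\<lambda>t. H2_to_L2 (w t)) has_vector_derivative H2_to_L2 (w\<^sub>t t)) (at t within {s..})"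
      by (rule bounded_linear.has_vector_derivative[OF bounded_linear_H2_to_L2 D[OF t(1)]])
    note at = has_field_derivative_at_within
    have "w\<^sub>t\<^sub>t t = laplacian (w t) + damping t *\<^sub>R laplacian (w\<^sub>t t)"
      using eq[OF t(1)] by (simp add: algebra_simps damping_def)
    then have wtt: "inner (w\<^sub>t\<^sub>t t) \<phi> = inner (H2_to_L2 (w t)) \<psi> + damping t * inner (H2_to_L2 (w\<^sub>t t)) \<psi>"
      using \<phi> by (simp add: inner_add_left weak_laplacian_def)
    have "(?Q has_real_derivative pairing \<phi> \<psi> t (H2_to_L2 (w t))) (at t within {s..})"
      unfolding data_pairing_def
      by (rule DERIV_cong, rule DERIV_minus,
          rule DERIV_diff[OF DERIV_diff[OF DERIV_mult[OF at[OF \<eta>] F[OF D2[OF t(1)]]]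
              DERIV_mult[OF at[OF \<eta>1] F[OF L]]]
            DERIV_mult[OF DERIV_mult[OF at[OF damping_DERIV[OF t(2)]] at[OF \<eta>]] F[OF L]]])
         (simp add: wtt pairing_def adj_def algebra_simps)
    then show "(?Q has_vector_derivative pairing \<phi> \<psi> t (H2_to_L2 (w t))) (at t within {s..T})"
      by (auto simp: has_real_derivative_iff_has_vector_derivative intro: has_vector_derivative_within_subset)
  qed
  then show ?thesis
    using \<eta>T by (simp add: w data_pairing_def)
qed

lemma continuous_on_pairing:
  assumes "continuous_on {s..t} f" "0 \<le> s"
  shows "continuous_on {s..t} (\<lambda>x. pairing \<phi> \<psi> x (f x))"
  unfolding pairing_def using assms
  by (intro continuous_intros continuous_on_adj(2) continuous_on_subset[OF continuous_on_adj(1)]) auto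

text \<open>The identity for strong solutions contains no derivative of w in the integral and only
  the data on the other side, so it survives the limits that define \<open>R_value\<close>.\<close>

lemma R_value_weak:
  assumes R: "R_value b\<^sub>0 \<beta> s g\<^sub>0 g\<^sub>1 w" and \<phi>: "weak_laplacian \<phi> \<psi>" and s: "0 \<le> s" "s \<le> T"
  shows "((\<lambda>t. pairing \<phi> \<psi> t (H1_to_L2 (w t))) has_integral data_pairing \<phi> \<psi> s (H1_to_L2 g\<^sub>0) g\<^sub>1) {s..T}"
proof -
  obtain h0 h1 v vt where sol: "\<And>k. strong_solution b\<^sub>0 \<beta> s (h0 k) (h1 k) (v k) (vt k)"
    and l0: "(\<lambda>k. H2_to_H1 (h0 k)) \<longlonglongrightarrow> g\<^sub>0" and l1: "(\<lambda>k. H2_to_L2 (h1 k)) \<longlonglongrightarrow> g\<^sub>1"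
    and unif: "uniform_limit {s..T} (\<lambda>k t. H2_to_H1 (v k t)) w sequentially"
    and w: "continuous_on {s..} w"
    using R s unfolding R_value_def by blast
  have wL: "continuous_on {s..T} (\<lambda>t. H1_to_L2 (w t))"
    by (rule bounded_linear.continuous_on[OF bounded_linear_H1_to_L2]) (rule continuous_on_subset[OF w], simp)
  have u: "uniform_limit {s..T} (\<lambda>k t. inner (H2_to_L2 (v k t)) c) (\<lambda>t. inner (H1_to_L2 (w t)) c) sequentially" for c
    using bounded_linear.uniform_limit[OF bounded_linear_inner_left
        bounded_linear.uniform_limit[OF bounded_linear_H1_to_L2 unif], of c] by simp
  have mult: "uniform_limit {s..T} (\<lambda>k t. a t * inner (H2_to_L2 (v k t)) c) (\<lambda>t. a t * inner (H1_to_L2 (w t)) c) sequentially"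
    if a: "continuous_on {s..T} a" for a c
  proof (rule uniform_lim_mult[OF uniform_limit_const u])
    show "bounded (a ` {s..T})"
      by (intro compact_imp_bounded compact_continuous_image a) simp
    show "bounded ((\<lambda>t. inner (H1_to_L2 (w t)) c) ` {s..T})"
      by (intro compact_imp_bounded compact_continuous_image continuous_intros wL) simp
  qed
  have unif': "uniform_limit {s..T} (\<lambda>k t. pairing \<phi> \<psi> t (H2_to_L2 (v k t))) (\<lambda>t. pairing \<phi> \<psi> t (H1_to_L2 (w t))) sequentially"
    unfolding pairing_def
    by (intro uniform_limit_add mult continuous_on_adj(2) continuous_on_subset[OF continuous_on_adj(1)]) (use s in auto)
  have vc: "continuous_on {s..T} (\<lambda>t. pairing \<phi> \<psi> t (H2_to_L2 (v k t)))" for k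
  proof (rule continuous_on_pairing[OF bounded_linear.continuous_on[OF bounded_linear_H2_to_L2] s(1)])
    have "\<And>t. s \<le> t \<Longrightarrow> (v k has_vector_derivative vt k t) (at t within {s..})"
      using sol[of k] unfolding strong_solution_def by blast
    then have "continuous_on {s..} (v k)"
      unfolding continuous_on_eq_continuous_within by (auto intro: has_vector_derivative_continuous)
    then show "continuous_on {s..T} (v k)"
      by (rule continuous_on_subset) auto
  qed
  obtain I J where I: "\<And>k. ((\<lambda>t. pairing \<phi> \<psi> t (H2_to_L2 (v k t))) has_integral I k) {s..T}"
    and J: "((\<lambda>t. pairing \<phi> \<psi> t (H1_to_L2 (w t))) has_integral J) {s..T}" and IJ: "I \<longlonglongrightarrow> J"
    using uniform_limit_integral[OF unif' vc] by auto
  have "I = (\<lambda>k. data_pairing \<phi> \<psi> s (H2_to_L2 (h0 k)) (H2_to_L2 (h1 k)))"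
    by (rule ext) (rule has_integral_unique[OF I strong_solution_weak[OF sol \<phi> s]])
  moreover have "(\<lambda>k. data_pairing \<phi> \<psi> s (H2_to_L2 (h0 k)) (H2_to_L2 (h1 k))) \<longlonglongrightarrow> data_pairing \<phi> \<psi> s (H1_to_L2 g\<^sub>0) g\<^sub>1"
    unfolding data_pairing_def
    using bounded_linear.tendsto[OF bounded_linear_H1_to_L2 l0] by (intro tendsto_intros l1) simp_all
  ultimately have "I \<longlonglongrightarrow> data_pairing \<phi> \<psi> s (H1_to_L2 g\<^sub>0) g\<^sub>1"
    by (simp only:)
  with IJ have "J = data_pairing \<phi> \<psi> s (H1_to_L2 g\<^sub>0) g\<^sub>1"
    by (rule LIMSEQ_unique)
  then show ?thesis
    using J by simp
qed

end

section \<open>The Duhamel formula in weak form\<close>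

lemma riemann_sum_tendsto:
  fixes f :: "real \<Rightarrow> real"
  assumes f: "continuous_on {0..T} f" and T: "0 < T"
  shows "(\<lambda>k. \<Sum>j<Suc k. T / real (Suc k) * f (real j * (T / real (Suc k)))) \<longlonglongrightarrow> integral {0..T} f"
proof (rule LIMSEQ_I)
  fix \<epsilon> :: real assume \<epsilon>: "0 < \<epsilon>"
  define e where "e = \<epsilon> / (2 * T)"
  have e: "0 < e"
    using \<epsilon> T by (simp add: e_def)
  have "uniformly_continuous_on {0..T} f"
    by (intro compact_uniformly_continuous f) simp
  then obtain \<delta> where \<delta>: "0 < \<delta>" "\<And>x y. x \<in> {0..T} \<Longrightarrow> y \<in> {0..T} \<Longrightarrow> dist y x < \<delta> \<Longrightarrow> dist (f y) (f x) < e"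
    using e unfolding uniformly_continuous_on_def by metis
  have int: "f integrable_on {a..b}" if "0 \<le> a" "b \<le> T" for a b
    by (intro integrable_continuous_real continuous_on_subset[OF f]) (use that in auto)
  obtain K where K: "T / \<delta> < real K"
    using reals_Archimedean2 by blast
  show "\<exists>K. \<forall>k\<ge>K. norm ((\<Sum>j<Suc k. T / real (Suc k) * f (real j * (T / real (Suc k)))) - integral {0..T} f) < \<epsilon>"
  proof (intro exI allI impI)
    fix k assume k: "K \<le> k"
    define h where "h = T / real (Suc k)"
    have "T / \<delta> < real (Suc k)"
      using K k by linarith
    then have h: "0 < h" "h < \<delta>" "real (Suc k) * h = T"
      using T \<delta>(1) by (auto simp: h_def field_simps)
    \<comment> \<open>The error over the first m cells is at most e times their total length; the
      induction adds one cell at a time.\<close>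
    have "\<bar>(\<Sum>j<m. h * f (real j * h)) - integral {0..real m * h} f\<bar> \<le> e * (real m * h)" if "m \<le> Suc k" for m
      using that
    proof (induction m)
      case (Suc m)
      define a where "a = real m * h"
      have "real (Suc m) * h \<le> real (Suc k) * h"
        using Suc.prems h by (intro mult_right_mono) auto
      then have a: "0 \<le> a" "a + h \<le> T"
        using h by (auto simp: a_def algebra_simps)
      have mh: "real (Suc m) * h = a + h"
        by (simp add: a_def algebra_simps)
      have "integral {0..a} f + integral {a..a + h} f = integral {0..a + h} f"
        by (rule Henstock_Kurzweil_Integration.integral_combine) (use a h int in auto)
      moreover have "\<bar>integral {a..a + h} f - h * f a\<bar> \<le> e * h"
      proof -
        have "((\<lambda>x. f x - f a) has_integral (integral {a..a + h} f - h * f a)) {a..a + h}"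
          using h a has_integral_const_real[of "f a" a "a + h"]
          by (intro has_integral_diff integrable_integral int) auto
        moreover have "norm (f x - f a) \<le> e" if "x \<in> cbox a (a + h)" for x
          using \<delta>(2)[of a x] that a h by (simp add: dist_real_def less_imp_le)
        ultimately show ?thesis
          using has_integral_bound[of e "\<lambda>x. f x - f a" _ a "a + h"] e h by simp
      qed
      moreover have "\<bar>(\<Sum>j<m. h * f (real j * h)) - integral {0..a} f\<bar> \<le> e * a"
        using Suc by (simp add: a_def)
      moreover have "(\<Sum>j<Suc m. h * f (real j * h)) = (\<Sum>j<m. h * f (real j * h)) + h * f a"
        by (simp add: a_def)
      ultimately show ?case
        unfolding mh distrib_left by linarith
    qed simp
    from this[of "Suc k"] have "\<bar>(\<Sum>j<Suc k. h * f (real j * h)) - integral {0..T} f\<bar> \<le> e * T"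
      unfolding h(3) by simp
    also have "e * T < \<epsilon>"
      using \<epsilon> T by (simp add: e_def)
    finally show "norm ((\<Sum>j<Suc k. T / real (Suc k) * f (real j * (T / real (Suc k)))) - integral {0..T} f) < \<epsilon>"
      by (simp add: h_def)
  qed
qed

text \<open>
  The integral in \<open>s\<close> is a gauge integral and the joint measurability of \<open>\<kappa>\<close> is not known, so
  Fubini's theorem is replaced by Riemann sums in \<open>t\<close> and dominated convergence in \<open>s\<close>.
\<close>

lemma integral_swap_dominated:
  fixes \<kappa> :: "real \<Rightarrow> real \<Rightarrow> real"
  assumes T: "0 < T"
    and A: "\<And>t. t \<in> {0..T} \<Longrightarrow> ((\<lambda>s. \<kappa> s t) has_integral A t) {0..T}" "continuous_on {0..T} A"
    and \<kappa>: "\<And>s. s \<in> {0..T} \<Longrightarrow> continuous_on {0..T} (\<kappa> s)"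
      "\<And>s t. s \<in> {0..T} \<Longrightarrow> t \<in> {0..T} \<Longrightarrow> \<bar>\<kappa> s t\<bar> \<le> B"
  shows "((\<lambda>s. integral {0..T} (\<kappa> s)) has_integral integral {0..T} A) {0..T}"
proof -
  define r where "r k s = (\<Sum>j<Suc k. T / real (Suc k) * \<kappa> s (real j * (T / real (Suc k))))" for k s
  have node: "real j * (T / real (Suc k)) \<in> {0..T}" if "j < Suc k" for j k
  proof -
    have "real j * T \<le> real (Suc k) * T"
      using that T by (intro mult_right_mono) auto
    then show ?thesis
      using T by (simp add: divide_le_eq mult.commute)
  qed
  have rI: "(r k has_integral (\<Sum>j<Suc k. T / real (Suc k) * A (real j * (T / real (Suc k))))) {0..T}" for k
    unfolding r_def by (intro has_integral_sum has_integral_mult_right A node) auto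
  have rB: "norm (r k s) \<le> T * B" if s: "s \<in> {0..T}" for k s
  proof -
    have "norm (r k s) \<le> (\<Sum>j<Suc k. T / real (Suc k) * B)"
      unfolding r_def
    proof (rule order_trans[OF norm_sum sum_mono])
      fix j assume "j \<in> {..<Suc k}"
      then have "\<bar>\<kappa> s (real j * (T / real (Suc k)))\<bar> \<le> B"
        by (intro \<kappa>(2) s node) simp
      then show "norm (T / real (Suc k) * \<kappa> s (real j * (T / real (Suc k)))) \<le> T / real (Suc k) * B"
        unfolding real_norm_def abs_mult using T by (intro mult_mono) auto
    qed
    also have "\<dots> = T * B"
      by (simp add: field_simps)
    finally show ?thesis .
  qed
  have conv: "(\<lambda>k. r k s) \<longlonglongrightarrow> integral {0..T} (\<kappa> s)" if "s \<in> {0..T}" for s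
    unfolding r_def by (rule riemann_sum_tendsto[OF \<kappa>(1)[OF that] T])
  \<comment> \<open>For the gauge integral, dominated convergence asks only that each Riemann sum be
    integrable in s, which holds because each section at fixed t is.\<close>
  note dc = dominated_convergence[of r "{0..T}" "\<lambda>_. T * B", OF has_integral_integrable[OF rI] _ rB conv]
  have "(\<lambda>k. integral {0..T} (r k)) \<longlonglongrightarrow> integral {0..T} (\<lambda>s. integral {0..T} (\<kappa> s))"
    by (rule dc(2)) auto
  moreover have "(\<lambda>k. integral {0..T} (r k)) \<longlonglongrightarrow> integral {0..T} A"
    using riemann_sum_tendsto[OF A(2) T] by (simp add: integral_unique[OF rI])
  ultimately have "integral {0..T} (\<lambda>s. integral {0..T} (\<kappa> s)) = integral {0..T} A"
    by (rule LIMSEQ_unique)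
  moreover have "(\<lambda>s. integral {0..T} (\<kappa> s)) integrable_on {0..T}"
    by (rule dc(1)) auto
  ultimately show ?thesis
    using integrable_integral by fastforce
qed

context time_weight
begin

text \<open>The linear functional \<open>pairing\<close> is applied under the Duhamel integral and
  the two time integrals are exchanged. For fixed s the inner integral is then the weak identity for
  \<open>z s\<close> with data 0 and \<open>N s\<close>, whose only boundary term is the weight at s
  times the inner product of \<open>N s\<close> and \<phi>.\<close>

lemma duhamel_weak:
  fixes u :: "real \<Rightarrow> 'n::finite H1"
  assumes u: "continuous_on {0..T} u" and w: "R_value b\<^sub>0 \<beta> 0 g\<^sub>0 g\<^sub>1 w" and T: "0 < T"
    and z: "\<And>s. s \<in> {0..T} \<Longrightarrow> R_value b\<^sub>0 \<beta> s 0 (N s) (z s)"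
    and zI: "\<And>t. t \<in> {0..T} \<Longrightarrow> ((\<lambda>s. z s t) has_integral (u t - w t)) {0..t}"
    and N: "\<And>s. s \<in> {0..T} \<Longrightarrow> norm (N s) \<le> C" and \<phi>: "weak_laplacian \<phi> \<psi>"
  shows "((\<lambda>s. \<eta> s * inner (N s) \<phi>) has_integral
    (integral {0..T} (\<lambda>t. pairing \<phi> \<psi> t (H1_to_L2 (u t))) - data_pairing \<phi> \<psi> 0 (H1_to_L2 g\<^sub>0) g\<^sub>1)) {0..T}"
proof -
  let ?L = "\<lambda>t f. pairing \<phi> \<psi> t (H1_to_L2 f)"
  have wc: "continuous_on {0..T} w"
    using w unfolding R_value_def by (meson Icc_subset_Ici_iff continuous_on_subset order_refl)
  have bl: "bounded_linear (?L t)" for t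
    unfolding pairing_def
    by (intro bounded_linear_add bounded_linear_const_mult
        bounded_linear_compose[OF bounded_linear_inner_left bounded_linear_H1_to_L2])
  have L0: "?L t 0 = 0" for t
    by (rule linear_0[OF bounded_linear.linear[OF bl]])
  have L_diff: "?L t (f - g) = ?L t f - ?L t g" for t f g
    by (rule linear_diff[OF bounded_linear.linear[OF bl]])
  \<comment> \<open>Extension by 0 to t < s turns the triangle of integration into a square.
    Continuity in t is kept because \<open>z s\<close> vanishes at time s.\<close>
  define \<kappa> where "\<kappa> s t = (if s \<le> t then ?L t (z s t) else 0)" for s t
  have "compact (\<eta>2 ` {0..T})" "compact (adj ` {0..T})"
    by (auto intro!: compact_continuous_image continuous_on_adj continuous_on_subset[OF continuous_on_adj(1)])
  then obtain c d where c: "\<And>t. t \<in> {0..T} \<Longrightarrow> \<bar>\<eta>2 t\<bar> \<le> c" and d: "\<And>t. t \<in> {0..T} \<Longrightarrow> \<bar>adj t\<bar> \<le> d"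
    by (fastforce dest!: compact_imp_bounded simp: bounded_iff)
  have C: "0 \<le> C"
    using N[of 0] T norm_ge_zero[of "N 0"] by (meson atLeastAtMost_iff less_imp_le order_refl order_trans)
  have \<kappa>B: "\<bar>\<kappa> s t\<bar> \<le> c * (T * C * norm \<phi>) + d * (T * C * norm \<psi>)" if s: "s \<in> {0..T}" and t: "t \<in> {0..T}" for s t
  proof (cases "s \<le> t")
    case True
    have "norm (H1_to_L2 (z s t)) \<le> (t - s) * norm (N s)"
      by (rule R_value_norm[OF z[OF s] b0 True])
    also have "\<dots> \<le> T * C"
      using s t True N[OF s] by (intro mult_mono) auto
    finally have zb: "norm (H1_to_L2 (z s t)) \<le> T * C" .
    have i: "\<bar>inner (H1_to_L2 (z s t)) v\<bar> \<le> T * C * norm v" for v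
      by (rule order_trans[OF Cauchy_Schwarz_ineq2 mult_right_mono[OF zb]]) simp
    have "\<bar>\<eta>2 t * inner (H1_to_L2 (z s t)) \<phi>\<bar> \<le> c * (T * C * norm \<phi>)"
      unfolding abs_mult by (intro mult_mono c t i) (use c[OF t] in auto)
    moreover have "\<bar>adj t * inner (H1_to_L2 (z s t)) \<psi>\<bar> \<le> d * (T * C * norm \<psi>)"
      unfolding abs_mult by (intro mult_mono d t i) (use d[OF t] in auto)
    ultimately show ?thesis
      using True by (simp add: \<kappa>_def pairing_def)
  next
    case False
    have "0 \<le> c" "0 \<le> d"
      using c[OF t] d[OF t] by auto
    then show ?thesis
      using False C T by (simp add: \<kappa>_def)
  qed
  have \<kappa>0: "\<kappa> s t = 0" if "s \<in> {0..T}" "t \<le> s" for s t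
    using that R_value_initial[OF z[OF that(1)]] L0 by (cases "t = s") (auto simp: \<kappa>_def)
  have \<kappa>c: "continuous_on {s..T} (\<lambda>t. ?L t (z s t))" if s: "s \<in> {0..T}" for s
  proof -
    have "continuous_on {s..T} (z s)"
      using z[OF s] unfolding R_value_def by (meson Icc_subset_Ici_iff continuous_on_subset order_refl)
    then show ?thesis
      using s by (intro continuous_on_pairing bounded_linear.continuous_on[OF bounded_linear_H1_to_L2]) auto
  qed
  have eq: "\<kappa> s t = ?L t (z s t)" if "t \<in> {s..T}" for s t
    using that by (simp add: \<kappa>_def)
  have I: "((\<lambda>s. integral {0..T} (\<kappa> s)) has_integral integral {0..T} (\<lambda>t. ?L t (u t - w t))) {0..T}"
  proof (rule integral_swap_dominated[OF T _ _ _ \<kappa>B])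
    fix t assume t: "t \<in> {0..T}"
    have "((\<lambda>s. ?L t (z s t)) has_integral ?L t (u t - w t)) {0..t}"
      using has_integral_linear[OF zI[OF t] bl] by (simp add: o_def)
    moreover have "{0..t} \<subseteq> {0..T}"
      using t by auto
    ultimately have "((\<lambda>s. if s \<in> {0..t} then ?L t (z s t) else 0) has_integral ?L t (u t - w t)) {0..T}"
      by (simp only: has_integral_restrict)
    then show "((\<lambda>s. \<kappa> s t) has_integral ?L t (u t - w t)) {0..T}"
      by (rule has_integral_eq[rotated]) (auto simp: \<kappa>_def)
  next
    show "continuous_on {0..T} (\<lambda>t. ?L t (u t - w t))"
      by (intro continuous_on_pairing bounded_linear.continuous_on[OF bounded_linear_H1_to_L2] continuous_intros u wc) simp
  next
    fix s assume s: "s \<in> {0..T}"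
    have "continuous_on ({0..s} \<union> {s..T}) (\<kappa> s)"
    proof (intro continuous_on_closed_Un)
      have "continuous_on {0..s} (\<lambda>_. 0 :: real)"
        by simp
      then show "continuous_on {0..s} (\<kappa> s)"
        by (rule continuous_on_eq) (use \<kappa>0[OF s] in auto)
      show "continuous_on {s..T} (\<kappa> s)"
        by (rule continuous_on_eq[OF \<kappa>c[OF s]]) (simp add: eq)
    qed auto
    also have "{0..s} \<union> {s..T} = {0..T}"
      using s by auto
    finally show "continuous_on {0..T} (\<kappa> s)" .
  qed
  have E: "integral {0..T} (\<kappa> s) = \<eta> s * inner (N s) \<phi>" if s: "s \<in> {0..T}" for s
  proof -
    have "((\<lambda>t. ?L t (z s t)) has_integral data_pairing \<phi> \<psi> s (H1_to_L2 0) (N s)) {s..T}"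
      by (rule R_value_weak[OF z[OF s] \<phi>]) (use s in auto)
    then have "((\<lambda>t. if t \<in> {s..T} then ?L t (z s t) else 0) has_integral data_pairing \<phi> \<psi> s (H1_to_L2 0) (N s)) {0..T}"
      using s by (subst has_integral_restrict) auto
    then have "(\<kappa> s has_integral data_pairing \<phi> \<psi> s (H1_to_L2 0) (N s)) {0..T}"
      by (rule has_integral_eq[rotated]) (auto simp: \<kappa>_def)
    moreover have "H1_to_L2 (0 :: 'n H1) = 0"
      by (simp add: linear_0 bounded_linear.linear[OF bounded_linear_H1_to_L2])
    ultimately show ?thesis
      by (simp add: integral_unique data_pairing_def)
  qed
  \<comment> \<open>The homogeneous part w contributes the data terms at time 0.\<close>
  have "integral {0..T} (\<lambda>t. ?L t (u t - w t))
      = integral {0..T} (\<lambda>t. ?L t (u t)) - data_pairing \<phi> \<psi> 0 (H1_to_L2 g\<^sub>0) g\<^sub>1"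
  proof (rule integral_unique)
    have "(\<lambda>t. ?L t (u t)) integrable_on {0..T}"
      by (intro integrable_continuous_real continuous_on_pairing bounded_linear.continuous_on[OF bounded_linear_H1_to_L2] u) simp
    from has_integral_diff[OF integrable_integral[OF this] R_value_weak[OF w \<phi>]] T
    show "((\<lambda>t. ?L t (u t - w t)) has_integral
        integral {0..T} (\<lambda>t. ?L t (u t)) - data_pairing \<phi> \<psi> 0 (H1_to_L2 g\<^sub>0) g\<^sub>1) {0..T}"
      by (simp add: L_diff)
  qed
  with has_integral_eq[OF E I] show ?thesis
    by simp
qed

text \<open>The hypothesis on \<open>p\<close> enters through the Sobolev bound, which makes \<open>\<parallel>N s\<parallel>\<close> bounded on \<open>[0, T]\<close>.\<close>

lemma mild_solution_weak:
  fixes u :: "real \<Rightarrow> 'n::finite H1"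
  assumes u: "mild_solution b\<^sub>0 \<beta> p u\<^sub>0 u\<^sub>1 T u" and T: "0 < T" and p: "1 < p" "real CARD('n) * (p - 1) < 2 * p"
    and \<phi>: "sq_integrable \<phi>" "weak_laplacian (abs_L2 \<phi>) \<psi>"
  shows "((\<lambda>s. \<eta> s * (\<integral>x. \<bar>fun_of (H1_to_L2 (u s)) x\<bar> powr p * \<phi> x \<partial>lborel)) has_integral
    (integral {0..T} (\<lambda>t. pairing (abs_L2 \<phi>) \<psi> t (H1_to_L2 (u t)))
      - data_pairing (abs_L2 \<phi>) \<psi> 0 (H1_to_L2 u\<^sub>0) u\<^sub>1)) {0..T}"
    and "s \<in> {0..T} \<Longrightarrow> integrable lborel (\<lambda>x. \<bar>fun_of (H1_to_L2 (u s)) x\<bar> powr p * \<phi> x)"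
proof -
  obtain w N z where uc: "continuous_on {0..T} u" and w: "R_value b\<^sub>0 \<beta> 0 u\<^sub>0 u\<^sub>1 w"
    and N: "\<And>s. s \<in> {0..T} \<Longrightarrow> AE x in lborel. fun_of (N s) x = \<bar>fun_of (H1_to_L2 (u s)) x\<bar> powr p"
    and z: "\<And>s. s \<in> {0..T} \<Longrightarrow> R_value b\<^sub>0 \<beta> s 0 (N s) (z s)"
    and zI: "\<And>t. t \<in> {0..T} \<Longrightarrow> ((\<lambda>s. z s t) has_integral (u t - w t)) {0..t}"
    using u unfolding mild_solution_def by blast
  have \<phi>m [measurable]: "\<phi> \<in> borel_measurable borel"
    using \<phi>(1) by (simp add: sq_integrable_def)
  have AEN: "AE x in lborel. fun_of (N s) x * \<phi> x = \<bar>fun_of (H1_to_L2 (u s)) x\<bar> powr p * \<phi> x"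
    if "s \<in> {0..T}" for s
    using N[OF that] by eventually_elim simp
  have "compact (u ` {0..T})"
    by (intro compact_continuous_image uc) simp
  then obtain A where A: "\<And>s. s \<in> {0..T} \<Longrightarrow> norm (u s) \<le> A"
    by (fastforce dest!: compact_imp_bounded simp: bounded_iff)
  obtain C where C: "\<And>f :: 'n H1. norm f \<le> A \<Longrightarrow> integrable lborel (\<lambda>x. \<bar>fun_of (H1_to_L2 f) x\<bar> powr (2 * p)) \<Longrightarrow>
      (\<integral>x. \<bar>fun_of (H1_to_L2 f) x\<bar> powr (2 * p) \<partial>lborel) \<le> C"
    using sobolev[OF p, of A] by blast
  have NC: "norm (N s) \<le> sqrt C" if s: "s \<in> {0..T}" for s
  proof -
    have ae: "AE x in lborel. (fun_of (N s) x)\<^sup>2 = \<bar>fun_of (H1_to_L2 (u s)) x\<bar> powr (2 * p)"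
      using N[OF s] by eventually_elim (simp add: power2_eq_square flip: powr_add)
    have "integrable lborel (\<lambda>x. (fun_of (N s) x)\<^sup>2)"
      using fun_of_sq_integrable[of "N s"] by (simp only: sq_integrable_def)
    then have "integrable lborel (\<lambda>x. \<bar>fun_of (H1_to_L2 (u s)) x\<bar> powr (2 * p))"
      by (subst integrable_cong_AE[OF _ _ ae, symmetric]) auto
    then have "(\<integral>x. \<bar>fun_of (H1_to_L2 (u s)) x\<bar> powr (2 * p) \<partial>lborel) \<le> C"
      by (intro C A s)
    moreover have "(norm (N s))\<^sup>2 = (\<integral>x. \<bar>fun_of (H1_to_L2 (u s)) x\<bar> powr (2 * p) \<partial>lborel)"
      unfolding norm_L2_sq by (rule integral_cong_AE[OF _ _ ae]) auto
    ultimately show ?thesis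
      by (simp add: real_le_rsqrt)
  qed
  have E: "inner (N s) (abs_L2 \<phi>) = (\<integral>x. \<bar>fun_of (H1_to_L2 (u s)) x\<bar> powr p * \<phi> x \<partial>lborel)" if "s \<in> {0..T}" for s
    unfolding inner_abs_L2[OF \<phi>(1)] by (rule integral_cong_AE[OF _ _ AEN[OF that]]) auto
  show "((\<lambda>s. \<eta> s * (\<integral>x. \<bar>fun_of (H1_to_L2 (u s)) x\<bar> powr p * \<phi> x \<partial>lborel)) has_integral
    (integral {0..T} (\<lambda>t. pairing (abs_L2 \<phi>) \<psi> t (H1_to_L2 (u t)))
      - data_pairing (abs_L2 \<phi>) \<psi> 0 (H1_to_L2 u\<^sub>0) u\<^sub>1)) {0..T}"
    by (rule has_integral_eq[OF _ duhamel_weak[OF uc w T z zI NC \<phi>(2)]]) (simp_all add: E)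
  show "integrable lborel (\<lambda>x. \<bar>fun_of (H1_to_L2 (u s)) x\<bar> powr p * \<phi> x)" if "s \<in> {0..T}"
    using sq_integrable_mult[OF fun_of_sq_integrable \<phi>(1), of "N s"]
    by (subst integrable_cong_AE[OF _ _ AEN[OF that], symmetric]) auto
qed

end

section \<open>Test functions adapted to the scaling\<close>

text \<open>The product and its first derivatives are all admissible test functions, so the two
  derivatives in the Hessian are moved one after the other, and the two signs cancel.\<close>

lemma weak_laplacian_tensor:
  fixes h :: "'n::finite \<Rightarrow> real \<Rightarrow> real"
  assumes h: "\<And>j. smooth (h j)" and r: "\<And>j x. r < \<bar>x\<bar> \<Longrightarrow> h j x = 0"
  defines "L \<equiv> (\<lambda>x. \<Sum>i\<in>UNIV. partial i (partial i (tensor h)) x)"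
  shows "test_function (tensor h)" and "sq_integrable L"
    and "weak_laplacian (abs_L2 (tensor h)) (abs_L2 L)"
proof -
  let ?h1 = "\<lambda>i. h(i := deriv (h i))" and ?h2 = "\<lambda>i. h(i := deriv (deriv (h i)))"
  have s1: "smooth (?h1 i j)" and s2: "smooth (?h2 i j)" for i j
    using h by (auto intro: smooth_deriv)
  have z1: "?h1 i j x = 0" if "r < \<bar>x\<bar>" for i j x
    using r that by (auto intro: deriv_eq_0_outside)
  have p1: "partial i (tensor h) = tensor (?h1 i)" for i
    by (rule partial_tensor) (rule h)
  have c: "compact (cube r :: (real^'n) set)"
    by (simp add: cube_eq_cbox)
  show t0: "test_function (tensor h)"
    by (rule test_function_tensor[of h, OF h _ c]) (rule tensor_eq_0[OF r])
  have t1: "test_function (partial i (tensor h))" for i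
    unfolding p1 by (rule test_function_tensor[of "?h1 i", OF s1 _ c]) (rule tensor_eq_0[OF z1])
  have sq: "sq_integrable (partial i (partial i (tensor h)))" for i
    by (rule test_function_sq_integrable(2)[OF t1])
  have "sq_integrable (\<lambda>x. \<Sum>i\<in>I. partial i (partial i (tensor h)) x)" if "finite I" for I
    using that by induction (auto intro: sq_integrable_zero sq_integrable_add sq)
  then show sL: "sq_integrable L"
    unfolding L_def by simp
  show "weak_laplacian (abs_L2 (tensor h)) (abs_L2 L)"
    unfolding weak_laplacian_def
  proof
    fix f :: "'n H2"
    have "inner (H2_hess f $ i $ i) (abs_L2 (tensor h))
        = (\<integral>x. fun_of (H2_to_L2 f) x * partial i (partial i (tensor h)) x \<partial>lborel)" for i
      using weak_partial_inner[OF weak_partial_H2(2)[of i f i] t0] weak_partial_inner[OF weak_partial_H2(1)[of i f] t1[of i]]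
      by (simp add: inner_abs_L2[OF sq])
    then have "inner (laplacian f) (abs_L2 (tensor h))
        = (\<Sum>i\<in>UNIV. \<integral>x. fun_of (H2_to_L2 f) x * partial i (partial i (tensor h)) x \<partial>lborel)"
      by (simp add: laplacian_eq inner_sum_left)
    also have "\<dots> = (\<integral>x. (\<Sum>i\<in>UNIV. fun_of (H2_to_L2 f) x * partial i (partial i (tensor h)) x) \<partial>lborel)"
      by (rule Bochner_Integration.integral_sum[symmetric]) (intro sq_integrable_mult sq fun_of_sq_integrable)
    also have "\<dots> = inner (H2_to_L2 f) (abs_L2 L)"
      unfolding inner_abs_L2[OF sL] by (simp add: L_def sum_distrib_left)
    finally show "inner (laplacian f) (abs_L2 (tensor h)) = inner (H2_to_L2 f) (abs_L2 L)" .
  qed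
qed

text \<open>The bounds by \<zeta>^(1 / p) are what Young's inequality needs: |u| times a derivative
  is then controlled by |u|^p \<zeta> and a constant. The second derivative has to vanish on all of
  [-1, 1], where the profile of half the scale lives; the condition at 0 removes the term with the
  derivative of the time weight from the data.\<close>

locale profile =
  fixes \<zeta> :: "real \<Rightarrow> real" and p C :: real
  assumes smooth: "smooth \<zeta>"
    and nonneg: "0 \<le> \<zeta> x" and le_1: "\<zeta> x \<le> 1"
    and eq_1: "\<bar>x\<bar> \<le> 1 \<Longrightarrow> \<zeta> x = 1" and eq_0: "2 \<le> \<bar>x\<bar> \<Longrightarrow> \<zeta> x = 0"
    and d2_eq_0: "\<bar>x\<bar> \<le> 1 \<Longrightarrow> deriv (deriv \<zeta>) x = 0" and d1_eq_0: "deriv \<zeta> 0 = 0"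
    and d1_bound: "\<bar>deriv \<zeta> x\<bar> \<le> C * \<zeta> x powr (1 / p)"
    and d2_bound: "\<bar>deriv (deriv \<zeta>) x\<bar> \<le> C * \<zeta> x powr (1 / p)"
    and p: "1 < p" and C: "0 \<le> C"

text \<open>
  A high power of the cutoff works: each derivative costs at most one factor, and
  \<open>m \<ge> (m + 2) / p\<close> for large \<open>m\<close>.
\<close>

lemma profile_exists:
  assumes p: "1 < p"
  shows "\<exists>\<zeta> C. profile \<zeta> p C"
proof -
  \<comment> \<open>The condition is (m + 2) / p <= m solved for m.\<close>
  obtain m where m: "2 / (p - 1) \<le> real m"
    using real_arch_simple by blast
  have "0 < 2 / (p - 1)"
    using p by simp
  then have m0: "0 < m"
    using m by (cases m) auto
  have mp: "(real m + 2) / p \<le> real m"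
    using m p by (simp add: field_simps)
  define \<zeta> where "\<zeta> x = cutoff x ^ (m + 2)" for x
  let ?c1 = "deriv cutoff" and ?c2 = "deriv (deriv cutoff)"
  let ?d1 = "\<lambda>x. real (m + 2) * (cutoff x ^ (m + 1) * ?c1 x)"
  let ?d2 = "\<lambda>x. real (m + 2) * (real (m + 1) * cutoff x ^ m * ?c1 x * ?c1 x + cutoff x ^ (m + 1) * ?c2 x)"
  have s: "smooth cutoff" "smooth ?c1" "smooth ?c2"
    by (intro smooth_cutoff smooth_deriv)+
  have P: "((\<lambda>x. cutoff x ^ Suc k) has_real_derivative real (Suc k) * (cutoff x ^ k * ?c1 x)) (at x)" for k x
    by (rule DERIV_cong, rule DERIV_power, rule smooth_DERIV[OF s(1)]) simp
  have D1: "deriv \<zeta> = ?d1"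
  proof
    fix x
    show "deriv \<zeta> x = ?d1 x"
      unfolding \<zeta>_def[abs_def]
      by (rule DERIV_imp_deriv) (use P[of "m + 1" x] in simp)
  qed
  have D2: "deriv (deriv \<zeta>) = ?d2"
  proof
    fix x
    show "deriv (deriv \<zeta>) x = ?d2 x"
      unfolding D1
      by (rule DERIV_imp_deriv, rule DERIV_cong,
          rule DERIV_cmult[OF DERIV_mult[OF P[of m x, unfolded Suc_eq_plus1] smooth_DERIV[OF s(2)]]])
         (simp add: algebra_simps)
  qed
  have z: "?c1 x = 0" "?c2 x = 0" if "2 < \<bar>x\<bar>" for x
    using that cutoff_eq_0 by (auto intro!: deriv_eq_0_outside[of 2])
  obtain M1 where M1: "0 < M1" "\<And>x. \<bar>?c1 x\<bar> \<le> M1"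
    using smooth_compact_support_bounded[OF s(2) z(1)] by blast
  obtain M2 where M2: "0 < M2" "\<And>x. \<bar>?c2 x\<bar> \<le> M2"
    using smooth_compact_support_bounded[OF s(3) z(2)] by blast
  have pw: "cutoff x ^ m \<le> \<zeta> x powr (1 / p)" "cutoff x ^ (m + 1) \<le> \<zeta> x powr (1 / p)" for x
  proof -
    show *: "cutoff x ^ m \<le> \<zeta> x powr (1 / p)"
    proof (cases "cutoff x = 0")
      case False
      then have c: "0 < cutoff x" "cutoff x \<le> 1"
        using cutoff_nonneg[of x] cutoff_le_1[of x] by auto
      have "cutoff x ^ m = cutoff x powr real m"
        using c by (simp add: powr_realpow)
      also have "\<dots> \<le> cutoff x powr ((real m + 2) / p)"
        using c mp by (intro powr_mono') auto
      also have "\<dots> = (cutoff x powr real (m + 2)) powr (1 / p)"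
        by (simp add: powr_powr add.commute)
      also have "cutoff x powr real (m + 2) = \<zeta> x"
        using c(1) unfolding \<zeta>_def by (rule powr_realpow)
      finally show ?thesis .
    qed (use m0 in \<open>auto simp: zero_power\<close>)
    have "cutoff x ^ (m + 1) \<le> cutoff x ^ m"
      using cutoff_nonneg[of x] cutoff_le_1[of x] by (intro power_decreasing) auto
    then show "cutoff x ^ (m + 1) \<le> \<zeta> x powr (1 / p)"
      using * by linarith
  qed
  define C where "C = real (m + 2) * M1 + real (m + 2) * (real (m + 1) * M1 * M1 + M2)"
  have b1: "\<bar>deriv \<zeta> x\<bar> \<le> real (m + 2) * M1 * \<zeta> x powr (1 / p)" for x
  proof -
    have "cutoff x ^ (m + 1) * \<bar>?c1 x\<bar> \<le> \<zeta> x powr (1 / p) * M1"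
      using M1 pw cutoff_nonneg[of x] by (intro mult_mono) auto
    then have "real (m + 2) * (cutoff x ^ (m + 1) * \<bar>?c1 x\<bar>) \<le> real (m + 2) * (\<zeta> x powr (1 / p) * M1)"
      by (rule mult_left_mono) simp
    then show ?thesis
      using cutoff_nonneg[of x] by (simp add: D1 abs_mult mult_ac del: power_Suc)
  qed
  have b2: "\<bar>deriv (deriv \<zeta>) x\<bar> \<le> real (m + 2) * (real (m + 1) * M1 * M1 + M2) * \<zeta> x powr (1 / p)" for x
  proof -
    have "\<bar>real (m + 1) * cutoff x ^ m * ?c1 x * ?c1 x\<bar> \<le> real (m + 1) * \<zeta> x powr (1 / p) * M1 * M1"
      unfolding abs_mult using M1 pw cutoff_nonneg[of x] by (intro mult_mono) auto
    moreover have "\<bar>cutoff x ^ (m + 1) * ?c2 x\<bar> \<le> \<zeta> x powr (1 / p) * M2"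
      unfolding abs_mult using M2 pw cutoff_nonneg[of x] by (intro mult_mono) auto
    ultimately have "\<bar>real (m + 1) * cutoff x ^ m * ?c1 x * ?c1 x + cutoff x ^ (m + 1) * ?c2 x\<bar>
        \<le> real (m + 1) * \<zeta> x powr (1 / p) * M1 * M1 + \<zeta> x powr (1 / p) * M2"
      by linarith
    then have "real (m + 2) * \<bar>real (m + 1) * cutoff x ^ m * ?c1 x * ?c1 x + cutoff x ^ (m + 1) * ?c2 x\<bar>
        \<le> real (m + 2) * (real (m + 1) * \<zeta> x powr (1 / p) * M1 * M1 + \<zeta> x powr (1 / p) * M2)"
      by (rule mult_left_mono) simp
    then show ?thesis
      unfolding D2 abs_mult by (simp add: algebra_simps)
  qed
  have CC: "real (m + 2) * M1 \<le> C" "real (m + 2) * (real (m + 1) * M1 * M1 + M2) \<le> C" "0 \<le> C"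
    using M1(1) M2(1) by (auto simp: C_def)
  have loc: "deriv \<zeta> x = 0" if "\<bar>x\<bar> < 3 / 2" for x
    by (rule deriv_eq_0_of_const_on[of "{- 3 / 2<..<3 / 2}" _ _ 1])
       (use that cutoff_eq_1 in \<open>auto simp: \<zeta>_def abs_less_iff abs_le_iff\<close>)
  have loc2: "deriv (deriv \<zeta>) x = 0" if "\<bar>x\<bar> < 3 / 2" for x
    by (rule deriv_eq_0_of_const_on[of "{- 3 / 2<..<3 / 2}" _ _ 0])
       (use that loc in \<open>auto simp: abs_less_iff\<close>)
  have "profile \<zeta> p C"
  proof
    show "smooth \<zeta>"
      unfolding \<zeta>_def[abs_def] by (intro smooth_power smooth_cutoff)
    show "\<bar>deriv \<zeta> x\<bar> \<le> C * \<zeta> x powr (1 / p)" for x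
      by (rule order_trans[OF b1]) (intro mult_right_mono CC powr_ge_zero)
    show "\<bar>deriv (deriv \<zeta>) x\<bar> \<le> C * \<zeta> x powr (1 / p)" for x
      by (rule order_trans[OF b2]) (intro mult_right_mono CC powr_ge_zero)
    show "\<zeta> x \<le> 1" for x
      unfolding \<zeta>_def using cutoff_nonneg[of x] cutoff_le_1[of x] by (rule power_le_one)
  qed (use p CC loc loc2 in \<open>auto simp: \<zeta>_def cutoff_nonneg cutoff_eq_1 cutoff_eq_0\<close>)
  then show ?thesis
    by blast
qed

context profile
begin

definition bump :: "real \<Rightarrow> real^'n::finite \<Rightarrow> real" where
  "bump \<rho> = tensor (\<lambda>_ s. \<zeta> (s / \<rho>))"

definition bump_laplacian :: "real \<Rightarrow> real^'n::finite \<Rightarrow> real" where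
  "bump_laplacian \<rho> x = (\<Sum>i\<in>UNIV. partial i (partial i (bump \<rho>)) x)"

lemma smooth_dilation: "smooth (\<lambda>s. \<zeta> (s / \<rho>))"
  using smooth_affine[OF smooth, of "1 / \<rho>" 0] by simp

lemma bump_range: "0 \<le> bump \<rho> x" "bump \<rho> x \<le> 1"
  unfolding bump_def tensor_def by (auto intro!: prod_nonneg prod_le_1 simp: nonneg le_1)

lemma bump_eq_1: "0 < \<rho> \<Longrightarrow> x \<in> cube \<rho> \<Longrightarrow> bump \<rho> x = 1"
  unfolding bump_def tensor_def cube_def by (intro prod.neutral ballI eq_1) (simp add: divide_le_eq)

lemma bump_eq_0: "0 < \<rho> \<Longrightarrow> x \<notin> cube (2 * \<rho>) \<Longrightarrow> bump \<rho> x = 0"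
  unfolding bump_def by (rule tensor_eq_0[of "2 * \<rho>"], rule eq_0) (simp_all add: le_divide_eq)

lemma dilation_eq_0: "0 < \<rho> \<Longrightarrow> 2 * \<rho> < \<bar>s\<bar> \<Longrightarrow> \<zeta> (s / \<rho>) = 0"
  by (rule eq_0) (simp add: le_divide_eq)

lemma bump_weak_laplacian:
  assumes "0 < \<rho>"
  shows "sq_integrable (bump \<rho> :: real^'n::finite \<Rightarrow> real)" "sq_integrable (bump_laplacian \<rho> :: real^'n \<Rightarrow> real)"
    and "weak_laplacian (abs_L2 (bump \<rho> :: real^'n \<Rightarrow> real)) (abs_L2 (bump_laplacian \<rho>))"
  using weak_laplacian_tensor[of "\<lambda>(_ :: 'n) s. \<zeta> (s / \<rho>)" "2 * \<rho>", OF smooth_dilation dilation_eq_0[OF assms]]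
  by (auto simp: bump_def bump_laplacian_def[abs_def] intro: test_function_sq_integrable)

text \<open>In each second derivative one factor carries the second derivative of \<zeta>, and the
  other factors satisfy v <= v^(1 / p) because 0 <= v <= 1. The whole product is therefore dominated
  by the power 1 / p of \<open>bump\<close>.\<close>

lemma bump_laplacian_bound:
  fixes x :: "real^'n::finite"
  assumes \<rho>: "0 < \<rho>"
  shows "\<bar>bump_laplacian \<rho> x\<bar> \<le> real CARD('n) * C / \<rho>\<^sup>2 * bump \<rho> x powr (1 / p)"
    and "x \<in> cube \<rho> \<Longrightarrow> bump_laplacian \<rho> x = 0"
proof -
  let ?h = "\<lambda>_ :: 'n. \<lambda>s. \<zeta> (s / \<rho>)"
  let ?d2 = "\<lambda>s. deriv (deriv \<zeta>) (s / \<rho>)"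
  have d1: "deriv (\<lambda>s. \<zeta> (s / \<rho>)) = (\<lambda>s. 1 / \<rho> * deriv \<zeta> (1 / \<rho> * s + 0))"
    using deriv_affine[OF smooth, of "1 / \<rho>" 0] by simp
  have d2: "deriv (\<lambda>s. 1 / \<rho> * deriv \<zeta> (1 / \<rho> * s + 0)) s = 1 / \<rho>\<^sup>2 * ?d2 s" for s
  proof (rule DERIV_imp_deriv)
    show "((\<lambda>s. 1 / \<rho> * deriv \<zeta> (1 / \<rho> * s + 0)) has_real_derivative 1 / \<rho>\<^sup>2 * ?d2 s) (at s)"
      by (rule DERIV_cong, rule DERIV_cmult, rule DERIV_chain'[OF _ smooth_DERIV[OF smooth_deriv[OF smooth]]])
         (use \<rho> in \<open>auto intro!: derivative_eq_intros simp: power2_eq_square\<close>)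
  qed
  have part: "partial i (partial i (bump \<rho>)) x = 1 / \<rho>\<^sup>2 * tensor (?h(i := ?d2)) x" for i
  proof -
    have s1: "smooth ((?h(i := deriv (?h i))) j)" for j
      using smooth_dilation by (auto intro: smooth_deriv)
    have "partial i (partial i (bump \<rho>)) = tensor (?h(i := deriv (deriv (?h i))))"
      unfolding bump_def partial_tensor[of ?h, OF smooth_dilation]
        partial_tensor[of "?h(i := deriv (?h i))", OF s1] by simp
    also have "deriv (deriv (?h i)) = (\<lambda>s. 1 / \<rho>\<^sup>2 * ?d2 s)"
      unfolding d1 by (rule ext) (rule d2)
    finally show ?thesis
      by (simp only: tensor_upd_scale)
  qed
  have t: "tensor (?h(i := ?d2)) x = ?d2 (x $ i) * (\<Prod>j\<in>UNIV - {i}. \<zeta> (x $ j / \<rho>))" for i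
    unfolding tensor_def by (subst prod.remove[of UNIV i]) auto
  have "\<bar>tensor (?h(i := ?d2)) x\<bar> \<le> C * bump \<rho> x powr (1 / p)" for i
  proof -
    have pr: "v \<le> v powr (1 / p)" if "0 \<le> v" "v \<le> 1" for v
    proof (cases "v = 0")
      case False
      then have "v powr 1 \<le> v powr (1 / p)"
        using that p by (intro powr_mono') auto
      then show ?thesis
        using that by simp
    qed simp
    have "\<bar>tensor (?h(i := ?d2)) x\<bar> = \<bar>?d2 (x $ i)\<bar> * (\<Prod>j\<in>UNIV - {i}. \<zeta> (x $ j / \<rho>))"
      unfolding t abs_mult by (simp add: prod_nonneg nonneg)
    also have "\<dots> \<le> (C * \<zeta> (x $ i / \<rho>) powr (1 / p)) * (\<Prod>j\<in>UNIV - {i}. \<zeta> (x $ j / \<rho>) powr (1 / p))"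
      using d2_bound C by (intro mult_mono prod_mono prod_nonneg) (auto simp: nonneg le_1 pr)
    also have "\<dots> = C * (\<Prod>j\<in>UNIV. \<zeta> (x $ j / \<rho>) powr (1 / p))"
      using prod.remove[of UNIV i "\<lambda>j. \<zeta> (x $ j / \<rho>) powr (1 / p)"] by (simp add: mult.assoc)
    also have "(\<Prod>j\<in>UNIV. \<zeta> (x $ j / \<rho>) powr (1 / p)) = bump \<rho> x powr (1 / p)"
      unfolding bump_def tensor_def by (rule prod_powr_distrib[symmetric])
    finally show ?thesis .
  qed
  then have "\<bar>partial i (partial i (bump \<rho>)) x\<bar> \<le> 1 / \<rho>\<^sup>2 * (C * bump \<rho> x powr (1 / p))" for i
    unfolding part abs_mult using \<rho> by (simp add: divide_right_mono)
  then have "\<bar>bump_laplacian \<rho> x\<bar> \<le> (\<Sum>i\<in>(UNIV :: 'n set). 1 / \<rho>\<^sup>2 * (C * bump \<rho> x powr (1 / p)))"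
    unfolding bump_laplacian_def by (intro order_trans[OF sum_abs sum_mono])
  then show "\<bar>bump_laplacian \<rho> x\<bar> \<le> real CARD('n) * C / \<rho>\<^sup>2 * bump \<rho> x powr (1 / p)"
    by simp
  assume x: "x \<in> cube \<rho>"
  have "?d2 (x $ i) = 0" for i
    using x \<rho> by (intro d2_eq_0) (simp add: cube_def divide_le_eq)
  then show "bump_laplacian \<rho> x = 0"
    unfolding bump_laplacian_def part t by simp
qed

end

section \<open>Blow-up\<close>

text \<open>The inequality is used at two weights. A small l absorbs half of \<open>I\<close> and
  bounds it, so that the increments tend to 0; a large l then brings the constant term below m / 2,
  and the limit gives m <= m / 2.\<close>

lemma telescoping_contradiction:
  fixes I D :: "nat \<Rightarrow> real"
  assumes I: "\<And>k. 0 \<le> I k" "\<And>k. I k \<le> I (Suc k)" and D: "D \<longlonglongrightarrow> m" "0 < m" and q: "0 < p" "0 < q"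
    and K: "0 \<le> K"
    and le: "\<And>k l. 0 < l \<Longrightarrow> I (Suc k) + D (Suc k) \<le> l powr p * (I (Suc k) - I k) + l powr (- q) * K"
  shows False
proof -
  \<comment> \<open>Makes l^p equal to 1 / 2, so that half of \<open>I (Suc k)\<close> can be
    absorbed on the left.\<close>
  define l0 where "l0 = (1 / 2 :: real) powr (1 / p)"
  have l0: "0 < l0" "l0 powr p = 1 / 2"
    using q by (auto simp: l0_def powr_powr)
  obtain B where B: "\<And>k. \<bar>D k\<bar> \<le> B"
    using convergent_imp_Bseq[OF convergentI[OF D(1)]] by (auto simp: Bseq_def)
  have "I (Suc k) \<le> 2 * (l0 powr (- q) * K + B)" for k
  proof -
    have "- B \<le> D (Suc k)"
      using B[of "Suc k"] by linarith
    moreover have "y \<le> 2 * (x + B)" if "y + d \<le> 1 / 2 * (y - i) + x" "- B \<le> d" "0 \<le> i" for x y d i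
      using that by argo
    ultimately show ?thesis
      using le[OF l0(1), of k] I(1)[of k] unfolding l0(2) by blast
  qed
  then have "I k \<le> 2 * (l0 powr (- q) * K + B)" for k
    using I(2)[of k] order_trans by blast
  moreover have "incseq I"
    by (intro incseq_SucI I)
  ultimately obtain L where L: "I \<longlonglongrightarrow> L"
    using incseq_convergent by blast
  \<comment> \<open>Makes l^(-q) K at most m / 2; K + 1 in place of K avoids a division by
    0.\<close>
  define l where "l = (m / (2 * (K + 1))) powr (- 1 / q)"
  have l: "0 < l" "l powr (- q) = m / (2 * (K + 1))"
    using D(2) K q by (auto simp: l_def powr_powr)
  have "l powr (- q) * K \<le> m / 2"
    using D(2) K by (simp add: l field_simps)
  then have "D (Suc k) \<le> l powr p * (I (Suc k) - I k) + m / 2" for k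
    using le[OF l(1), of k] I(1)[of "Suc k"] by linarith
  moreover have "(\<lambda>k. D (Suc k)) \<longlonglongrightarrow> m"
    by (rule LIMSEQ_Suc[OF D(1)])
  moreover have "(\<lambda>k. l powr p * (I (Suc k) - I k) + m / 2) \<longlonglongrightarrow> l powr p * (L - L) + m / 2"
    by (intro tendsto_intros LIMSEQ_Suc L)
  ultimately have "m \<le> l powr p * (L - L) + m / 2"
    by (intro LIMSEQ_le) auto
  then show False
    using D(2) by simp
qed

text \<open>A setting shown to be contradictory. The exponent \<alpha> enters only through its
  inequalities, so both ranges of \<beta> are treated at once; \<open>subcritical\<close> is the
  volume condition with its denominator cleared.\<close>

locale global_solution = profile \<zeta> p C for \<zeta> p C +
  fixes b\<^sub>0 \<beta> \<alpha> :: real and u\<^sub>0 :: "'n::finite H1" and u\<^sub>1 :: "'n L2" and u :: "real \<Rightarrow> 'n H1"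
  assumes b0: "0 < b\<^sub>0"
    and \<alpha>: "1 \<le> \<alpha>" "1 - \<beta> \<le> 2 * \<alpha>"
    and subcritical: "(p - 1) * (real CARD('n) * \<alpha> - 1) \<le> 2"
    and mild: "\<And>T. 0 < T \<Longrightarrow> mild_solution b\<^sub>0 \<beta> p u\<^sub>0 u\<^sub>1 T u"
    and L1: "integrable lborel (fun_of (H1_to_L2 u\<^sub>0))" "integrable lborel (fun_of u\<^sub>1)"
    and mean: "0 < (\<integral>x. fun_of u\<^sub>1 x \<partial>lborel)"
begin

definition source :: "real \<Rightarrow> real \<Rightarrow> real" where
  "source R s = (\<integral>x. \<bar>fun_of (H1_to_L2 (u s)) x\<bar> powr p * bump (R powr \<alpha>) x \<partial>lborel)"

text \<open>The space-time integral I_R of the overview.\<close>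

definition action :: "real \<Rightarrow> real" where
  "action R = integral {0..2 * R} (\<lambda>s. \<zeta> (s / R) * source R s)"

text \<open>The boundary terms at time 0, where the time weight is 1, its derivative is 0 and the
  damping equals \<open>b\<^sub>0\<close>.\<close>

definition data :: "real \<Rightarrow> real" where
  "data R = (\<integral>x. fun_of u\<^sub>1 x * bump (R powr \<alpha>) x \<partial>lborel)
     - b\<^sub>0 * (\<integral>x. fun_of (H1_to_L2 u\<^sub>0) x * bump_laplacian (R powr \<alpha>) x \<partial>lborel)"

text \<open>The function \<open>adj\<close> for the weight \<zeta>(t / R), written out because
  \<open>time_weight\<close> is interpreted anew for each R and T.\<close>

definition adjoint :: "real \<Rightarrow> real \<Rightarrow> real" where
  "adjoint R t = - \<zeta> (t / R) + - (\<beta> * b\<^sub>0) * (1 + t) powr (- \<beta> - 1) * \<zeta> (t / R)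
     + b\<^sub>0 / (1 + t) powr \<beta> * (deriv \<zeta> (t / R) / R)"

text \<open>The summand 1 comes from the undamped Laplacian, the other two from the time derivatives
  of the damping and of the cutoff; the factors 3 stem from 1 + t <= 3 R.\<close>

definition adjoint_const :: real where
  "adjoint_const = 1 + (\<bar>\<beta>\<bar> * b\<^sub>0 + 3 * b\<^sub>0 * C) * 3 powr (2 * \<alpha> - 2)"

text \<open>The adjoint operator applied to the test function at scale R.\<close>

definition dual :: "real \<Rightarrow> real \<Rightarrow> real^'n \<Rightarrow> real" where
  "dual R t x = deriv (deriv \<zeta>) (t / R) / R\<^sup>2 * bump (R powr \<alpha>) x + adjoint R t * bump_laplacian (R powr \<alpha>) x"

definition dual_const :: real where
  "dual_const = C + adjoint_const * real CARD('n) * C"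

text \<open>With \<alpha> >= 1 the volume condition gives n (p - 1) <= p + 1, and p + 1 < 2
  p.\<close>

lemma sobolev_exponent: "real CARD('n) * (p - 1) < 2 * p"
proof -
  have "(p - 1) * real CARD('n) * 1 \<le> (p - 1) * real CARD('n) * \<alpha>"
    using p \<alpha>(1) by (intro mult_left_mono) auto
  then have "(p - 1) * real CARD('n) \<le> 2 + (p - 1)"
    using subcritical by (simp add: algebra_simps)
  then show ?thesis
    using p by (simp add: mult.commute)
qed

lemma adjoint_const_nonneg: "0 \<le> adjoint_const" and dual_const_nonneg: "0 \<le> dual_const"
proof -
  show "0 \<le> adjoint_const"
    unfolding adjoint_const_def using b0 C by (intro add_nonneg_nonneg mult_nonneg_nonneg) auto
  then show "0 \<le> dual_const"
    unfolding dual_const_def using C by simp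
qed

lemma zeta_le_powr: "\<zeta> x \<le> \<zeta> x powr (1 / p)"
proof (cases "\<zeta> x = 0")
  case False
  then have "\<zeta> x powr 1 \<le> \<zeta> x powr (1 / p)"
    using nonneg[of x] le_1[of x] p by (intro powr_mono') auto
  then show ?thesis
    using nonneg[of x] by simp
qed simp

text \<open>The exponent 2 \<alpha> - 2 is at least 0 and at least -\<beta> - 1, so all coefficients
  can be compared with the same power of R.\<close>

lemma adjoint_bound:
  assumes R: "1 \<le> R" and t: "0 \<le> t" "t \<le> 2 * R"
  shows "\<bar>adjoint R t\<bar> \<le> adjoint_const * R powr (2 * \<alpha> - 2) * \<zeta> (t / R) powr (1 / p)"
proof -
  define m where "m = 2 * \<alpha> - 2"
  define Z where "Z = \<zeta> (t / R) powr (1 / p)"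
  have m: "0 \<le> m" "- \<beta> - 1 \<le> m"
    using \<alpha> by (auto simp: m_def)
  have t3: "1 \<le> 1 + t" "1 + t \<le> 3 * R"
    using R t by auto
  have Z: "0 \<le> Z" "\<zeta> (t / R) \<le> Z"
    by (simp_all add: Z_def zeta_le_powr)
  have "(1 + t) powr (- \<beta> - 1) \<le> (1 + t) powr m"
    using t3 m by (intro powr_mono) auto
  also have "\<dots> \<le> (3 * R) powr m"
    using t3 m by (intro powr_mono2) auto
  finally have e1: "(1 + t) powr (- \<beta> - 1) \<le> 3 powr m * R powr m"
    using R by (simp add: powr_mult)
  \<comment> \<open>The extra factor 1 + t, at most 3 R, is paid for by the factor 1 / R from
    differentiating the cutoff in time.\<close>
  have "(1 + t) powr (- \<beta>) = (1 + t) * (1 + t) powr (- \<beta> - 1)"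
    using t3 by (simp add: powr_diff)
  also have "\<dots> \<le> 3 * R * (3 powr m * R powr m)"
    using t3 e1 by (intro mult_mono) auto
  finally have e2: "1 / (1 + t) powr \<beta> \<le> 3 * R * (3 powr m * R powr m)"
    by (simp add: powr_minus_divide)
  have R1: "1 \<le> R powr m"
    using R m by (simp add: ge_one_powr_ge_zero)
  have "\<bar>- \<zeta> (t / R)\<bar> \<le> R powr m * Z"
    using Z R1 mult_mono[OF R1 Z(2)] nonneg[of "t / R"] by simp
  moreover have "\<bar>- (\<beta> * b\<^sub>0) * (1 + t) powr (- \<beta> - 1) * \<zeta> (t / R)\<bar> \<le> \<bar>\<beta>\<bar> * b\<^sub>0 * (3 powr m * R powr m) * Z"
    unfolding abs_mult using Z e1 b0 nonneg[of "t / R"] by (intro mult_mono) (auto simp: abs_mult)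
  moreover have "\<bar>b\<^sub>0 / (1 + t) powr \<beta> * (deriv \<zeta> (t / R) / R)\<bar> \<le> 3 * b\<^sub>0 * C * (3 powr m * R powr m) * Z"
  proof -
    have "\<bar>b\<^sub>0 / (1 + t) powr \<beta> * (deriv \<zeta> (t / R) / R)\<bar> = b\<^sub>0 * (1 / (1 + t) powr \<beta>) * (\<bar>deriv \<zeta> (t / R)\<bar> / R)"
      using b0 R by (simp add: abs_mult)
    also have "\<dots> \<le> b\<^sub>0 * (3 * R * (3 powr m * R powr m)) * (C * Z / R)"
      using b0 R e2 d1_bound[of "t / R"] by (intro mult_mono divide_right_mono) (auto simp: Z_def)
    also have "\<dots> = 3 * b\<^sub>0 * C * (3 powr m * R powr m) * Z"
      using R by simp
    finally show ?thesis .
  qed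
  ultimately have "\<bar>adjoint R t\<bar> \<le> R powr m * Z + \<bar>\<beta>\<bar> * b\<^sub>0 * (3 powr m * R powr m) * Z
      + 3 * b\<^sub>0 * C * (3 powr m * R powr m) * Z"
    unfolding adjoint_def by linarith
  also have "\<dots> = adjoint_const * R powr m * Z"
    by (simp add: adjoint_const_def m_def algebra_simps)
  finally show ?thesis
    by (simp add: m_def Z_def)
qed

text \<open>The loss R^(2 \<alpha> - 2) of the coefficient and the gain R^(-2 \<alpha>) of the
  Laplacian combine to R^(-2), which is also the size of the second time derivative.\<close>

lemma dual_bound:
  assumes R: "1 \<le> R" and t: "0 \<le> t" "t \<le> 2 * R"
  shows "\<bar>dual R t x\<bar> \<le> dual_const / R\<^sup>2 * (\<zeta> (t / R) * bump (R powr \<alpha>) x) powr (1 / p)"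
    and "t \<le> R \<Longrightarrow> x \<in> cube (R powr \<alpha>) \<Longrightarrow> dual R t x = 0"
proof -
  define \<rho> where "\<rho> = R powr \<alpha>"
  have \<rho>: "0 < \<rho>"
    using R by (simp add: \<rho>_def)
  define Z where "Z = \<zeta> (t / R) powr (1 / p)"
  define B where "B = bump \<rho> x powr (1 / p)"
  have bb: "bump \<rho> x \<le> B"
  proof (cases "bump \<rho> x = 0")
    case False
    then have "bump \<rho> x powr 1 \<le> bump \<rho> x powr (1 / p)"
      using bump_range[of \<rho> x] p by (intro powr_mono') auto
    then show ?thesis
      using bump_range[of \<rho> x] by (simp add: B_def)
  qed (simp add: B_def)
  have "\<bar>deriv (deriv \<zeta>) (t / R) / R\<^sup>2 * bump \<rho> x\<bar> \<le> C * Z / R\<^sup>2 * B"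
    unfolding abs_mult abs_divide using bb bump_range[of \<rho> x] d2_bound[of "t / R"] C
    by (intro mult_mono divide_mono) (use R in \<open>auto simp: Z_def\<close>)
  moreover have "\<bar>adjoint R t * bump_laplacian \<rho> x\<bar> \<le> adjoint_const * R powr (2 * \<alpha> - 2) * Z * (real CARD('n) * C / \<rho>\<^sup>2 * B)"
    unfolding abs_mult using adjoint_bound[OF R t] bump_laplacian_bound(1)[OF \<rho>, of x] adjoint_const_nonneg
    by (intro mult_mono) (auto simp: Z_def B_def)
  moreover have "R powr (2 * \<alpha> - 2) / \<rho>\<^sup>2 = 1 / R\<^sup>2"
  proof -
    have "\<rho>\<^sup>2 = R powr (2 * \<alpha>)"
      by (simp add: \<rho>_def power2_eq_square flip: powr_add)
    then show ?thesis
      using R by (simp add: powr_diff)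
  qed
  then have "adjoint_const * R powr (2 * \<alpha> - 2) * Z * (real CARD('n) * C / \<rho>\<^sup>2 * B)
      = adjoint_const * real CARD('n) * C * (1 / R\<^sup>2) * (Z * B)"
    by (metis (no_types, lifting) mult.assoc mult.commute mult.left_commute times_divide_eq_left times_divide_eq_right)
  ultimately have "\<bar>dual R t x\<bar> \<le> C * Z / R\<^sup>2 * B + adjoint_const * real CARD('n) * C * (1 / R\<^sup>2) * (Z * B)"
    unfolding dual_def \<rho>_def[symmetric] by linarith
  also have "\<dots> = dual_const / R\<^sup>2 * (Z * B)"
    by (simp add: dual_const_def algebra_simps add_divide_distrib)
  also have "Z * B = (\<zeta> (t / R) * bump \<rho> x) powr (1 / p)"
    using nonneg bump_range(1) by (simp add: Z_def B_def powr_mult)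
  finally show "\<bar>dual R t x\<bar> \<le> dual_const / R\<^sup>2 * (\<zeta> (t / R) * bump (R powr \<alpha>) x) powr (1 / p)"
    by (simp add: \<rho>_def)
  assume "t \<le> R" "x \<in> cube (R powr \<alpha>)"
  then show "dual R t x = 0"
    using bump_laplacian_bound(2)[OF \<rho>, of x] d2_eq_0[of "t / R"] R t by (simp add: dual_def \<rho>_def)
qed

text \<open>T may be any time from 2 R on, where the time weight has died out; integrals belonging
  to R and to R / 2 can thus be taken over a common interval.\<close>

lemma weak_identity:
  assumes R: "0 < R" and T: "2 * R \<le> T"
  defines "P \<equiv> \<lambda>t. \<integral>x. fun_of (H1_to_L2 (u t)) x * dual R t x \<partial>lborel"
  shows "P integrable_on {0..T}"
    and "((\<lambda>s. \<zeta> (s / R) * source R s) has_integral (integral {0..T} P - data R)) {0..T}"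
    and "s \<in> {0..T} \<Longrightarrow> integrable lborel (\<lambda>x. \<bar>fun_of (H1_to_L2 (u s)) x\<bar> powr p * bump (R powr \<alpha>) x)"
    and "integrable lborel (\<lambda>x. fun_of (H1_to_L2 (u t)) x * dual R t x)"
proof -
  define \<rho> where "\<rho> = R powr \<alpha>"
  have \<rho>: "0 < \<rho>"
    using R by (simp add: \<rho>_def)
  have T0: "0 < T"
    using R T by simp
  have dil: "((\<lambda>t. f (t / R)) has_real_derivative deriv f (t / R) / R) (at t)" if "smooth f" for f t
    using smooth_DERIV[OF that] R
    by (auto intro!: DERIV_cong[OF DERIV_chain'[where g = f and f = "\<lambda>t. t / R"]] derivative_eq_intros)
  have big: "2 \<le> \<bar>T / R\<bar>"
    using R T by (simp add: le_divide_eq)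
  \<comment> \<open>Where \<zeta> vanishes, \<open>d1_bound\<close> forces its derivative to vanish
    too.\<close>
  have z1: "deriv \<zeta> (T / R) = 0"
    using d1_bound[of "T / R"] eq_0[OF big] by simp
  interpret TW: time_weight b\<^sub>0 \<beta> "\<lambda>t. \<zeta> (t / R)" "\<lambda>t. deriv \<zeta> (t / R) / R" "\<lambda>t. deriv (deriv \<zeta>) (t / R) / R\<^sup>2" T
  proof
    show "((\<lambda>t. \<zeta> (t / R)) has_real_derivative deriv \<zeta> (t / R) / R) (at t)" for t
      by (rule dil[OF smooth])
    show "((\<lambda>t. deriv \<zeta> (t / R) / R) has_real_derivative deriv (deriv \<zeta>) (t / R) / R\<^sup>2) (at t)" for t
      using DERIV_cdivide[OF dil[OF smooth_deriv[OF smooth]], of R t] by (simp add: power2_eq_square)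
    show "continuous_on UNIV (\<lambda>t. deriv (deriv \<zeta>) (t / R) / R\<^sup>2)"
    proof (rule continuous_on_divide[OF _ continuous_on_const])
      show "continuous_on UNIV (\<lambda>t. deriv (deriv \<zeta>) (t / R))"
        using smooth_continuous_on[OF smooth_affine[OF smooth_deriv[OF smooth_deriv[OF smooth]], of "1 / R" 0]]
        by simp
    qed (use R in simp)
  qed (use b0 eq_0[OF big] z1 in auto)
  note bw = bump_weak_laplacian[OF \<rho>, where 'n = 'n]
  have adj: "TW.adj t = adjoint R t" for t
    by (simp add: TW.adj_def TW.damping_def TW.damping'_def adjoint_def)
  have int: "integrable lborel (\<lambda>x. fun_of f x * bump \<rho> x)" "integrable lborel (\<lambda>x. fun_of f x * bump_laplacian \<rho> x)" for f :: "'n L2"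
    by (intro sq_integrable_mult fun_of_sq_integrable bw)+
  have eq: "(\<lambda>x. fun_of f x * dual R t x) = (\<lambda>x. deriv (deriv \<zeta>) (t / R) / R\<^sup>2 * (fun_of f x * bump \<rho> x)
      + adjoint R t * (fun_of f x * bump_laplacian \<rho> x))" for f t
    by (simp add: dual_def \<rho>_def algebra_simps)
  have pair: "TW.pairing (abs_L2 (bump \<rho>)) (abs_L2 (bump_laplacian \<rho>)) t f = (\<integral>x. fun_of f x * dual R t x \<partial>lborel)" for t and f :: "'n L2"
    unfolding eq TW.pairing_def adj inner_abs_L2[OF bw(1)] inner_abs_L2[OF bw(2)]
    using int[of f] by simp
  have dat: "TW.data_pairing (abs_L2 (bump \<rho>)) (abs_L2 (bump_laplacian \<rho>)) 0 (H1_to_L2 u\<^sub>0) u\<^sub>1 = data R"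
    unfolding TW.data_pairing_def inner_abs_L2[OF bw(1)] inner_abs_L2[OF bw(2)]
    by (simp add: TW.damping_def data_def eq_1 d1_eq_0 \<rho>_def)
  show "integrable lborel (\<lambda>x. fun_of (H1_to_L2 (u t)) x * dual R t x)"
    unfolding eq using int by simp
  have uc: "continuous_on {0..T} (\<lambda>t. H1_to_L2 (u t))"
    using mild[OF T0] by (intro bounded_linear.continuous_on[OF bounded_linear_H1_to_L2]) (simp add: mild_solution_def)
  show "P integrable_on {0..T}"
    using integrable_continuous_real[OF TW.continuous_on_pairing[OF uc order_refl, of "abs_L2 (bump \<rho>)" "abs_L2 (bump_laplacian \<rho>)"]]
    by (simp add: pair P_def)
  show "((\<lambda>s. \<zeta> (s / R) * source R s) has_integral (integral {0..T} P - data R)) {0..T}"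
    using TW.mild_solution_weak(1)[OF mild[OF T0] T0 p sobolev_exponent bw(1,3)]
    unfolding pair dat by (simp add: P_def source_def \<rho>_def)
  show "integrable lborel (\<lambda>x. \<bar>fun_of (H1_to_L2 (u s)) x\<bar> powr p * bump (R powr \<alpha>) x)" if "s \<in> {0..T}"
    using TW.mild_solution_weak(2)[OF mild[OF T0] T0 p sobolev_exponent bw(1,3) that] by (simp add: \<rho>_def)
qed

lemma action_has_integral:
  assumes R: "0 < R" and T: "2 * R \<le> T"
  shows "((\<lambda>s. \<zeta> (s / R) * source R s) has_integral action R) {0..T}"
proof -
  let ?f = "\<lambda>s. \<zeta> (s / R) * source R s"
  have "(?f has_integral action R) {0..2 * R}"
    unfolding action_def by (rule integrable_integral[OF has_integral_integrable[OF weak_identity(2)[OF R order_refl]]])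
  moreover have "(?f has_integral 0) {2 * R..T}"
  proof (rule has_integral_is_0)
    fix s assume "s \<in> {2 * R..T}"
    then have "2 \<le> \<bar>s / R\<bar>"
      using R by (simp add: le_divide_eq)
    then show "?f s = 0"
      by (simp add: eq_0)
  qed
  ultimately show ?thesis
    using has_integral_combine[of 0 "2 * R" T ?f "action R" 0] R T by simp
qed

text \<open>The test function of scale R / 2 is supported where that of scale R equals 1. In space
  this rests on 2 (R / 2)^\<alpha> <= R^\<alpha>, a consequence of \<alpha> >= 1.\<close>

lemma dilation_mono:
  fixes x :: "real^'n"
  assumes R: "1 \<le> R" and t: "0 \<le> t"
  shows "\<zeta> (t / (R / 2)) * bump ((R / 2) powr \<alpha>) x \<le> \<zeta> (t / R) * bump (R powr \<alpha>) x"
    and "\<not> (t \<le> R \<and> x \<in> cube (R powr \<alpha>)) \<Longrightarrow> \<zeta> (t / (R / 2)) * bump ((R / 2) powr \<alpha>) x = 0"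
proof -
  show out: "\<zeta> (t / (R / 2)) * bump ((R / 2) powr \<alpha>) x = 0" if "\<not> (t \<le> R \<and> x \<in> cube (R powr \<alpha>))"
  proof (cases "t \<le> R")
    case False
    then show ?thesis
      using R by (simp add: eq_0 field_simps)
  next
    case True
    have "2 * (R / 2) powr \<alpha> \<le> 2 powr \<alpha> * (R / 2) powr \<alpha>"
      using powr_mono[of 1 \<alpha> 2] \<alpha> by (intro mult_right_mono) auto
    also have "\<dots> = R powr \<alpha>"
      using R by (simp flip: powr_mult)
    finally have "cube (2 * (R / 2) powr \<alpha>) \<subseteq> (cube (R powr \<alpha>) :: (real^'n) set)"
      by (auto simp: cube_def intro: order_trans)
    then have "x \<notin> cube (2 * (R / 2) powr \<alpha>)"
      using that True by blast
    then show ?thesis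
      using R by (simp add: bump_eq_0)
  qed
  show "\<zeta> (t / (R / 2)) * bump ((R / 2) powr \<alpha>) x \<le> \<zeta> (t / R) * bump (R powr \<alpha>) x"
  proof (cases "t \<le> R \<and> x \<in> cube (R powr \<alpha>)")
    case True
    then have "\<zeta> (t / R) * bump (R powr \<alpha>) x = 1"
      using R t bump_eq_1[of "R powr \<alpha>" x] by (simp add: eq_1)
    moreover have "\<zeta> (t / (R / 2)) * bump ((R / 2) powr \<alpha>) x \<le> 1"
      by (intro mult_le_one le_1 bump_range)
    ultimately show ?thesis
      by simp
  next
    case False
    then show ?thesis
      unfolding out[OF False] by (intro mult_nonneg_nonneg nonneg bump_range)
  qed
qed

lemma source_mono:
  assumes R: "1 \<le> R" and t: "0 \<le> t"
  shows "\<zeta> (t / (R / 2)) * source (R / 2) t \<le> \<zeta> (t / R) * source R t"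
proof -
  have i: "integrable lborel (\<lambda>x. \<bar>fun_of (H1_to_L2 (u t)) x\<bar> powr p * bump (r powr \<alpha>) x)" if "0 < r" for r
    by (rule weak_identity(3)[OF that, of "max (2 * r) t"]) (use t in auto)
  have "(\<integral>x. \<zeta> (t / (R / 2)) * (\<bar>fun_of (H1_to_L2 (u t)) x\<bar> powr p * bump ((R / 2) powr \<alpha>) x) \<partial>lborel)
      \<le> (\<integral>x. \<zeta> (t / R) * (\<bar>fun_of (H1_to_L2 (u t)) x\<bar> powr p * bump (R powr \<alpha>) x) \<partial>lborel)"
  proof (rule integral_mono)
    fix x
    show "\<zeta> (t / (R / 2)) * (\<bar>fun_of (H1_to_L2 (u t)) x\<bar> powr p * bump ((R / 2) powr \<alpha>) x)
        \<le> \<zeta> (t / R) * (\<bar>fun_of (H1_to_L2 (u t)) x\<bar> powr p * bump (R powr \<alpha>) x)"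
      using mult_left_mono[OF dilation_mono(1)[OF R t, of x], of "\<bar>fun_of (H1_to_L2 (u t)) x\<bar> powr p"]
      by (simp add: mult_ac)
  qed (use i R in \<open>auto intro!: integrable_mult_right\<close>)
  then show ?thesis
    by (simp add: source_def)
qed

lemma action_mono:
  assumes R: "1 \<le> R"
  shows "0 \<le> action (R / 2)" "action (R / 2) \<le> action R"
proof -
  have I: "((\<lambda>s. \<zeta> (s / (R / 2)) * source (R / 2) s) has_integral action (R / 2)) {0..2 * R}"
    "((\<lambda>s. \<zeta> (s / R) * source R s) has_integral action R) {0..2 * R}"
    using R by (intro action_has_integral; simp)+
  show "0 \<le> action (R / 2)"
    by (rule has_integral_nonneg[OF I(1)]) (auto simp: source_def bump_range nonneg)
  show "action (R / 2) \<le> action R"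
    by (rule has_integral_le[OF I]) (use source_mono[OF R] in auto)
qed

text \<open>Pointwise there are two cases. For t <= R and x in the inner cube \<open>dual\<close>
  vanishes. Elsewhere the test function of scale R / 2 vanishes, so |u|^p times that of scale R
  belongs entirely to the increment, and Young's inequality applies. In the constant, 2 and 4^n come
  from the length 2 R of the time interval and the side 4 R^\<alpha> of the cube.\<close>

lemma action_inequality:
  assumes R: "1 \<le> R" and l: "0 < l"
  defines "q \<equiv> p / (p - 1)"
  shows "action R + data R \<le> l powr p * (action R - action (R / 2))
    + l powr (- q) * (2 * 4 ^ CARD('n) * dual_const powr q)"
proof -
  define \<rho> where "\<rho> = R powr \<alpha>"
  have \<rho>: "0 < \<rho>"
    using R by (simp add: \<rho>_def)
  have q: "1 < q" "1 / p + 1 / q = 1"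
    using p by (auto simp: q_def field_simps)
  \<comment> \<open>The second term of Young's inequality with weight l; it is constant in t and
    x.\<close>
  define c where "c = (dual_const / R\<^sup>2 / l) powr q"
  let ?U = "\<lambda>t x. \<bar>fun_of (H1_to_L2 (u t)) x\<bar>"
  define P where "P t = (\<integral>x. fun_of (H1_to_L2 (u t)) x * dual R t x \<partial>lborel)" for t
  have point: "fun_of (H1_to_L2 (u t)) x * dual R t x \<le> l powr p * (\<zeta> (t / R) * (?U t x powr p * bump \<rho> x)
      - \<zeta> (t / (R / 2)) * (?U t x powr p * bump ((R / 2) powr \<alpha>) x)) + c * indicator (cube (2 * \<rho>)) x"
    if t: "0 \<le> t" "t \<le> 2 * R" for t x
  proof (cases "t \<le> R \<and> x \<in> cube \<rho>")
    case True
    then have "dual R t x = 0"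
      using dual_bound(2)[OF R t] by (simp add: \<rho>_def)
    moreover have "0 \<le> ?U t x powr p * (\<zeta> (t / R) * bump \<rho> x - \<zeta> (t / (R / 2)) * bump ((R / 2) powr \<alpha>) x)"
      using dilation_mono(1)[OF R t(1), of x] by (intro mult_nonneg_nonneg) (auto simp: \<rho>_def)
    then have "0 \<le> l powr p * (\<zeta> (t / R) * (?U t x powr p * bump \<rho> x)
      - \<zeta> (t / (R / 2)) * (?U t x powr p * bump ((R / 2) powr \<alpha>) x))"
      by (intro mult_nonneg_nonneg) (simp_all add: algebra_simps)
    moreover have "0 \<le> c * indicator (cube (2 * \<rho>)) x"
      by (simp add: c_def)
    ultimately show ?thesis
      by simp
  next
    case False
    define w where "w = \<zeta> (t / R) * bump \<rho> x"
    have w: "0 \<le> w"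
      by (simp add: w_def nonneg bump_range)
    have zero: "\<zeta> (t / (R / 2)) * (?U t x powr p * bump ((R / 2) powr \<alpha>) x) = 0"
      using dilation_mono(2)[OF R t(1), of x] False by (auto simp: \<rho>_def)
    have d: "\<bar>dual R t x\<bar> \<le> dual_const / R\<^sup>2 * w powr (1 / p)"
      using dual_bound(1)[OF R t, of x] by (simp add: w_def \<rho>_def)
    show ?thesis
    proof (cases "x \<in> cube (2 * \<rho>)")
      case True
      have "fun_of (H1_to_L2 (u t)) x * dual R t x \<le> ?U t x * \<bar>dual R t x\<bar>"
        by (metis abs_ge_self abs_mult)
      also have "\<dots> \<le> ?U t x * (dual_const / R\<^sup>2 * w powr (1 / p))"
        by (intro mult_left_mono d) simp
      also have "\<dots> = (l * ?U t x * w powr (1 / p)) * (dual_const / R\<^sup>2 / l)"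
        using l by simp
      also have "\<dots> \<le> (l * ?U t x * w powr (1 / p)) powr p / p + (dual_const / R\<^sup>2 / l) powr q / q"
        using l dual_const_nonneg p q by (intro Youngs_inequality) auto
      also have "\<dots> \<le> (l * ?U t x * w powr (1 / p)) powr p + (dual_const / R\<^sup>2 / l) powr q"
        using p q by (intro add_mono) (auto simp: divide_le_eq mult_le_cancel_left1)
      also have "(l * ?U t x * w powr (1 / p)) powr p = l powr p * (?U t x powr p * w)"
        using l w p by (simp add: powr_mult powr_powr)
      finally show ?thesis
        unfolding zero using True by (simp add: c_def w_def mult_ac)
    next
      case out: False
      then have "w = 0"
        using bump_eq_0[OF \<rho>, of x] by (simp add: w_def)
      then have "dual R t x = 0"
        using d p by simp
      then show ?thesis
        unfolding zero using out by (simp add: nonneg bump_range)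
    qed
  qed
  have ind: "integrable lborel (indicator (cube (2 * \<rho>)) :: real^'n \<Rightarrow> real)"
    "(\<integral>x. indicator (cube (2 * \<rho>)) x \<partial>(lborel :: (real^'n) measure)) = (4 * \<rho>) ^ CARD('n)"
    using integrable_indicator_cube[of "2 * \<rho>" "0 :: real^'n"] \<rho> by simp_all
  have PJ: "P t \<le> l powr p * (\<zeta> (t / R) * source R t - \<zeta> (t / (R / 2)) * source (R / 2) t) + c * (4 * \<rho>) ^ CARD('n)"
    if t: "t \<in> {0..2 * R}" for t
  proof -
    have i: "integrable lborel (\<lambda>x. ?U t x powr p * bump \<rho> x)"
      "integrable lborel (\<lambda>x. ?U t x powr p * bump ((R / 2) powr \<alpha>) x)"
      unfolding \<rho>_def using R t by (intro weak_identity(3)[where T = "2 * R"]; simp)+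
    have "P t \<le> (\<integral>x. l powr p * (\<zeta> (t / R) * (?U t x powr p * bump \<rho> x)
      - \<zeta> (t / (R / 2)) * (?U t x powr p * bump ((R / 2) powr \<alpha>) x)) + c * indicator (cube (2 * \<rho>)) x \<partial>lborel)"
      unfolding P_def
    proof (rule integral_mono)
      show "integrable lborel (\<lambda>x. fun_of (H1_to_L2 (u t)) x * dual R t x)"
        using R by (intro weak_identity(4)[where T = "2 * R"]) auto
    qed (use i ind point t in auto)
    also have "\<dots> = l powr p * (\<zeta> (t / R) * source R t - \<zeta> (t / (R / 2)) * source (R / 2) t) + c * (4 * \<rho>) ^ CARD('n)"
      using i ind by (simp add: source_def \<rho>_def)
    finally show ?thesis .
  qed
  have R0: "0 < R" "2 * R \<le> 2 * R" "0 < R / 2" "2 * (R / 2) \<le> 2 * R"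
    using R by auto
  have "action R = integral {0..2 * R} P - data R"
    using has_integral_unique[OF action_has_integral[OF R0(1,2)] weak_identity(2)[OF R0(1,2)]]
    by (simp add: P_def[abs_def])
  moreover have "integral {0..2 * R} P \<le> l powr p * (action R - action (R / 2)) + c * (4 * \<rho>) ^ CARD('n) * (2 * R)"
  proof (rule has_integral_le)
    show "(P has_integral integral {0..2 * R} P) {0..2 * R}"
      using weak_identity(1)[OF R0(1,2)] by (simp add: P_def[abs_def] has_integral_integral)
    show "((\<lambda>t. l powr p * (\<zeta> (t / R) * source R t - \<zeta> (t / (R / 2)) * source (R / 2) t) + c * (4 * \<rho>) ^ CARD('n))
        has_integral (l powr p * (action R - action (R / 2)) + c * (4 * \<rho>) ^ CARD('n) * (2 * R))) {0..2 * R}"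
      using has_integral_const_real[of "c * (4 * \<rho>) ^ CARD('n)" 0 "2 * R"] R
      by (intro has_integral_add has_integral_mult_right has_integral_diff action_has_integral R0)
         (simp add: mult.commute)
  qed (use PJ in auto)
  moreover have "c * (4 * \<rho>) ^ CARD('n) * (2 * R) \<le> l powr (- q) * (2 * 4 ^ CARD('n) * dual_const powr q)"
  proof -
    \<comment> \<open>The total power of R, collected from the time interval, the cube and the
      factor R^(-2) of \<open>dual\<close> raised to q; \<open>subcritical\<close> makes it
      nonpositive.\<close>
    define e where "e = 1 + real CARD('n) * \<alpha> - 2 * q"
    have "e \<le> 0"
      using subcritical p by (simp add: e_def q_def field_simps)
    have "\<rho> ^ CARD('n) = R powr (real CARD('n) * \<alpha>)"
      using \<rho> by (simp add: \<rho>_def powr_powr mult.commute flip: powr_realpow)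
    moreover have "c = dual_const powr q * R powr (- 2 * q) * l powr (- q)"
    proof -
      have "(R\<^sup>2) powr q = R powr (2 * q)"
        using R by (simp add: powr_powr flip: powr_numeral)
      then show ?thesis
        using R l dual_const_nonneg by (simp add: c_def powr_divide powr_mult powr_minus_divide)
    qed
    ultimately have "c * (4 * \<rho>) ^ CARD('n) * (2 * R)
        = l powr (- q) * (2 * 4 ^ CARD('n) * dual_const powr q) * (R powr 1 * R powr (real CARD('n) * \<alpha>) * R powr (- 2 * q))"
      using R by (simp add: power_mult_distrib mult_ac)
    also have "R powr 1 * R powr (real CARD('n) * \<alpha>) * R powr (- 2 * q) = R powr e"
      unfolding powr_add[symmetric] by (simp add: e_def)
    also have "R powr e \<le> 1"
      using powr_mono[OF \<open>e \<le> 0\<close> R] R by simp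
    finally show ?thesis
      by (simp add: mult_left_mono)
  qed
  ultimately show ?thesis
    by linarith
qed

text \<open>At each x the cutoff is eventually 1 and its Laplacian eventually 0, and both are
  bounded uniformly in k; integrability of the data then provides the domination.\<close>

lemma data_tendsto: "(\<lambda>k. data (2 ^ k)) \<longlonglongrightarrow> (\<integral>x. fun_of u\<^sub>1 x \<partial>lborel)"
proof -
  let ?\<rho> = "\<lambda>k. (2 ^ k) powr \<alpha> :: real"
  have \<rho>: "0 < ?\<rho> k" "1 \<le> ?\<rho> k" for k
    using \<alpha> by (auto intro!: ge_one_powr_ge_zero)
  have ev: "\<forall>\<^sub>F k in sequentially. x \<in> cube (?\<rho> k)" for x :: "real^'n"
  proof -
    obtain N where N: "norm x \<le> 2 ^ N"
      using real_arch_pow[of 2 "norm x"] by (auto intro: less_imp_le)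
    show ?thesis
    proof (rule eventually_sequentiallyI)
      fix k assume "N \<le> k"
      have "norm x \<le> 2 ^ k"
        using N power_increasing[OF \<open>N \<le> k\<close>, of "2 :: real"] by linarith
      also have "(2 ^ k :: real) \<le> ?\<rho> k"
        using powr_mono[of 1 \<alpha> "2 ^ k"] \<alpha> by simp
      finally show "x \<in> cube (?\<rho> k)"
        unfolding cube_def using component_le_norm_cart[of x] order_trans by blast
    qed
  qed
  have m: "(bump r :: real^'n \<Rightarrow> real) \<in> borel_measurable borel" "(bump_laplacian r :: real^'n \<Rightarrow> real) \<in> borel_measurable borel"
    if "0 < r" for r
    using bump_weak_laplacian(1,2)[OF that, where 'n = 'n] by (auto simp: sq_integrable_def)
  have m' [measurable]: "(bump (?\<rho> k) :: real^'n \<Rightarrow> real) \<in> borel_measurable borel"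
    "(bump_laplacian (?\<rho> k) :: real^'n \<Rightarrow> real) \<in> borel_measurable borel" for k
    by (intro m \<rho>)+
  have "(\<lambda>k. \<integral>x. fun_of u\<^sub>1 x * bump (?\<rho> k) x \<partial>lborel) \<longlonglongrightarrow> (\<integral>x. fun_of u\<^sub>1 x \<partial>lborel)"
  proof (rule integral_dominated_convergence[where w = "\<lambda>x. \<bar>fun_of u\<^sub>1 x\<bar>"])
    show "AE x in lborel. (\<lambda>k. fun_of u\<^sub>1 x * bump (?\<rho> k) x) \<longlonglongrightarrow> fun_of u\<^sub>1 x"
    proof (rule AE_I2, rule tendsto_eventually)
      show "\<forall>\<^sub>F k in sequentially. fun_of u\<^sub>1 x * bump (?\<rho> k) x = fun_of u\<^sub>1 x" for x
        using ev[of x] by eventually_elim (simp add: bump_eq_1)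
    qed
    show "AE x in lborel. norm (fun_of u\<^sub>1 x * bump (?\<rho> k) x) \<le> \<bar>fun_of u\<^sub>1 x\<bar>" for k
      by (auto simp: abs_mult abs_of_nonneg[OF bump_range(1)] bump_range intro!: AE_I2 mult_left_le)
  qed (use L1 in auto)
  moreover have "(\<lambda>k. \<integral>x. fun_of (H1_to_L2 u\<^sub>0) x * bump_laplacian (?\<rho> k) x \<partial>lborel)
      \<longlonglongrightarrow> (\<integral>x. 0 \<partial>(lborel :: (real^'n) measure))"
  proof (rule integral_dominated_convergence[where w = "\<lambda>x. real CARD('n) * C * \<bar>fun_of (H1_to_L2 u\<^sub>0) x\<bar>"])
    show "AE x in lborel. (\<lambda>k. fun_of (H1_to_L2 u\<^sub>0) x * bump_laplacian (?\<rho> k) x) \<longlonglongrightarrow> 0"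
    proof (rule AE_I2, rule tendsto_eventually)
      show "\<forall>\<^sub>F k in sequentially. fun_of (H1_to_L2 u\<^sub>0) x * bump_laplacian (?\<rho> k) x = 0" for x
        using ev[of x] by eventually_elim (simp add: bump_laplacian_bound(2))
    qed
    show "AE x in lborel. norm (fun_of (H1_to_L2 u\<^sub>0) x * bump_laplacian (?\<rho> k) x)
        \<le> real CARD('n) * C * \<bar>fun_of (H1_to_L2 u\<^sub>0) x\<bar>" for k
    proof (rule AE_I2)
      fix x :: "real^'n"
      have "\<bar>bump_laplacian (?\<rho> k) x\<bar> \<le> real CARD('n) * C / (?\<rho> k)\<^sup>2 * bump (?\<rho> k) x powr (1 / p)"
        by (rule bump_laplacian_bound(1)[OF \<rho>(1)])
      also have "\<dots> \<le> real CARD('n) * C / 1 * 1"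
        using C \<rho>(2)[of k] bump_range[of "?\<rho> k" x] p
        by (intro mult_mono divide_left_mono powr_le1) auto
      finally have "\<bar>fun_of (H1_to_L2 u\<^sub>0) x\<bar> * \<bar>bump_laplacian (?\<rho> k) x\<bar>
          \<le> \<bar>fun_of (H1_to_L2 u\<^sub>0) x\<bar> * (real CARD('n) * C)"
        by (intro mult_left_mono) auto
      then show "norm (fun_of (H1_to_L2 u\<^sub>0) x * bump_laplacian (?\<rho> k) x)
          \<le> real CARD('n) * C * \<bar>fun_of (H1_to_L2 u\<^sub>0) x\<bar>"
        by (simp add: abs_mult mult.commute)
    qed
  qed (use L1 in auto)
  ultimately have "(\<lambda>k. data (2 ^ k)) \<longlonglongrightarrow> (\<integral>x. fun_of u\<^sub>1 x \<partial>lborel) - b\<^sub>0 * (\<integral>x. 0 \<partial>(lborel :: (real^'n) measure))"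
    unfolding data_def by (intro tendsto_intros)
  then show ?thesis
    by simp
qed

text \<open>The radii are powers of 2, so that R / 2 is the previous radius and the increments
  telescope.\<close>

lemma contradiction: False
proof (rule telescoping_contradiction)
  have two: "(1 :: real) \<le> 2 ^ Suc k" "(2 :: real) ^ Suc k / 2 = 2 ^ k" for k
    by (simp_all add: one_le_power del: power_Suc) (simp add: power_Suc)
  show "0 \<le> action (2 ^ k)" "action (2 ^ k) \<le> action (2 ^ Suc k)" for k
    using action_mono[OF two(1), of k] unfolding two(2) by auto
  show "action (2 ^ Suc k) + data (2 ^ Suc k) \<le> l powr p * (action (2 ^ Suc k) - action (2 ^ k))
      + l powr (- (p / (p - 1))) * (2 * 4 ^ CARD('n) * dual_const powr (p / (p - 1)))" if "0 < l" for k l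
    using action_inequality[OF two(1) that, of k] unfolding two(2) .
qed (use data_tendsto mean p in auto)

end

theorem theorem1:
  fixes n :: nat and \<beta> b\<^sub>0 p :: real
    and u\<^sub>0 :: "'n::finite H1" and u\<^sub>1 :: "'n L2"
    and u :: "real \<Rightarrow> 'n H1" and T\<^sub>m\<^sub>a\<^sub>x :: ereal
  assumes "n = CARD('n)" and "b\<^sub>0 > 0" and "p > 1"
    and "n \<ge> 3 \<Longrightarrow> p \<le> real n / (real n - 2)"
    and "integrable lborel (fun_of (H1_to_L2 u\<^sub>0))"
    and "integrable lborel (fun_of u\<^sub>1)"
    and "(\<integral>x. fun_of u\<^sub>1 x \<partial>lborel) > 0"
    and "\<beta> \<ge> -1 \<Longrightarrow> le_ratio_pos p (real n + 1) (real n - 1)"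
    and "\<beta> \<le> -1 \<Longrightarrow> le_ratio_pos p (real n * (1 - \<beta>) + 2) (real n * (1 - \<beta>) - 2)"
    and "maximal_mild_solution b\<^sub>0 \<beta> p u\<^sub>0 u\<^sub>1 T\<^sub>m\<^sub>a\<^sub>x u"
  shows "T\<^sub>m\<^sub>a\<^sub>x < \<infinity>"
proof (rule ccontr)
  assume "\<not> T\<^sub>m\<^sub>a\<^sub>x < \<infinity>"
  then have mild: "mild_solution b\<^sub>0 \<beta> p u\<^sub>0 u\<^sub>1 T u" if "0 < T" for T
    using assms(10) that by (simp add: maximal_mild_solution_def)
  obtain \<zeta> C where "profile \<zeta> p C"
    using profile_exists[OF assms(3)] by blast
  \<comment> \<open>The test functions live on \<open>t \<lesssim> R\<close>, \<open>|x| \<lesssim> R\<^sup>\<alpha>\<close>.\<close>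
  define \<alpha> where "\<alpha> = max 1 ((1 - \<beta>) / 2)"
  \<comment> \<open>Clears the denominator, including the convention for b <= 0, where the left side
    is nonpositive. In the two uses a - b equals 2 and 4.\<close>
  have ratio: "(p - 1) * b \<le> a - b" if "le_ratio_pos p a b" "0 \<le> a - b" for a b
  proof (cases "b \<le> 0")
    case True
    then have "(p - 1) * b \<le> 0"
      using assms(3) by (intro mult_nonneg_nonpos) auto
    then show ?thesis
      using that(2) by linarith
  next
    case False
    then have "p * b \<le> a"
      using that(1) by (simp add: le_ratio_pos_def max_def le_divide_eq)
    then show ?thesis
      by (simp add: algebra_simps)
  qed
  have "(p - 1) * (real CARD('n) * \<alpha> - 1) \<le> 2"
  proof (cases "\<beta> \<ge> -1")
    case True
    then show ?thesis
      using ratio[OF assms(8)] assms(1) by (simp add: \<alpha>_def max_def)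
  next
    case False
    then have \<alpha>: "\<alpha> = (1 - \<beta>) / 2"
      by (simp add: \<alpha>_def max_def)
    have "real n * \<alpha> - 1 = (real n * (1 - \<beta>) - 2) / 2"
      unfolding \<alpha> by simp
    then have "(p - 1) * (real n * \<alpha> - 1) = (p - 1) * (real n * (1 - \<beta>) - 2) / 2"
      by simp
    moreover have "(p - 1) * (real n * (1 - \<beta>) - 2) \<le> 4"
      using ratio[OF assms(9)] False by simp
    ultimately show ?thesis
      unfolding assms(1) by linarith
  qed
  moreover have "1 \<le> \<alpha>" "1 - \<beta> \<le> 2 * \<alpha>"
    by (auto simp: \<alpha>_def max_def)
  ultimately interpret global_solution \<zeta> p C b\<^sub>0 \<beta> \<alpha> u\<^sub>0 u\<^sub>1 u
    using \<open>profile \<zeta> p C\<close> assms mild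
    by (auto simp: global_solution_def global_solution_axioms_def)
  show False
    by (rule contradiction)
qed

end
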